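(* Let $\pi_{p,1},\pi_{p,2}$ be unramified $H_p$-representations of Whittaker type with $\omega_{\pi_{p,1}}\neq\omega_{\pi_{p,2}}^{-1}$, and $\Pi_p=\pi_{p,1}\otimes\pi_{p,2}$. Assume the spherical Hecke eigensystem $\Theta_{\Pi_p}$ maps $\mathcal{H}^\circ_{G_p}(\mathcal{R})$ into $\mathcal{R}$ for some $\mathbf{Z}[1/p]$-algebra $\mathcal{R}\subseteq\mathbf{C}$. Let $\mathcal{Z}$ be a non-zero element of $\mathrm{Hom}_{P_p}(\Pi_p,\delta_P)$ normalized by $\mathcal{Z}(W^{\mathrm{sph}}_{\pi_{p,1}}\otimes W^{\mathrm{sph}}_{\pi_{p,2}})=L(\omega_{\Pi_p},0)^{-1}$. Then: (1) $\mathcal{Z}$ takes values in $\mathcal{R}$ on the lattice $\mathrm{span}_{\mathcal{R}}\{\mathrm{vol}_{P_p}(P_p\cap gG_p^\circ g^{-1})^{-1}\,g\cdot(W^{\mathrm{sph}}_{\pi_{p,1}}\otimes W^{\mathrm{sph}}_{\pi_{p,2}}):g\in G_p\}$; (2) $\mathcal{Z}$ takes values in the ideal $(p-1,L(\pi_{p,1}\boxtimes\pi_{p,2},0)^{-1})\subseteq\mathcal{R}$ on the lattice $\mathrm{span}_{\mathcal{R}}\{\mathrm{vol}_{P_p}(P_p(1)\cap gG_p^\circ g^{-1})^{-1}\,g\cdot(W^{\mathrm{sph}}_{\pi_{p,1}}\otimes W^{\mathrm{sph}}_{\pi_{p,2}}):g\in G_p\}$.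
   Context: Let $p$ be a prime, $H_p=\mathrm{GL}_2(\mathbf{Q}_p)$, $H_p^\circ=\mathrm{GL}_2(\mathbf{Z}_p)$, $G_p=H_p\times H_p$, $G_p^\circ=H_p^{\circ}\times H_p^\circ$, $H_p\subset G_p$ diagonally. $\mathcal{H}^\circ_{G_p}(\mathcal{R})$ is the ring of $\mathcal{R}$-valued compactly supported $G_p^\circ$-bi-invariant functions on $G_p$. An $H_p$-representation is of Whittaker type if it is irreducible generic or a twist of the reducible principal series containing the Steinberg representation as a codimension-one subrepresentation; unramified if it has a nonzero $H_p^\circ$-fixed vector. Fix $\psi$ additive of conductor one; $\pi_{p,1}$ (resp. $\pi_{p,2}$) is realized in its Whittaker model w.r.t. $\psi$ (resp. $\psi^{-1}$), and $W^{\mathrm{sph}}_{\pi_{p,i}}$ is the spherical Whittaker function with value $1$ at $1$. $G_p$ acts on $\Pi_p$ by $(g_1,g_2)(W_1\otimes W_2)=g_1W_1\otimes g_2W_2$; $\Theta_{\Pi_p}$ is the character of the spherical Hecke algebra on $W^{\mathrm{sph}}_{\pi_{p,1}}\otimes W^{\mathrm{sph}}_{\pi_{p,2}}$. $\omega_\pi$ is the central character, $\omega_{\Pi_p}=\omega_{\pi_{p,1}}\omega_{\pi_{p,2}}$, $L(\omega,s)=(1-\omega(p)p^{-s})^{-1}$; $L(\pi_{p,1}\boxtimes\pi_{p,2},s)$ is the Rankin–Selberg local $L$-factor. $P_p=\{\left(\begin{smallmatrix}a&b\\0&1\end{smallmatrix}\right)\}$, acting on $\Pi_p$ diagonally, $\delta_P\left(\begin{smallmatrix}a&b\\0&1\end{smallmatrix}\right)=|a|_p$,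 $\mathrm{Hom}_{P_p}(\Pi_p,\delta_P)$ the linear forms $\lambda$ with $\lambda(xv)=\delta_P(x)\lambda(v)$. $\mathrm{vol}_{P_p}$ is Haar measure on $P_p$ with $P_p\cap\mathrm{GL}_2(\mathbf{Z}_p)$ of volume $1$ (left and right give the same values here); $P_p\cap gG_p^\circ g^{-1}$ is taken via the diagonal embedding; $P_p(1)=\{x\in P_p:\det x\in1+p\mathbf{Z}_p\}$. *)

theory Defs
  imports "HOL-Analysis.Analysis" "HOL-Computational_Algebra.Polynomial"
begin

section \<open>The field of p-adic numbers\<close>

text \<open>
  The pair of a field type and \<open>nv\<close> is a completion of the rational numbers with respect
  to the p-adic absolute value normalised by \<open>|p| = 1/p\<close>. This determines it up to a unique
  isometric isomorphism. (By Ostrowski, a non-archimedean absolute value with \<open>|p| = 1/p\<close>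
  restricts to the p-adic one on the rational numbers.)
\<close>

definition padic_field :: "nat \<Rightarrow> ('k::field_char_0 \<Rightarrow> real) \<Rightarrow> bool" where
  "padic_field p nv \<longleftrightarrow>
     prime p \<and>
     (\<forall>x. nv x \<ge> 0) \<and> (\<forall>x. nv x = 0 \<longleftrightarrow> x = 0) \<and>
     (\<forall>x y. nv (x * y) = nv x * nv y) \<and>
     (\<forall>x y. nv (x + y) \<le> max (nv x) (nv y)) \<and>
     nv (of_nat p) = 1 / real p \<and>
     (\<forall>x. \<forall>e>0. \<exists>q::rat. nv (x - of_rat q) < e) \<and>
     Metric_space.mcomplete UNIV (\<lambda>x y. nv (x - y))"

definition padic_topology :: "('k::field \<Rightarrow> real) \<Rightarrow> 'k topology" where
  "padic_topology nv = Metric_space.mtopology UNIV (\<lambda>x y. nv (x - y))"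

text \<open>Conductor one: the largest fractional ideal on which \<open>\<psi>\<close> is trivial is the ring of
  integers. Continuity follows from triviality on the ring of integers.\<close>

definition additive_character :: "('k::field \<Rightarrow> complex) \<Rightarrow> bool" where
  "additive_character \<psi> \<longleftrightarrow> \<psi> 0 = 1 \<and> (\<forall>x y. \<psi> (x + y) = \<psi> x * \<psi> y)"

definition conductor_one :: "nat \<Rightarrow> ('k::field \<Rightarrow> real) \<Rightarrow> ('k \<Rightarrow> complex) \<Rightarrow> bool" where
  "conductor_one p nv \<psi> \<longleftrightarrow>
     (\<forall>x. nv x \<le> 1 \<longrightarrow> \<psi> x = 1) \<and> (\<exists>x. nv x \<le> real p \<and> \<psi> x \<noteq> 1)"

text \<open>Continuous characters of the multiplicative group; the value at \<open>0\<close> is irrelevant.\<close>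

definition quasi_character :: "('k::field \<Rightarrow> real) \<Rightarrow> ('k \<Rightarrow> complex) \<Rightarrow> bool" where
  "quasi_character nv \<eta> \<longleftrightarrow>
     \<eta> 1 = 1 \<and> (\<forall>a b. a \<noteq> 0 \<longrightarrow> b \<noteq> 0 \<longrightarrow> \<eta> (a * b) = \<eta> a * \<eta> b) \<and>
     (\<exists>e>0. \<forall>a. nv (a - 1) < e \<longrightarrow> \<eta> a = 1)"


section \<open>The groups\<close>

typedef (overloaded) ('k::field) gl2 = "{A :: 'k^2^2. invertible A}"
  morphisms mat_of Abs_gl2
  by (rule exI[of _ "mat 1"]) (auto simp: invertible_def)

setup_lifting type_definition_gl2

instantiation gl2 :: (field) "{monoid_mult, inverse}"
begin

lift_definition one_gl2 :: "'a gl2" is "mat 1"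
  by (auto simp: invertible_def)

lift_definition times_gl2 :: "'a gl2 \<Rightarrow> 'a gl2 \<Rightarrow> 'a gl2" is "\<lambda>A B. A ** B"
  by (simp add: invertible_mult)

lift_definition inverse_gl2 :: "'a gl2 \<Rightarrow> 'a gl2" is matrix_inv
  unfolding invertible_def matrix_inv_def by (rule exI, drule someI_ex) blast

definition divide_gl2 :: "'a gl2 \<Rightarrow> 'a gl2 \<Rightarrow> 'a gl2" where
  "divide_gl2 g h = g * inverse h"

instance
  by standard (transfer; simp add: matrix_mul_assoc)+

end

lemma gl2_inverse: "inverse g * g = 1" "g * inverse g = 1" for g :: "'k::field gl2"
  by (transfer; unfold invertible_def matrix_inv_def; drule someI_ex; blast)+

instantiation prod :: (monoid_mult, monoid_mult) monoid_mult
begin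

definition one_prod :: "'a \<times> 'b" where "one_prod = (1, 1)"

definition times_prod :: "'a \<times> 'b \<Rightarrow> 'a \<times> 'b \<Rightarrow> 'a \<times> 'b" where
  "times_prod x y = (fst x * fst y, snd x * snd y)"

instance
  by standard (simp_all add: one_prod_def times_prod_def mult.assoc)

end

text \<open>Only meaningful for \<open>a * d - b * c \<noteq> 0\<close>.\<close>

definition gl2_of :: "'k::field \<Rightarrow> 'k \<Rightarrow> 'k \<Rightarrow> 'k \<Rightarrow> 'k gl2" where
  "gl2_of a b c d = Abs_gl2 (vector [vector [a, b], vector [c, d]])"

lemma mat_of_gl2_of:
  assumes "a * d - b * c \<noteq> 0"
  shows "mat_of (gl2_of a b c d) = vector [vector [a, b], vector [c, d]]"
  unfolding gl2_of_def
  by (rule Abs_gl2_inverse) (use assms in \<open>simp add: invertible_det_nz det_2\<close>)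

abbreviation gl2_det :: "'k::field gl2 \<Rightarrow> 'k" where
  "gl2_det g \<equiv> det (mat_of g)"

definition gl2_topology :: "('k::field \<Rightarrow> real) \<Rightarrow> 'k gl2 topology" where
  "gl2_topology nv =
     pullback_topology UNIV (\<lambda>g (i, j). mat_of g $ i $ j)
       (product_topology (\<lambda>_. padic_topology nv) UNIV)"

definition gl2_int :: "('k::field \<Rightarrow> real) \<Rightarrow> 'k gl2 set" where
  "gl2_int nv = {g. (\<forall>i j. nv (mat_of g $ i $ j) \<le> 1) \<and> nv (gl2_det g) = 1}"

definition G_int :: "('k::field \<Rightarrow> real) \<Rightarrow> ('k gl2 \<times> 'k gl2) set" where
  "G_int nv = gl2_int nv \<times> gl2_int nv"

definition mirabolic :: "'k::field gl2 set" where
  "mirabolic = {gl2_of a b 0 1 | a b. a \<noteq> 0}"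

definition mirabolic1 :: "nat \<Rightarrow> ('k::field \<Rightarrow> real) \<Rightarrow> 'k gl2 set" where
  "mirabolic1 p nv =
     {x \<in> mirabolic. \<exists>y. nv y \<le> 1 \<and> gl2_det x = 1 + of_nat p * y}"

definition delta_P :: "('k::field \<Rightarrow> real) \<Rightarrow> 'k gl2 \<Rightarrow> real" where
  "delta_P nv x = nv (mat_of x $ 1 $ 1)"

definition conj_G_int ::
    "('k::field \<Rightarrow> real) \<Rightarrow> 'k gl2 \<times> 'k gl2 \<Rightarrow> ('k gl2 \<times> 'k gl2) set" where
  "conj_G_int nv g = {g * k * (inverse (fst g), inverse (snd g)) | k. k \<in> G_int nv}"

text \<open>Left Haar measure on the Borel sets of a closed subgroup \<open>S\<close>, up to
  normalisation; nontriviality and local finiteness come from requiring in addition that some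
  given compact open subgroup has measure \<open>1\<close>.\<close>

definition left_invariant_borel_measure ::
    "('k::field \<Rightarrow> real) \<Rightarrow> 'k gl2 set \<Rightarrow> 'k gl2 measure \<Rightarrow> bool" where
  "left_invariant_borel_measure nv S \<mu> \<longleftrightarrow>
     space \<mu> = S \<and>
     sets \<mu> = sigma_sets S {U. openin (subtopology (gl2_topology nv) S) U} \<and>
     (\<forall>x\<in>S. \<forall>B\<in>sets \<mu>. emeasure \<mu> ((\<lambda>y. x * y) ` B) = emeasure \<mu> B)"

definition haar_measure_P :: "('k::field \<Rightarrow> real) \<Rightarrow> 'k gl2 measure \<Rightarrow> bool" where
  "haar_measure_P nv \<mu> \<longleftrightarrow>
     left_invariant_borel_measure nv mirabolic \<mu> \<and>
     emeasure \<mu> (mirabolic \<inter> gl2_int nv) = 1"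


section \<open>Representations on spaces of functions\<close>

text \<open>
  All representations in play (Whittaker models, principal series, tensor products of Whittaker
  models) are spaces of complex functions on the group, acted on by right translation.
\<close>

definition rtrans :: "'g::times \<Rightarrow> ('g \<Rightarrow> complex) \<Rightarrow> 'g \<Rightarrow> complex" where
  "rtrans g F = (\<lambda>x. F (x * g))"

definition span_over :: "complex set \<Rightarrow> ('g \<Rightarrow> complex) set \<Rightarrow> ('g \<Rightarrow> complex) set" where
  "span_over R B =
     {(\<lambda>x. \<Sum>b\<in>S. c b * b x) | S c. finite S \<and> S \<subseteq> B \<and> (\<forall>b\<in>S. c b \<in> R)}"

definition invariant_subspace :: "('g::times \<Rightarrow> complex) set \<Rightarrow> bool" where
  "invariant_subspace V \<longleftrightarrow>
     (\<lambda>_. 0) \<in> V \<and>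
     (\<forall>F\<in>V. \<forall>F'\<in>V. (\<lambda>x. F x + F' x) \<in> V) \<and>
     (\<forall>c. \<forall>F\<in>V. (\<lambda>x. c * F x) \<in> V) \<and>
     (\<forall>g. \<forall>F\<in>V. rtrans g F \<in> V)"

definition smooth_vector :: "('k::field \<Rightarrow> real) \<Rightarrow> ('k gl2 \<Rightarrow> complex) \<Rightarrow> bool" where
  "smooth_vector nv F \<longleftrightarrow>
     (\<exists>U. openin (gl2_topology nv) U \<and> 1 \<in> U \<and> (\<forall>u\<in>U. rtrans u F = F))"

definition smooth_rep :: "('k::field \<Rightarrow> real) \<Rightarrow> ('k gl2 \<Rightarrow> complex) set \<Rightarrow> bool" where
  "smooth_rep nv V \<longleftrightarrow> invariant_subspace V \<and> (\<forall>F\<in>V. smooth_vector nv F)"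

definition irreducible_rep :: "('g::times \<Rightarrow> complex) set \<Rightarrow> bool" where
  "irreducible_rep V \<longleftrightarrow>
     V \<noteq> {\<lambda>_. 0} \<and>
     (\<forall>U. invariant_subspace U \<longrightarrow> U \<subseteq> V \<longrightarrow> U = {\<lambda>_. 0} \<or> U = V)"

definition linear_on :: "('g \<Rightarrow> complex) set \<Rightarrow> (('g \<Rightarrow> complex) \<Rightarrow> complex) \<Rightarrow> bool" where
  "linear_on V l \<longleftrightarrow>
     (\<forall>F\<in>V. \<forall>F'\<in>V. l (\<lambda>x. F x + F' x) = l F + l F') \<and>
     (\<forall>c. \<forall>F\<in>V. l (\<lambda>x. c * F x) = c * l F)"

definition isomorphic_reps :: "('g::times \<Rightarrow> complex) set \<Rightarrow> ('g \<Rightarrow> complex) set \<Rightarrow> bool" where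
  "isomorphic_reps V V' \<longleftrightarrow>
     (\<exists>T. bij_betw T V V' \<and>
        (\<forall>F\<in>V. \<forall>F'\<in>V. T (\<lambda>x. F x + F' x) = (\<lambda>x. T F x + T F' x)) \<and>
        (\<forall>c. \<forall>F\<in>V. T (\<lambda>x. c * F x) = (\<lambda>x. c * T F x)) \<and>
        (\<forall>g. \<forall>F\<in>V. T (rtrans g F) = rtrans g (T F)))"

definition generic_rep :: "('k::field \<Rightarrow> complex) \<Rightarrow> ('k gl2 \<Rightarrow> complex) set \<Rightarrow> bool" where
  "generic_rep \<psi> V \<longleftrightarrow>
     (\<exists>l. linear_on V l \<and> (\<exists>F\<in>V. l F \<noteq> 0) \<and>
        (\<forall>b. \<forall>F\<in>V. l (rtrans (gl2_of 1 b 0 1) F) = \<psi> b * l F))"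

text \<open>
  Twists of the normalised induction of \<open>(|.|^(1/2), |.|^(-1/2))\<close>: with the modulus factor
  \<open>|a/d|^(1/2)\<close> of normalised induction the transformation factor becomes \<open>|a/d|\<close>. This is the
  modular character of the Borel subgroup, so integration over the maximal compact subgroup is
  an invariant functional; its kernel is the Steinberg representation. (The opposite order of
  the inducing characters would make Steinberg a quotient.)
\<close>

definition steinberg_series :: "('k::field \<Rightarrow> real) \<Rightarrow> ('k gl2 \<Rightarrow> complex) set" where
  "steinberg_series nv =
     {F. smooth_vector nv F \<and>
        (\<forall>a b d g. a \<noteq> 0 \<longrightarrow> d \<noteq> 0 \<longrightarrow>
           F (gl2_of a b 0 d * g) = of_real (nv (a / d)) * F g)}"

definition twist ::
    "('k::field \<Rightarrow> complex) \<Rightarrow> ('k gl2 \<Rightarrow> complex) set \<Rightarrow> ('k gl2 \<Rightarrow> complex) set" where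
  "twist \<eta> V = (\<lambda>F g. \<eta> (gl2_det g) * F g) ` V"

definition whittaker_type ::
    "('k::field \<Rightarrow> real) \<Rightarrow> ('k \<Rightarrow> complex) \<Rightarrow> ('k gl2 \<Rightarrow> complex) set \<Rightarrow> bool" where
  "whittaker_type nv \<psi> V \<longleftrightarrow>
     smooth_rep nv V \<and>
     (irreducible_rep V \<and> generic_rep \<psi> V \<or>
      (\<exists>\<eta>. quasi_character nv \<eta> \<and> isomorphic_reps V (twist \<eta> (steinberg_series nv))))"

definition in_whittaker_model ::
    "('k::field \<Rightarrow> complex) \<Rightarrow> ('k gl2 \<Rightarrow> complex) set \<Rightarrow> bool" where
  "in_whittaker_model \<psi> V \<longleftrightarrow> (\<forall>W\<in>V. \<forall>b g. W (gl2_of 1 b 0 1 * g) = \<psi> b * W g)"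

definition unramified_rep :: "('k::field \<Rightarrow> real) \<Rightarrow> ('k gl2 \<Rightarrow> complex) set \<Rightarrow> bool" where
  "unramified_rep nv V \<longleftrightarrow> (\<exists>F\<in>V. F \<noteq> (\<lambda>_. 0) \<and> (\<forall>k\<in>gl2_int nv. rtrans k F = F))"

definition W_sph :: "('k::field \<Rightarrow> real) \<Rightarrow> ('k gl2 \<Rightarrow> complex) set \<Rightarrow> 'k gl2 \<Rightarrow> complex" where
  "W_sph nv V = (THE W. W \<in> V \<and> (\<forall>k\<in>gl2_int nv. rtrans k W = W) \<and> W 1 = 1)"

definition central_char :: "('k::field gl2 \<Rightarrow> complex) set \<Rightarrow> 'k \<Rightarrow> complex" where
  "central_char V a =
     (if a = 0 then 0
      else (THE c. \<forall>F\<in>V. rtrans (gl2_of a 0 0 a) F = (\<lambda>x. c * F x)))"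

text \<open>Functions on \<open>G\<^sub>p\<close> of the form \<open>(g, h) \<mapsto> W\<^sub>1(g) W\<^sub>2(h)\<close> span a copy of the algebraic
  tensor product, compatibly with the action of \<open>G\<^sub>p\<close> by right translation.\<close>

definition tensor_fun :: "('g \<Rightarrow> complex) \<Rightarrow> ('h \<Rightarrow> complex) \<Rightarrow> 'g \<times> 'h \<Rightarrow> complex" where
  "tensor_fun W1 W2 = (\<lambda>(g, h). W1 g * W2 h)"

definition tensor_rep ::
    "('g \<Rightarrow> complex) set \<Rightarrow> ('h \<Rightarrow> complex) set \<Rightarrow> ('g \<times> 'h \<Rightarrow> complex) set" where
  "tensor_rep V1 V2 = span_over UNIV {tensor_fun W1 W2 | W1 W2. W1 \<in> V1 \<and> W2 \<in> V2}"


section \<open>Spherical Hecke algebra\<close>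

definition hecke_algebra_G ::
    "('k::field \<Rightarrow> real) \<Rightarrow> complex set \<Rightarrow> ('k gl2 \<times> 'k gl2 \<Rightarrow> complex) set" where
  "hecke_algebra_G nv R =
     {\<phi>. range \<phi> \<subseteq> R \<and>
        (\<forall>k\<in>G_int nv. \<forall>k'\<in>G_int nv. \<forall>g. \<phi> (k * g * k') = \<phi> g) \<and>
        (\<exists>C. compactin (prod_topology (gl2_topology nv) (gl2_topology nv)) C \<and>
             {g. \<phi> g \<noteq> 0} \<subseteq> C)}"

text \<open>
  The integral of \<open>\<phi>(g) (g F)\<close> over the group, for the Haar measure giving \<open>K\<close> volume \<open>1\<close>, when
  \<open>\<phi>\<close> is \<open>K\<close>-bi-invariant of compact support and \<open>F\<close> is \<open>K\<close>-fixed: the integrand is constant on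
  each coset \<open>g K\<close>, and only finitely many cosets meet the support.
\<close>

definition hecke_act ::
    "'g::times set \<Rightarrow> ('g \<Rightarrow> complex) \<Rightarrow> ('g \<Rightarrow> complex) \<Rightarrow> 'g \<Rightarrow> complex" where
  "hecke_act K \<phi> F =
     (\<lambda>x. \<Sum>C\<in>{(\<lambda>k. g * k) ` K | g. \<phi> g \<noteq> 0}.
            \<phi> (SOME g. g \<in> C) * rtrans (SOME g. g \<in> C) F x)"

definition hecke_eigenvalue ::
    "'g::times set \<Rightarrow> ('g \<Rightarrow> complex) \<Rightarrow> ('g \<Rightarrow> complex) \<Rightarrow> complex" where
  "hecke_eigenvalue K F \<phi> = (THE c. hecke_act K \<phi> F = (\<lambda>x. c * F x))"

definition v_sph ::
    "('k::field \<Rightarrow> real) \<Rightarrow> ('k gl2 \<Rightarrow> complex) set \<Rightarrow> ('k gl2 \<Rightarrow> complex) set \<Rightarrow>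
     'k gl2 \<times> 'k gl2 \<Rightarrow> complex" where
  "v_sph nv V1 V2 = tensor_fun (W_sph nv V1) (W_sph nv V2)"

definition Theta ::
    "('k::field \<Rightarrow> real) \<Rightarrow> ('k gl2 \<Rightarrow> complex) set \<Rightarrow> ('k gl2 \<Rightarrow> complex) set \<Rightarrow>
     ('k gl2 \<times> 'k gl2 \<Rightarrow> complex) \<Rightarrow> complex" where
  "Theta nv V1 V2 \<phi> = hecke_eigenvalue (G_int nv) (v_sph nv V1 V2) \<phi>"


section \<open>L-factors\<close>

definition L_char :: "nat \<Rightarrow> ('k::field \<Rightarrow> complex) \<Rightarrow> complex \<Rightarrow> complex" where
  "L_char p \<omega> s = inverse (1 - \<omega> (of_nat p) * of_nat p powr (- s))"

text \<open>
  The Satake parameters \<open>\<alpha>, \<beta>\<close> of an unramified representation of Whittaker type satisfy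
  \<open>\<lambda> = sqrt p * (\<alpha> + \<beta>)\<close> and \<open>\<omega>(p) = \<alpha> * \<beta>\<close>, where \<open>\<lambda>\<close> is the eigenvalue of the characteristic
  function of the double coset of \<open>diag(p, 1)\<close> on the spherical vector and \<open>\<omega>\<close> is the central
  character; for the normalised induction of unramified characters they are the values of these
  characters at \<open>p\<close>.
\<close>

definition T_p :: "nat \<Rightarrow> ('k::field \<Rightarrow> real) \<Rightarrow> 'k gl2 \<Rightarrow> complex" where
  "T_p p nv = indicator {k * gl2_of (of_nat p) 0 0 1 * k' | k k'. k \<in> gl2_int nv \<and> k' \<in> gl2_int nv}"

definition satake_poly ::
    "nat \<Rightarrow> ('k::field \<Rightarrow> real) \<Rightarrow> ('k gl2 \<Rightarrow> complex) set \<Rightarrow> complex poly" where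
  "satake_poly p nv V =
     [: central_char V (of_nat p),
        - hecke_eigenvalue (gl2_int nv) (W_sph nv V) (T_p p nv) / of_real (sqrt (real p)),
        1 :]"

definition satake_params ::
    "nat \<Rightarrow> ('k::field \<Rightarrow> real) \<Rightarrow> ('k gl2 \<Rightarrow> complex) set \<Rightarrow> complex multiset" where
  "satake_params p nv V = proots (satake_poly p nv V)"

definition L_RS ::
    "nat \<Rightarrow> ('k::field \<Rightarrow> real) \<Rightarrow> ('k gl2 \<Rightarrow> complex) set \<Rightarrow> ('k gl2 \<Rightarrow> complex) set \<Rightarrow>
     complex \<Rightarrow> complex" where
  "L_RS p nv V1 V2 s =
     inverse (\<Prod>\<alpha>\<in>#satake_params p nv V1. \<Prod>\<beta>\<in>#satake_params p nv V2.
                1 - \<alpha> * \<beta> * of_nat p powr (- s))"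


section \<open>Equivariant forms and lattices\<close>

definition Hom_P ::
    "('k::field \<Rightarrow> real) \<Rightarrow> ('k gl2 \<times> 'k gl2 \<Rightarrow> complex) set \<Rightarrow>
     (('k gl2 \<times> 'k gl2 \<Rightarrow> complex) \<Rightarrow> complex) set" where
  "Hom_P nv V =
     {Z. linear_on V Z \<and>
        (\<forall>x\<in>mirabolic. \<forall>F\<in>V. Z (rtrans (x, x) F) = of_real (delta_P nv x) * Z F)}"

text \<open>The \<open>R\<close>-span of \<open>vol(Q \<inter> g G\<^sub>p\<^sup>\<circ> g\<^sup>-\<^sup>1)\<^sup>-\<^sup>1 g v\<close>, for a subgroup \<open>Q\<close> of \<open>P\<^sub>p\<close>.\<close>

definition int_lattice ::
    "('k::field \<Rightarrow> real) \<Rightarrow> complex set \<Rightarrow> 'k gl2 measure \<Rightarrow> 'k gl2 set \<Rightarrow>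
     ('k gl2 \<times> 'k gl2 \<Rightarrow> complex) \<Rightarrow> ('k gl2 \<times> 'k gl2 \<Rightarrow> complex) set" where
  "int_lattice nv R vol Q v =
     span_over R
       {(\<lambda>y. inverse (of_real (measure vol {x \<in> Q. (x, x) \<in> conj_G_int nv g})) * rtrans g v y)
        | g. True}"

definition subalgebra_Z_inv :: "nat \<Rightarrow> complex set \<Rightarrow> bool" where
  "subalgebra_Z_inv p R \<longleftrightarrow>
     1 \<in> R \<and> (\<forall>x\<in>R. \<forall>y\<in>R. x - y \<in> R) \<and> (\<forall>x\<in>R. \<forall>y\<in>R. x * y \<in> R) \<and>
     inverse (of_nat p) \<in> R"

definition ideal2 :: "complex set \<Rightarrow> complex \<Rightarrow> complex \<Rightarrow> complex set" where
  "ideal2 R x y = {a * x + b * y | a b. a \<in> R \<and> b \<in> R}"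

end

theory Submission
  imports Defs "HOL-Library.Function_Algebras" "HOL-Computational_Algebra.Fundamental_Theorem_Algebra"
begin

text \<open>
  The values \<open>Z(g v)\<close> on translates of the spherical vector \<open>v\<close> form a function on pairs of vertices of
  the tree of \<open>GL\<^sub>2(\<rat>\<^sub>p)\<close>, twisted by the central characters. It is an eigenfunction of the Hecke operator in
  each variable, and modulo the action of \<open>P\<close> a pair of vertices is described by the distances \<open>(i, j)\<close>
  to the point where the two rays towards the end fixed by \<open>P\<close> meet. The Hecke relations become a
  recursion for the resulting numbers \<open>f i j\<close>. The normalisation \<open>f 0 0 = 1 - \<omega>(p)\<close> makes \<open>f 1 0\<close> and \<open>f 0 1\<close>
  integral, hence all \<open>f i 0\<close> and \<open>f 0 j\<close>; for \<open>i, j \<ge> 1\<close> only \<open>(p - 1) f i j\<close> is integral, because a branch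
  point has \<open>p - 1\<close> directions avoiding the other vertex, and \<open>(p - 1) f 1 1\<close> is \<open>- L\<^sup>-\<^sup>1\<close> modulo \<open>p - 1\<close>.
  The inverse volumes are powers of \<open>p\<close>, times \<open>p - 1\<close> exactly when this factor is needed. Uniqueness
  of \<open>Z\<close> plays no role.

  That the spherical line is one-dimensional, so that \<open>v\<close> is a Hecke eigenvector, follows in the irreducible
  case from Dixmier's form of Schur's lemma for the centre and from the fact that the fixed vectors
  of the maximal compact subgroup are a cyclic module over the polynomials in the Hecke operator.
\<close>

text \<open>The volume and the value of \<open>Z\<close> at \<open>(g1, g2)\<close> obey the same
  dichotomy. By the Iwasawa decomposition both are governed by the two balls
  \<open>b + a \<int>\<^sub>p\<close> attached to \<open>g1\<close> and \<open>g2\<close>. If one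
  ball contains the other, every unit \<open>u\<close> occurs in the common stabiliser, whose volume
  is a power of \<open>p\<close>. If they are disjoint, the stabiliser forces \<open>u\<close> to be
  congruent to \<open>1\<close> modulo some \<open>p^n\<close> with \<open>n \<ge> 1\<close>, a
  condition of index \<open>(p - 1) p^(n - 1)\<close> in the units: this is where the inverse volume
  acquires the factor \<open>p - 1\<close>. In the second lattice the congruence is imposed from the
  start, so \<open>p - 1\<close> is always present, and for nested balls it puts the value into the
  ideal by itself. The obstacle before any of this is that the spherical vector, the central
  character and the Hecke eigenvalues are definite descriptions over an abstractly given space of
  functions. They carry information only after multiplicity one for the spherical line has been
  proved.\<close>

section \<open>Matrices\<close>

lemma gl2_eqI:
  fixes g h :: "'k::field gl2"
  assumes "\<And>i j. mat_of g $ i $ j = mat_of h $ i $ j"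
  shows "g = h"
  using assms by (metis mat_of_inject vec_eq_iff)

lemma gl2_of_nth:
  assumes "a * d - b * c \<noteq> (0::'k::field)"
  shows "mat_of (gl2_of a b c d) $ 1 $ 1 = a" "mat_of (gl2_of a b c d) $ 1 $ 2 = b"
    "mat_of (gl2_of a b c d) $ 2 $ 1 = c" "mat_of (gl2_of a b c d) $ 2 $ 2 = d"
  using mat_of_gl2_of[OF assms] by (simp_all add: vector_2)

lemma gl2_det_nz: "gl2_det (g :: 'k::field gl2) \<noteq> 0"
  using mat_of[of g] by (simp add: invertible_det_nz)

lemma gl2_cases:
  fixes g :: "'k::field gl2"
  obtains a b c d where "g = gl2_of a b c d" "a * d - b * c \<noteq> 0"
proof -
  let ?m = "mat_of g"
  have nz: "?m $ 1 $ 1 * ?m $ 2 $ 2 - ?m $ 1 $ 2 * ?m $ 2 $ 1 \<noteq> 0"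
    using gl2_det_nz[of g] by (simp add: det_2)
  have "g = gl2_of (?m $ 1 $ 1) (?m $ 1 $ 2) (?m $ 2 $ 1) (?m $ 2 $ 2)"
  proof (rule gl2_eqI)
    fix i j :: 2
    show "?m $ i $ j = mat_of (gl2_of (?m $ 1 $ 1) (?m $ 1 $ 2) (?m $ 2 $ 1) (?m $ 2 $ 2)) $ i $ j"
      using gl2_of_nth[OF nz] exhaust_2[of i] exhaust_2[of j] by auto
  qed
  with nz that show ?thesis by blast
qed

lemma gl2_of_mult:
  fixes a b c d :: "'k::field"
  assumes "a * d - b * c \<noteq> 0" "a' * d' - b' * c' \<noteq> 0"
  shows "gl2_of a b c d * gl2_of a' b' c' d' =
    gl2_of (a * a' + b * c') (a * b' + b * d') (c * a' + d * c') (c * b' + d * d')"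
proof (rule gl2_eqI)
  fix i j :: 2
  have "(a * a' + b * c') * (c * b' + d * d') - (a * b' + b * d') * (c * a' + d * c') =
      (a * d - b * c) * (a' * d' - b' * c')" by (simp add: algebra_simps)
  also have "\<dots> \<noteq> 0" using assms by simp
  finally have nz: "(a * a' + b * c') * (c * b' + d * d') - (a * b' + b * d') * (c * a' + d * c') \<noteq> 0" .
  show "mat_of (gl2_of a b c d * gl2_of a' b' c' d') $ i $ j =
    mat_of (gl2_of (a * a' + b * c') (a * b' + b * d') (c * a' + d * c') (c * b' + d * d')) $ i $ j"
    using exhaust_2[of i] exhaust_2[of j]
    by (auto simp: times_gl2.rep_eq matrix_matrix_mult_def sum_2 gl2_of_nth[OF nz]
        gl2_of_nth[OF assms(1)] gl2_of_nth[OF assms(2)])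
qed

lemma one_gl2_eq: "(1 :: 'k::field gl2) = gl2_of 1 0 0 1"
proof (rule gl2_eqI)
  fix i j :: 2
  show "mat_of (1 :: 'k gl2) $ i $ j = mat_of (gl2_of 1 0 0 1) $ i $ j"
    using exhaust_2[of i] exhaust_2[of j]
    by (auto simp: one_gl2.rep_eq mat_def gl2_of_nth)
qed

lemma gl2_inverse_unique:
  fixes g h :: "'k::field gl2"
  assumes "g * h = 1"
  shows "inverse g = h"
  by (metis assms gl2_inverse(1) mult.assoc mult.left_neutral mult.right_neutral)

lemma gl2_of_inverse:
  fixes a b c d :: "'k::field"
  assumes "a * d - b * c = D" "D \<noteq> 0"
  shows "inverse (gl2_of a b c d) = gl2_of (d / D) (- b / D) (- c / D) (a / D)"
proof (rule gl2_inverse_unique)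
  have e: "d / D * (a / D) - (- b / D) * (- c / D) = 1 / D"
    using assms by (simp add: field_simps)
  then have nz: "d / D * (a / D) - (- b / D) * (- c / D) \<noteq> 0" "a * d - b * c \<noteq> 0" using assms by simp_all
  have "a * (d / D) + b * (- c / D) = 1" "a * (- b / D) + b * (a / D) = 0"
    "c * (d / D) + d * (- c / D) = 0" "c * (- b / D) + d * (a / D) = 1"
    using assms by (auto simp: field_simps)
  then show "gl2_of a b c d * gl2_of (d / D) (- b / D) (- c / D) (a / D) = 1"
    by (subst gl2_of_mult[OF nz(2,1)]) (simp only: one_gl2_eq)
qed

lemma gl2_inverse_mult: "inverse (g * h) = inverse h * inverse g" for g h :: "'k::field gl2"
  by (rule gl2_inverse_unique) (metis gl2_inverse(2) mult.assoc mult.right_neutral)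

lemma gl2_inverse_inverse [simp]: "inverse (inverse g) = g" for g :: "'k::field gl2"
  by (rule gl2_inverse_unique) (rule gl2_inverse)

lemma gl2_mult_inverse_cancel [simp]:
  "inverse g * (g * h) = h" "g * (inverse g * h) = h" "inverse g * g = 1" "g * inverse g = 1"
  for g h :: "'k::field gl2"
  by (simp_all add: gl2_inverse flip: mult.assoc)

lemma gl2_det_mult: "gl2_det (g * h) = gl2_det g * gl2_det h" for g h :: "'k::field gl2"
  by (simp add: times_gl2.rep_eq det_mul)

lemma gl2_det_of: "a * d - b * c \<noteq> (0::'k::field) \<Longrightarrow> gl2_det (gl2_of a b c d) = a * d - b * c"
  by (simp add: det_2 gl2_of_nth)

abbreviation scal :: "'k::field \<Rightarrow> 'k gl2" where "scal z \<equiv> gl2_of z 0 0 z"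
abbreviation mir :: "'k::field \<Rightarrow> 'k \<Rightarrow> 'k gl2" where "mir a b \<equiv> gl2_of a b 0 1"

lemma scal_commute:
  assumes "z \<noteq> (0::'k::field)"
  shows "scal z * g = g * scal z"
proof -
  obtain a b c d where "g = gl2_of a b c d" "a * d - b * c \<noteq> 0" by (rule gl2_cases)
  then show ?thesis using assms by (simp add: gl2_of_mult mult.commute)
qed

lemma scal_mult: "z \<noteq> (0::'k::field) \<Longrightarrow> w \<noteq> 0 \<Longrightarrow> scal z * scal w = scal (z * w)"
  by (simp add: gl2_of_mult)

lemma scal_one [simp]: "scal 1 = (1::'k::field gl2)"
  by (simp add: one_gl2_eq)

lemma mir_mult: "a \<noteq> (0::'k::field) \<Longrightarrow> a' \<noteq> 0 \<Longrightarrow> mir a b * mir a' b' = mir (a * a') (a * b' + b)"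
  by (simp add: gl2_of_mult)

lemma mir_inverse: "a \<noteq> (0::'k::field) \<Longrightarrow> inverse (mir a b) = mir (1 / a) (- b / a)"
  using gl2_of_inverse[of a 1 b 0 a] by simp

lemma mir_inject: "a \<noteq> (0::'k::field) \<Longrightarrow> a' \<noteq> 0 \<Longrightarrow> mir a b = mir a' b' \<longleftrightarrow> a = a' \<and> b = b'"
  using gl2_of_nth[of a 1 b 0] gl2_of_nth[of a' 1 b' 0] by auto

section \<open>The valuation\<close>

locale padic_gl2 =
  fixes p :: nat and nv :: "'k::field_char_0 \<Rightarrow> real"
  assumes padic: "padic_field p nv"
begin

lemma prime_p: "prime p" and nv_nonneg [simp]: "nv x \<ge> 0" and nv_eq_0 [simp]: "nv x = 0 \<longleftrightarrow> x = 0"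
  and nv_mult: "nv (x * y) = nv x * nv y" and nv_add: "nv (x + y) \<le> max (nv x) (nv y)"
  and nv_p: "nv (of_nat p) = 1 / real p" and rat_dense: "e > 0 \<Longrightarrow> \<exists>q::rat. nv (x - of_rat q) < e"
  using padic unfolding padic_field_def by auto

lemma p_gt_1: "p > 1" and p_gt_0: "p > 0" and p_nz [simp]: "p \<noteq> 0" and pk_nz [simp]: "of_nat p \<noteq> (0::'k)"
  using prime_gt_1_nat[OF prime_p] by auto

lemma nv_0 [simp]: "nv 0 = 0" by simp
lemma nv_le_0 [simp]: "nv x \<le> 0 \<longleftrightarrow> x = 0"
  using nv_nonneg[of x] nv_eq_0[of x] by linarith
lemma nv_pos: "x \<noteq> 0 \<Longrightarrow> nv x > 0"
  using nv_nonneg[of x] nv_eq_0[of x] by linarith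

lemma nv_1 [simp]: "nv 1 = 1"
  using nv_mult[of 1 1] by simp

lemma nv_minus_1: "nv (- 1) = 1"
proof -
  have "nv (- 1) * nv (- 1) = 1" using nv_mult[of "-1" "-1"] by simp
  then show ?thesis using nv_nonneg[of "-1"] by (auto simp: square_eq_1_iff)
qed

lemma nv_minus [simp]: "nv (- x) = nv x"
  using nv_mult[of "-1" x] nv_minus_1 by simp

lemma nv_diff: "nv (x - y) \<le> max (nv x) (nv y)"
  using nv_add[of x "- y"] by simp

lemma nv_diff_commute: "nv (x - y) = nv (y - x)"
  by (metis minus_diff_eq nv_minus)

lemma nv_add_le: "nv x \<le> r \<Longrightarrow> nv y \<le> r \<Longrightarrow> nv (x + y) \<le> r"
  using nv_add[of x y] by simp
lemma nv_diff_le: "nv x \<le> r \<Longrightarrow> nv y \<le> r \<Longrightarrow> nv (x - y) \<le> r"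
  using nv_diff[of x y] by simp
lemma nv_add_less: "nv x < r \<Longrightarrow> nv y < r \<Longrightarrow> nv (x + y) < r"
  using nv_add[of x y] by simp

lemma nv_mult_le_1: "nv x \<le> 1 \<Longrightarrow> nv y \<le> 1 \<Longrightarrow> nv (x * y) \<le> 1"
  by (simp add: nv_mult mult_le_one)

lemma nv_add_eq: "nv x < nv y \<Longrightarrow> nv (x + y) = nv y"
proof (rule antisym)
  assume a: "nv x < nv y"
  then show "nv (x + y) \<le> nv y" using nv_add[of x y] by simp
  show "nv y \<le> nv (x + y)" using nv_diff[of "x + y" x] a by simp
qed

lemma nv_inverse: "nv (inverse x) = inverse (nv x)"
proof (cases "x = 0")
  case False
  then have "nv x * nv (inverse x) = 1" using nv_mult[of x "inverse x"] by simp
  then show ?thesis by (simp add: inverse_unique)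
qed auto

lemma nv_divide: "nv (x / y) = nv x / nv y"
  by (simp add: divide_inverse nv_mult nv_inverse)

lemma nv_power: "nv (x ^ n) = nv x ^ n"
  by (induction n) (auto simp: nv_mult)

lemma nv_powi: "nv (x powi n) = nv x powi n"
  by (auto simp: power_int_def nv_power nv_inverse)

lemma nv_of_nat_le: "nv (of_nat n) \<le> 1"
  by (induction n) (auto intro!: nv_add_le)

lemma nv_of_int_le: "nv (of_int z) \<le> 1"
proof (cases "z \<ge> 0")
  case True
  then show ?thesis using nv_of_nat_le[of "nat z"] by simp
next
  case False
  then have "nv (- of_int z) \<le> 1" using nv_of_nat_le[of "nat (- z)"] by simp
  then show ?thesis by simp
qed

text \<open>Bezout gives \<open>u * p + v * z = 1\<close>. The first term has absolute value below
  \<open>1\<close>, so \<open>v * z\<close> has absolute value \<open>1\<close>, and neither factor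
  exceeds \<open>1\<close>.\<close>

lemma nv_of_int_unit:
  assumes "\<not> int p dvd z"
  shows "nv (of_int z) = 1"
proof -
  have "coprime (int p) z" using assms prime_p by (simp add: prime_imp_coprime)
  then obtain u v where uv: "u * int p + v * z = 1"
    by (metis bezout_int coprime_iff_gcd_eq_1)
  then have "of_int u * of_nat p + of_int v * of_int z = (1::'k)"
    by (metis of_int_1 of_int_add of_int_mult of_int_of_nat_eq)
  moreover have "nv (of_int u * of_nat p) < 1"
  proof -
    have "nv (of_int u * of_nat p) \<le> 1 / real p"
      using nv_of_int_le[of u] by (simp add: nv_mult nv_p divide_right_mono)
    also have "\<dots> < 1" using p_gt_1 by simp
    finally show ?thesis .
  qed
  ultimately have "nv (of_int v * of_int z) = 1"
    using nv_add_eq[of "- (of_int u * of_nat p)" 1] by (metis add.commute add_diff_cancel_left' nv_1 nv_minus uminus_add_conv_diff)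
  then show ?thesis
    using nv_of_int_le[of v] nv_of_int_le[of z]
      mult_left_le_one_le[of "nv (of_int z)" "nv (of_int v)"] by (simp add: nv_mult)
qed

lemma nv_of_nat_unit: "\<not> p dvd n \<Longrightarrow> nv (of_nat n) = 1"
  using nv_of_int_unit[of "int n"] by simp

lemma nv_of_int_value:
  assumes "z \<noteq> 0"
  shows "\<exists>n::nat. nv (of_int z) = (1 / real p) ^ n"
proof -
  have "\<not> is_unit (int p)" using p_gt_1 by simp
  then obtain n y where "z = int p ^ n * y" "\<not> int p dvd y"
    using assms multiplicity_decompose'[of z "int p"] by metis
  then show ?thesis using nv_of_int_unit[of y] by (auto simp: nv_mult nv_power nv_p intro!: exI[of _ n])
qed

lemma p_inv_powi: "(1 / real p) powi n = real p powi (- n)"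
  by (simp add: power_int_minus power_int_divide_distrib inverse_eq_divide)

text \<open>A rational number closer to \<open>x\<close> than \<open>nv x\<close> has the same
  absolute value as \<open>x\<close>, so the value group is that of the rationals.\<close>

lemma nv_value:
  assumes "x \<noteq> 0"
  shows "\<exists>n::int. nv x = real p powi n"
proof -
  obtain q where q: "nv (x - of_rat q) < nv x" using rat_dense[of "nv x" x] nv_pos[OF assms] by auto
  have eq: "nv (of_rat q) = nv x"
    using nv_add_eq[of "of_rat q - x" x] q by (simp add: nv_diff_commute)
  obtain a b where ab: "q = Fract a b" "b > 0" by (meson Rat_cases)
  have "q \<noteq> 0" using eq assms nv_eq_0[of x] by auto
  then have a: "a \<noteq> 0" using ab by (auto simp: rat_number_collapse)
  obtain m where m: "nv (of_int a) = (1 / real p) ^ m" using nv_of_int_value a by blast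
  obtain n where n: "nv (of_int b) = (1 / real p) ^ n" using nv_of_int_value ab by (metis less_irrefl)
  have "nv x = (1 / real p) ^ m / (1 / real p) ^ n"
    using eq ab m n by (simp add: of_rat_rat nv_divide)
  also have "\<dots> = (1 / real p) powi (int m - int n)"
    by (subst power_int_diff) auto
  finally show ?thesis unfolding p_inv_powi by blast
qed

lemma nv_less_1_iff: "nv x < 1 \<longleftrightarrow> nv x \<le> 1 / real p"
proof
  assume l: "nv x < 1"
  show "nv x \<le> 1 / real p"
  proof (cases "x = 0")
    case False
    then obtain n where n: "nv x = real p powi n" using nv_value by blast
    have "n < 0"
    proof (rule ccontr)
      assume "\<not> n < 0"
      then have "real p powi n \<ge> 1" using p_gt_1 by (simp add: one_le_power_int)
      then show False using l n by simp
    qed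
    then have "real p powi n \<le> real p powi (-1)"
      using p_gt_1 by (intro power_int_increasing) auto
    then show ?thesis using n by (simp add: power_int_minus inverse_eq_divide)
  qed auto
next
  assume "nv x \<le> 1 / real p"
  also have "\<dots> < 1" using p_gt_1 by simp
  finally show "nv x < 1" .
qed

lemma unit_decomp:
  assumes "x \<noteq> 0"
  obtains n :: int and u where "x = of_nat p powi n * u" "nv u = 1"
proof -
  obtain n where n: "nv x = real p powi n" using nv_value assms by blast
  have "x = of_nat p powi (-n) * (x * of_nat p powi n)"
    by (simp add: power_int_minus)
  moreover have "nv (x * of_nat p powi n) = 1"
    by (simp add: nv_mult nv_powi nv_p n p_inv_powi power_int_minus)
  ultimately show ?thesis using that by blast
qed

lemma residue_unique: "nv (of_nat n - of_nat m) < 1 \<Longrightarrow> n < p \<Longrightarrow> m < p \<Longrightarrow> n = m"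
proof -
  assume a: "nv (of_nat n - of_nat m) < 1" "n < p" "m < p"
  have "of_nat n - of_nat m = (of_int (int n - int m) :: 'k)" by simp
  then have "int p dvd (int n - int m)" using nv_of_int_unit a(1) by (metis less_irrefl)
  then show ?thesis using a(2,3)
    by (metis mod_eq_dvd_iff mod_less of_nat_eq_iff of_nat_mod)
qed

text \<open>Density supplies a fraction \<open>a / b\<close> in lowest terms at distance below
  \<open>1\<close> from \<open>x\<close>. Integrality forces \<open>b\<close> to be prime to
  \<open>p\<close>, and the residue is \<open>a\<close> times an inverse of \<open>b\<close> modulo
  \<open>p\<close>.\<close>

lemma residue:
  assumes "nv x \<le> 1"
  obtains c where "c < p" "nv (x - of_nat c) < 1"
proof -
  obtain q where q: "nv (x - of_rat q) < 1" using rat_dense[of 1 x] by auto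
  have q1: "nv (of_rat q) \<le> 1" using nv_diff[of x "x - of_rat q"] q assms by simp
  obtain a b where ab: "q = Fract a b" "b > 0" "coprime a b" by (meson Rat_cases)
  have "\<not> int p dvd b"
  proof
    assume d: "int p dvd b"
    then have "\<not> int p dvd a"
      using ab(3) p_gt_1 by (metis coprime_common_divisor zdvd1_eq int_ops(2) less_irrefl of_nat_eq_iff abs_of_nat)
    then have 1: "nv (of_int a) = 1" by (rule nv_of_int_unit)
    obtain e where "b = int p * e" using d by blast
    then have "nv (of_int b) \<le> 1 / real p"
      using nv_of_int_le[of e] by (simp add: nv_mult nv_p divide_right_mono)
    then have 2: "nv (of_int b) < 1" by (simp add: nv_less_1_iff)
    have "nv (of_int a) = nv (of_rat q) * nv (of_int b)"
      using ab(1,2) by (simp add: of_rat_rat nv_divide)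
    then show False
      using 1 2 q1 mult_left_le_one_le[of "nv (of_int b)" "nv (of_rat q)"] by simp
  qed
  then have "coprime b (int p)" using prime_p by (metis coprime_commute prime_imp_coprime prime_nat_int_transfer)
  then obtain u where u: "int p dvd b * u - a"
  proof -
    obtain s t where "s * b + t * int p = 1"
      by (metis \<open>coprime b (int p)\<close> bezout_int coprime_iff_gcd_eq_1)
    then have "b * (s * a) - a = int p * (- t * a)" by algebra
    then show ?thesis using that by (metis dvd_triv_left)
  qed
  define c where "c = nat (u mod int p)"
  have c: "c < p" "int p dvd int c - u"
    using p_gt_0 by (auto simp: c_def nat_less_iff mod_eq_dvd_iff[symmetric])
  have bu: "nv (of_int b) = 1" by (rule nv_of_int_unit) fact
  have "int p dvd b * int c - a"
  proof -
    have "b * int c - a = b * (int c - u) + (b * u - a)" by (simp add: right_diff_distrib)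
    then show ?thesis using u c(2) by (metis dvd_add dvd_mult)
  qed
  then obtain e where e: "b * int c - a = int p * e" by blast
  have e': "of_int b * of_nat c - of_int a = (of_nat p * of_int e :: 'k)"
    by (metis e of_int_diff of_int_mult of_int_of_nat_eq)
  have "nv (of_rat q - of_nat c) = nv (of_int a - of_int b * of_nat c)"
  proof -
    have "of_rat q - of_nat c = (of_int a - of_int b * of_nat c) / (of_int b :: 'k)"
      using ab(1,2) by (simp add: of_rat_rat diff_divide_distrib)
    then show ?thesis using bu by (simp add: nv_divide)
  qed
  also have "\<dots> = nv (of_nat p * of_int e)" using e' by (metis nv_diff_commute)
  also have "\<dots> \<le> 1 / real p" using nv_of_int_le[of e] by (simp add: nv_mult nv_p divide_right_mono)
  finally have "nv (of_rat q - of_nat c) < 1" by (simp add: nv_less_1_iff)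
  then have "nv (x - of_nat c) < 1" using nv_add_less[OF q] by fastforce
  with c show ?thesis using that by blast
qed

text \<open>Base \<open>p\<close> digits: split off the residue \<open>c\<close> of \<open>x\<close>
  and continue with \<open>(x - c) / p\<close>.\<close>

lemma residue_power:
  assumes "nv x \<le> 1"
  shows "\<exists>c<p^n. nv (x - of_nat c) \<le> (1 / real p) ^ n"
  using assms
proof (induction n arbitrary: x)
  case 0
  then show ?case by auto
next
  case (Suc n)
  obtain c where c: "c < p" "nv (x - of_nat c) \<le> 1 / real p"
    using residue[OF Suc.prems] nv_less_1_iff by blast
  define y where "y = (x - of_nat c) / of_nat p"
  have y: "x - of_nat c = of_nat p * y" by (simp add: y_def)
  have "nv y \<le> 1" using c p_gt_0 by (simp add: y_def nv_divide nv_p field_simps)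
  from Suc.IH[OF this] obtain d where d: "d < p ^ n" "nv (y - of_nat d) \<le> (1 / real p) ^ n" by blast
  have "x - of_nat (c + p * d) = of_nat p * (y - of_nat d)" using y by (simp add: algebra_simps)
  then have "nv (x - of_nat (c + p * d)) = 1 / real p * nv (y - of_nat d)" by (simp only: nv_mult nv_p)
  also have "\<dots> \<le> (1 / real p) ^ Suc n" using d by (simp add: divide_right_mono)
  finally have "nv (x - of_nat (c + p * d)) \<le> (1 / real p) ^ Suc n" .
  moreover have "c + p * d < p ^ Suc n"
  proof -
    have "c + p * d < p + p * d" using c by simp
    also have "\<dots> = p * Suc d" by simp
    also have "\<dots> \<le> p * p ^ n" using d(1) by (intro mult_le_mono) auto
    finally show ?thesis by simp
  qed
  ultimately show ?case by blast
qed

lemma nv_small: "e > 0 \<Longrightarrow> \<exists>n. (1 / real p) ^ n < e"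
  using p_gt_1 by (intro real_arch_pow_inv) auto

section \<open>The maximal compact subgroup\<close>

abbreviation K where "K \<equiv> gl2_int nv"

lemma K_iff:
  assumes "a * d - b * c \<noteq> 0"
  shows "gl2_of a b c d \<in> K \<longleftrightarrow> nv a \<le> 1 \<and> nv b \<le> 1 \<and> nv c \<le> 1 \<and> nv d \<le> 1 \<and> nv (a * d - b * c) = 1"
  using assms by (auto simp: gl2_int_def forall_2 gl2_of_nth det_2)

lemma K_intro:
  assumes "nv a \<le> 1" "nv b \<le> 1" "nv c \<le> 1" "nv d \<le> 1" "nv (a * d - b * c) = 1"
  shows "gl2_of a b c d \<in> K"
proof -
  have "a * d - b * c \<noteq> 0" using assms(5) by auto
  then show ?thesis using assms by (simp add: K_iff)
qed

lemma K_cases: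
  assumes "g \<in> K"
  obtains a b c d where "g = gl2_of a b c d" "nv a \<le> 1" "nv b \<le> 1" "nv c \<le> 1" "nv d \<le> 1"
    "nv (a * d - b * c) = 1" "a * d - b * c \<noteq> 0"
proof -
  obtain a b c d where g: "g = gl2_of a b c d" "a * d - b * c \<noteq> 0" by (rule gl2_cases)
  with assms have "nv a \<le> 1 \<and> nv b \<le> 1 \<and> nv c \<le> 1 \<and> nv d \<le> 1 \<and> nv (a * d - b * c) = 1"
    using K_iff[OF g(2)] by simp
  then show ?thesis using that[OF g(1)] g(2) by blast
qed

lemma K_one: "1 \<in> K"
  unfolding one_gl2_eq by (rule K_intro) auto

lemma K_mult:
  assumes "g \<in> K" "h \<in> K"
  shows "g * h \<in> K"
proof -
  obtain a b c d where g: "g = gl2_of a b c d" "nv a \<le> 1" "nv b \<le> 1" "nv c \<le> 1" "nv d \<le> 1"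
    "nv (a * d - b * c) = 1" "a * d - b * c \<noteq> 0" using K_cases[OF assms(1)] by blast
  obtain a' b' c' d' where h: "h = gl2_of a' b' c' d'" "nv a' \<le> 1" "nv b' \<le> 1" "nv c' \<le> 1" "nv d' \<le> 1"
    "nv (a' * d' - b' * c') = 1" "a' * d' - b' * c' \<noteq> 0" using K_cases[OF assms(2)] by blast
  have "(a * a' + b * c') * (c * b' + d * d') - (a * b' + b * d') * (c * a' + d * c') =
      (a * d - b * c) * (a' * d' - b' * c')" by (simp add: algebra_simps)
  then have "nv ((a * a' + b * c') * (c * b' + d * d') - (a * b' + b * d') * (c * a' + d * c')) = 1"
    using g h by (simp add: nv_mult)
  then show ?thesis unfolding g(1) h(1) gl2_of_mult[OF g(7) h(7)]
    by (intro K_intro nv_add_le nv_mult_le_1) (use g h in auto)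
qed

lemma K_inverse:
  assumes "g \<in> K"
  shows "inverse g \<in> K"
proof -
  obtain a b c d where g: "g = gl2_of a b c d" "nv a \<le> 1" "nv b \<le> 1" "nv c \<le> 1" "nv d \<le> 1"
    "nv (a * d - b * c) = 1" "a * d - b * c \<noteq> 0" using K_cases[OF assms(1)] by blast
  let ?D = "a * d - b * c"
  have "d / ?D * (a / ?D) - (- b / ?D) * (- c / ?D) = 1 / ?D"
    using g(7) by (simp add: divide_simps)
  then show ?thesis unfolding g(1) gl2_of_inverse[OF refl g(7)]
    by (intro K_intro) (use g in \<open>auto simp: nv_divide\<close>)
qed

lemma K_mult_left_iff [simp]: "k \<in> K \<Longrightarrow> k * g \<in> K \<longleftrightarrow> g \<in> K"
  using K_mult[of k g] K_mult[OF K_inverse, of k "k * g"] by auto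

lemma K_mult_right_iff [simp]: "k \<in> K \<Longrightarrow> g * k \<in> K \<longleftrightarrow> g \<in> K"
  using K_mult[of g k] K_mult[OF _ K_inverse, of "g * k" k] by (auto simp: mult.assoc)

lemma mir_K_iff: "a \<noteq> 0 \<Longrightarrow> mir a b \<in> K \<longleftrightarrow> nv a = 1 \<and> nv b \<le> 1"
  using K_iff[of a 1 b 0] by auto

lemma scal_K: "nv u = 1 \<Longrightarrow> scal u \<in> K"
  by (rule K_intro) (auto simp: nv_mult)

definition w_elt :: "'k gl2" where "w_elt = gl2_of 0 1 1 0"

lemma w_elt_K: "w_elt \<in> K"
  unfolding w_elt_def by (rule K_intro) auto

text \<open>The lower left entry is cleared by a column operation that divides by the larger of the
  two lower entries; its coefficient is then integral, so the operation lies in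
  \<open>K\<close>.\<close>

lemma iwasawa:
  obtains z a b k where "g = scal z * mir a b * k" "z \<noteq> 0" "a \<noteq> 0" "k \<in> K"
proof -
  obtain x y c d where g: "g = gl2_of x y c d" "x * d - y * c \<noteq> 0" by (rule gl2_cases)
  have 1: "\<exists>a b z k. a \<noteq> 0 \<and> z \<noteq> 0 \<and> k \<in> K \<and> g = gl2_of a b 0 z * k"
  proof (cases "nv c \<le> nv d")
    case True
    then have d: "d \<noteq> 0" using g(2) by auto
    have "g = gl2_of (x - y * c / d) y 0 d * gl2_of 1 0 (c / d) 1"
      using g d by (subst gl2_of_mult) (auto simp: field_simps)
    moreover have "gl2_of 1 0 (c / d) 1 \<in> K"
      using True d by (intro K_intro) (auto simp: nv_divide divide_le_eq_1 nv_pos)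
    moreover have "x - y * c / d \<noteq> 0" using g(2) d by (auto simp: field_simps)
    ultimately show ?thesis using d by blast
  next
    case False
    then have c: "c \<noteq> 0" by auto
    have "g = gl2_of (y - x * d / c) x 0 c * gl2_of 0 1 1 (d / c)"
      using g c by (subst gl2_of_mult) (auto simp: field_simps)
    moreover have "gl2_of 0 1 1 (d / c) \<in> K"
      using False c by (intro K_intro) (auto simp: nv_divide divide_le_eq_1 nv_pos)
    moreover have "y - x * d / c \<noteq> 0" using g(2) c by (auto simp: field_simps)
    ultimately show ?thesis using c by blast
  qed
  then obtain a b z k where abzk: "a \<noteq> 0" "z \<noteq> 0" "k \<in> K" "g = gl2_of a b 0 z * k" by blast
  moreover have "gl2_of a b 0 z = scal z * mir (a / z) (b / z)"
    using abzk by (subst gl2_of_mult) auto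
  ultimately show ?thesis using that[of z "a / z" "b / z" k] by simp
qed

lemma mir_unit_right: "a \<noteq> 0 \<Longrightarrow> u \<noteq> 0 \<Longrightarrow> mir (a * u) (b + a * s) = mir a b * mir u s"
  by (simp add: mir_mult add.commute)

text \<open>Countably many representatives of the cosets of \<open>K\<close>: this bounds the
  dimension of a representation generated by a spherical vector, as Dixmier's argument
  requires.\<close>

lemma iwasawa_rat:
  obtains n m :: int and q :: rat and k
  where "g = scal (of_nat p powi n) * mir (of_nat p powi m) (of_rat q) * k" "k \<in> K"
proof -
  obtain z a b k where g: "g = scal z * mir a b * k" "z \<noteq> 0" "a \<noteq> 0" "k \<in> K" by (rule iwasawa)
  obtain n u where nu: "z = of_nat p powi n * u" "nv u = 1" using unit_decomp[OF g(2)] by blast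
  obtain m v where mv: "a = of_nat p powi m * v" "nv v = 1" using unit_decomp[OF g(3)] by blast
  have uv: "u \<noteq> 0" "v \<noteq> 0" using nu mv by auto
  let ?P = "of_nat p :: 'k"
  obtain q where q: "nv (b - of_rat q) < nv (?P powi m)"
    using rat_dense[of "nv (?P powi m)" b] nv_pos[of "?P powi m"] by auto
  define s where "s = (b - of_rat q) / ?P powi m"
  have s: "nv s \<le> 1" using q nv_pos[of "?P powi m"] by (simp add: s_def nv_divide divide_le_eq_1)
  have b: "b = of_rat q + ?P powi m * s" by (simp add: s_def)
  have "mir a b = mir (?P powi m) (of_rat q) * mir v s"
    using uv mv(1) b by (simp add: mir_unit_right)
  moreover have "scal z = scal (?P powi n) * scal u" using nu uv by (simp add: scal_mult)
  ultimately have "g = scal (?P powi n) * (scal u * (mir (?P powi m) (of_rat q) * mir v s)) * k"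
    using g(1) by (simp add: mult.assoc)
  also have "scal u * (mir (?P powi m) (of_rat q) * mir v s) = mir (?P powi m) (of_rat q) * mir v s * scal u"
    using uv scal_commute by blast
  finally have "g = scal (?P powi n) * mir (?P powi m) (of_rat q) * (mir v s * scal u * k)"
    by (simp add: mult.assoc)
  moreover have "mir v s * scal u * k \<in> K"
    using mv nu s g(4) uv by (intro K_mult) (auto simp: mir_K_iff scal_K)
  ultimately show ?thesis using that by blast
qed

text \<open>After the Iwasawa step the entry \<open>b\<close> of \<open>mir a b\<close> can be
  cleared by an integral row operation if \<open>b\<close> is integral and by an integral column
  operation if \<open>b / a\<close> is. Otherwise \<open>b\<close> strictly dominates both
  \<open>a\<close> and \<open>1\<close> and serves as the pivot.\<close>

lemma cartan:
  obtains k z n k' where "g = k * (scal z * mir (of_nat p ^ n) 0) * k'" "k \<in> K" "k' \<in> K" "z \<noteq> 0"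
proof -
  let ?good = "\<lambda>g. \<exists>k z n k'. g = k * (scal z * mir (of_nat p ^ n) 0) * k' \<and> k \<in> K \<and> k' \<in> K \<and> z \<noteq> 0"
  have good_K: "?good (k * g * k')" if g: "?good g" and k: "k \<in> K" and k': "k' \<in> K" for k g k'
  proof -
    obtain k1 z n k2 where *: "g = k1 * (scal z * mir (of_nat p ^ n) 0) * k2" "k1 \<in> K" "k2 \<in> K" "z \<noteq> 0"
      using g by blast
    then have "k * g * k' = (k * k1) * (scal z * mir (of_nat p ^ n) 0) * (k2 * k')" by (simp add: mult.assoc)
    then show ?thesis using * k k' K_mult by blast
  qed
  have good_diag_n: "?good (scal z * mir (of_nat p powi n) 0)" if z: "z \<noteq> 0" for z and n :: int
  proof (cases "n \<ge> 0")
    case True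
    then have "scal z * mir (of_nat p powi n) 0 = 1 * (scal z * mir (of_nat p ^ nat n) 0) * 1"
      by (simp add: power_int_def)
    then show ?thesis using K_one z by blast
  next
    \<comment> \<open>Exchanging the two diagonal entries by \<open>w_elt\<close> turns a negative
      exponent into a positive one, at the price of a scalar.\<close>
    case False
    then have e: "of_nat p powi n = inverse ((of_nat p :: 'k) ^ nat (- n))" by (simp add: power_int_def power_inverse)
    have "scal z * mir (of_nat p powi n) 0 =
       w_elt * (scal (z * of_nat p powi n) * mir (of_nat p ^ nat (- n)) 0) * w_elt"
      using z by (simp add: w_elt_def gl2_of_mult e mult.assoc)
    moreover have "z * of_nat p powi n \<noteq> 0" using z by simp
    ultimately show ?thesis using w_elt_K by blast
  qed
  have good_diag: "?good (scal z * mir a 0)" if z: "z \<noteq> 0" "a \<noteq> 0" for z a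
  proof -
    obtain n u where nu: "a = of_nat p powi n * u" "nv u = 1" using unit_decomp[OF z(2)] by blast
    have "scal z * mir a 0 = 1 * (scal z * mir (of_nat p powi n) 0) * mir u 0"
      using nu z by (auto simp: gl2_of_mult mult.assoc)
    moreover have "mir u 0 \<in> K" using nu by (subst mir_K_iff) auto
    ultimately show ?thesis using good_K[OF good_diag_n[OF z(1)] K_one] by metis
  qed
  have good_mir: "?good (scal z * mir a b)" if z: "z \<noteq> 0" "a \<noteq> 0" for z a b
  proof -
    consider "nv b \<le> 1" | "nv b \<le> nv a" | "nv b > 1" "nv b > nv a" by linarith
    then show ?thesis
    proof cases
      case 1
      have "scal z * mir a b = mir 1 b * (scal z * mir a 0) * 1"
        using z by (simp add: gl2_of_mult mult.commute)
      moreover have "mir 1 b \<in> K" using 1 by (simp add: mir_K_iff)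
      ultimately show ?thesis using good_K[OF good_diag[OF z] _ K_one, of "mir 1 b"] by simp
    next
      case 2
      have "scal z * mir a b = 1 * (scal z * mir a 0) * mir 1 (b / a)" using z by (auto simp: gl2_of_mult)
      moreover have "mir 1 (b / a) \<in> K" using 2 z by (simp add: mir_K_iff nv_divide nv_pos)
      ultimately show ?thesis using good_K[OF good_diag[OF z] K_one, of "mir 1 (b / a)"] by simp
    next
      case 3
      then have b: "b \<noteq> 0" by auto
      \<comment> \<open>Elimination with pivot \<open>b\<close>: up to the scalar \<open>z\<close>
        the diagonal factor has entries \<open>b\<close> and \<open>- a / b\<close>, and
        \<open>w_elt\<close> moves the pivot onto the diagonal.\<close>
      have m: "scal z * mir a b = gl2_of 1 0 (1 / b) 1 * (scal (- (z * a / b)) * mir (- (b * b / a)) 0)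
          * (gl2_of 1 (a / b) 0 1 * w_elt)"
        using z b by (simp add: w_elt_def gl2_of_mult field_simps)
      have "gl2_of 1 0 (1 / b) 1 \<in> K" using 3 by (intro K_intro) (auto simp: nv_divide)
      moreover have "gl2_of 1 (a / b) 0 1 * w_elt \<in> K"
        using 3 by (intro K_mult w_elt_K) (auto simp: mir_K_iff nv_divide)
      ultimately show ?thesis
        unfolding m using z b by (intro good_K[OF good_diag]) auto
    qed
  qed
  obtain z a b k where "g = scal z * mir a b * k" "z \<noteq> 0" "a \<noteq> 0" "k \<in> K" by (rule iwasawa)
  then have "?good g" using good_K[OF good_mir[of z a b] K_one, of k] by simp
  then show ?thesis using that by blast
qed

end

section \<open>Hecke operators\<close>

definition lcoset :: "'g::times \<Rightarrow> 'g set \<Rightarrow> 'g set" where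
  "lcoset g H = (\<lambda>k. g * k) ` H"

definition right_inv :: "'g::times set \<Rightarrow> ('g \<Rightarrow> complex) \<Rightarrow> bool" where
  "right_inv H F \<longleftrightarrow> (\<forall>h\<in>H. rtrans h F = F)"

lemma right_invD: "right_inv H F \<Longrightarrow> h \<in> H \<Longrightarrow> F (x * h) = F x"
  unfolding right_inv_def rtrans_def by metis

lemma right_invI: "(\<And>x h. h \<in> H \<Longrightarrow> F (x * h) = F x) \<Longrightarrow> right_inv H F"
  unfolding right_inv_def rtrans_def by auto

text \<open>The representatives chosen by \<open>SOME\<close> need not correspond under
  \<open>\<tau>\<close>, but a function constant on cosets does not see the difference.\<close>

lemma coset_sum_reindex:
  fixes H :: "'g::times set"
  assumes inv: "\<And>y h. h \<in> H \<Longrightarrow> F (y * h) = (F y :: 'b::comm_monoid_add)"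
    and cosets: "\<And>C. C \<in> \<C> \<Longrightarrow> \<exists>g. C = lcoset g H" "\<And>C. C \<in> \<C>' \<Longrightarrow> \<exists>g. C = lcoset g H"
    and H: "H \<noteq> {}"
    and bij: "bij_betw (\<lambda>C. \<tau> ` C) \<C> \<C>'"
  shows "(\<Sum>C\<in>\<C>. F (\<tau> (SOME g. g \<in> C))) = (\<Sum>C\<in>\<C>'. F (SOME g. g \<in> C))"
proof -
  have "(\<Sum>C\<in>\<C>'. F (SOME g. g \<in> C)) = (\<Sum>C\<in>\<C>. F (SOME g. g \<in> \<tau> ` C))"
    using sum.reindex_bij_betw[OF bij, of "\<lambda>C. F (SOME g. g \<in> C)"] by simp
  also have "\<dots> = (\<Sum>C\<in>\<C>. F (\<tau> (SOME g. g \<in> C)))"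
  proof (rule sum.cong[OF refl])
    fix C assume C: "C \<in> \<C>"
    then have "C \<noteq> {}" using cosets(1) H by (fastforce simp: lcoset_def)
    then have 1: "\<tau> (SOME g. g \<in> C) \<in> \<tau> ` C" by (simp add: some_in_eq)
    then have 2: "(SOME g. g \<in> \<tau> ` C) \<in> \<tau> ` C" by (metis someI)
    obtain g where g: "\<tau> ` C = lcoset g H" using C cosets(2) bij by (meson bij_betwE)
    have "F y = F g" if "y \<in> \<tau> ` C" for y using that inv unfolding g by (auto simp: lcoset_def)
    then show "F (SOME g. g \<in> \<tau> ` C) = F (\<tau> (SOME g. g \<in> C))" using 1 2 by metis
  qed
  finally show ?thesis by simp
qed

text \<open>Distinctness of the cosets is expressed without inverses, because pairs of group
  elements only form a \<open>monoid_mult\<close> here.\<close>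

definition coset_reps :: "'g::monoid_mult set \<Rightarrow> 'g set \<Rightarrow> 'g set \<Rightarrow> bool" where
  "coset_reps H A S \<longleftrightarrow>
     A = (\<Union>r\<in>S. lcoset r H) \<and> (\<forall>r\<in>S. \<forall>r'\<in>S. \<forall>h\<in>H. r = r' * h \<longrightarrow> r = r')"

text \<open>Passage from the choice of representatives in \<open>hecke_act\<close> to an explicit
  sum; it rests on the right invariance of \<open>F\<close> alone making each summand independent of
  the choice.\<close>

lemma hecke_act_reps:
  fixes H :: "'g::monoid_mult set"
  assumes H: "1 \<in> H" "\<And>h. h \<in> H \<Longrightarrow> lcoset h H = H"
    and reps: "coset_reps H A S" and F: "right_inv H F"
  shows "hecke_act H (indicator A) F x = (\<Sum>r\<in>S. F (x * r))"
proof -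
  have A: "A = (\<Union>r\<in>S. lcoset r H)" and dist: "\<And>r r' h. r \<in> S \<Longrightarrow> r' \<in> S \<Longrightarrow> h \<in> H \<Longrightarrow> r = r' * h \<Longrightarrow> r = r'"
    using reps unfolding coset_reps_def by blast+
  have assoc: "lcoset (r * h) H = lcoset r (lcoset h H)" for r h
    by (auto simp: lcoset_def image_image mult.assoc)
  have self: "r \<in> lcoset r H" for r using H(1) by (force simp: lcoset_def)
  have sub: "r \<in> A" if "r \<in> S" for r using that A self by blast
  have cosets: "{(\<lambda>k. g * k) ` H | g. indicator A g \<noteq> (0::complex)} = (\<lambda>r. lcoset r H) ` S"
  proof -
    have "{(\<lambda>k. g * k) ` H | g. indicator A g \<noteq> (0::complex)} = {lcoset g H | g. g \<in> A}"
      by (auto simp: lcoset_def indicator_def)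
    also have "\<dots> = (\<lambda>r. lcoset r H) ` S"
    proof (intro equalityI subsetI)
      fix C assume "C \<in> {lcoset g H | g. g \<in> A}"
      then obtain g r h where "C = lcoset g H" "r \<in> S" "h \<in> H" "g = r * h"
        using A by (auto simp: lcoset_def)
      then show "C \<in> (\<lambda>r. lcoset r H) ` S" using assoc H(2) by auto
    qed (use sub in blast)
    finally show ?thesis .
  qed
  have inj: "inj_on (\<lambda>r. lcoset r H) S"
  proof (rule inj_onI)
    fix r r' assume r: "r \<in> S" "r' \<in> S" "lcoset r H = lcoset r' H"
    then have "r \<in> lcoset r' H" using self by metis
    then show "r = r'" using dist r by (auto simp: lcoset_def)
  qed
  have val: "indicator A (SOME g. g \<in> lcoset r H) * rtrans (SOME g. g \<in> lcoset r H) F x = F (x * r)"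
    if r: "r \<in> S" for r
  proof -
    have "(SOME g. g \<in> lcoset r H) \<in> lcoset r H" using self by (rule someI)
    then obtain h where h: "h \<in> H" "(SOME g. g \<in> lcoset r H) = r * h" by (auto simp: lcoset_def)
    have "r * h \<in> A" using r h A by (auto simp: lcoset_def)
    then show ?thesis unfolding h(2) rtrans_def using right_invD[OF F h(1), of "x * r"] by (simp add: mult.assoc)
  qed
  show ?thesis unfolding hecke_act_def cosets sum.reindex[OF inj] o_def using val by (simp cong: sum.cong)
qed

lemma lcoset_prod: "lcoset (r, r') (H \<times> H') = lcoset r H \<times> lcoset r' H'"
  by (force simp: lcoset_def times_prod_def image_iff)

lemma coset_reps_prod:
  assumes "coset_reps H A S" "coset_reps H' A' S'"
  shows "coset_reps (H \<times> H') (A \<times> A') (S \<times> S')"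
proof -
  have "A \<times> A' = (\<Union>x\<in>S \<times> S'. lcoset x (H \<times> H'))"
    using assms by (auto simp: coset_reps_def lcoset_prod)
  then show ?thesis using assms by (auto simp: coset_reps_def times_prod_def)
qed

text \<open>\<open>span_over\<close> is indexed by distinct vectors, so a family with repetitions
  needs its coefficients collected over each fibre of \<open>b\<close>.\<close>

lemma span_over_sum:
  assumes "finite I" "\<And>i. i \<in> I \<Longrightarrow> b i \<in> B"
  shows "(\<lambda>x. \<Sum>i\<in>I. c i * b i x) \<in> span_over UNIV B"
proof -
  have "(\<lambda>x. \<Sum>i\<in>I. c i * b i x) = (\<lambda>x. \<Sum>y\<in>b ` I. (\<Sum>i\<in>{i\<in>I. b i = y}. c i) * y x)"
  proof (rule ext)
    fix x
    have "(\<Sum>i\<in>I. c i * b i x) = (\<Sum>y\<in>b ` I. \<Sum>i\<in>{i\<in>I. b i = y}. c i * b i x)"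
      using assms(1) by (rule sum.image_gen)
    also have "\<dots> = (\<Sum>y\<in>b ` I. (\<Sum>i\<in>{i\<in>I. b i = y}. c i) * y x)"
      by (intro sum.cong refl) (simp add: sum_distrib_right)
    finally show "(\<Sum>i\<in>I. c i * b i x) = (\<Sum>y\<in>b ` I. (\<Sum>i\<in>{i\<in>I. b i = y}. c i) * y x)" .
  qed
  then show ?thesis unfolding span_over_def mem_Collect_eq
    using assms(1,2) by (intro exI[of _ "b ` I"] exI[of _ "\<lambda>y. \<Sum>i\<in>{i \<in> I. b i = y}. c i"]) auto
qed

context padic_gl2
begin

lemma lcoset_K: "k \<in> K \<Longrightarrow> lcoset k K = K"
proof (intro equalityI subsetI)
  fix x assume k: "k \<in> K" and "x \<in> K"
  then have "x = k * (inverse k * x)" "inverse k * x \<in> K" using K_inverse K_mult by auto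
  then show "x \<in> lcoset k K" unfolding lcoset_def by blast
qed (auto simp: lcoset_def)

lemma coset_reps_scal: "coset_reps K (lcoset z K) {z}"
  by (auto simp: coset_reps_def)

text \<open>For \<open>c > 0\<close> a compact set stable under \<open>K\<close> on both sides. It
  describes the double coset \<open>T_set\<close> by inequalities and bounds the supports of Hecke
  functions.\<close>

definition gl2_ball :: "real \<Rightarrow> real \<Rightarrow> 'k gl2 set" where
  "gl2_ball r c = {g. (\<forall>i j. nv (mat_of g $ i $ j) \<le> r) \<and> nv (gl2_det g) = c}"

lemma gl2_ball_iff:
  assumes "a * d - b * c \<noteq> 0"
  shows "gl2_of a b c d \<in> gl2_ball r s \<longleftrightarrow>
    nv a \<le> r \<and> nv b \<le> r \<and> nv c \<le> r \<and> nv d \<le> r \<and> nv (a * d - b * c) = s"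
  using assms by (auto simp: gl2_ball_def forall_2 gl2_of_nth det_2)

lemma nv_mult_le: "nv x \<le> r \<Longrightarrow> nv y \<le> 1 \<Longrightarrow> nv (x * y) \<le> r" "nv x \<le> 1 \<Longrightarrow> nv y \<le> r \<Longrightarrow> nv (x * y) \<le> r"
  by (metis mult.commute mult_left_le_one_le nv_mult nv_nonneg order_trans)
     (metis mult_left_le_one_le nv_mult nv_nonneg order_trans)

lemma gl2_ball_K:
  assumes "g \<in> gl2_ball r c" "k \<in> K"
  shows "g * k \<in> gl2_ball r c" "k * g \<in> gl2_ball r c"
proof -
  have g: "nv (mat_of g $ i $ j) \<le> r" "nv (gl2_det g) = c" and k: "nv (mat_of k $ i $ j) \<le> 1" "nv (gl2_det k) = 1" for i j
    using assms by (auto simp: gl2_ball_def gl2_int_def)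
  show "g * k \<in> gl2_ball r c"
    unfolding gl2_ball_def mem_Collect_eq gl2_det_mult nv_mult
    using g k by (auto simp: times_gl2.rep_eq matrix_matrix_mult_def sum_2 intro!: nv_add_le nv_mult_le(1))
  show "k * g \<in> gl2_ball r c"
    unfolding gl2_ball_def mem_Collect_eq gl2_det_mult nv_mult
    using g k by (auto simp: times_gl2.rep_eq matrix_matrix_mult_def sum_2 intro!: nv_add_le nv_mult_le(2))
qed

section \<open>The double coset of \<open>mir p 0\<close> and its Hecke operator\<close>

definition T_set :: "'k gl2 set" where
  "T_set = {k * mir (of_nat p) 0 * k' | k k'. k \<in> K \<and> k' \<in> K}"

text \<open>The \<open>p + 1\<close> neighbours of the base vertex: the subballs
  \<open>c + p \<int>\<^sub>p\<close>, and the enclosing ball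
  \<open>p\<^sup>-\<^sup>1 \<int>\<^sub>p\<close>, which appears as
  \<open>gl2_of 1 0 0 p = scal p * mir (1 / p) 0\<close>.\<close>

definition T_reps :: "'k gl2 set" where
  "T_reps = insert (gl2_of 1 0 0 (of_nat p)) ((\<lambda>c. mir (of_nat p) (of_nat c)) ` {..<p})"

lemma T_set_ball: "T_set \<subseteq> gl2_ball 1 (1 / real p)"
proof -
  have "mir (of_nat p) 0 \<in> gl2_ball 1 (1 / real p)"
    using p_gt_0 by (subst gl2_ball_iff) (auto simp: nv_p)
  then show ?thesis by (auto simp: T_set_def intro: gl2_ball_K)
qed

lemma T_set_right: "g \<in> T_set \<Longrightarrow> k \<in> K \<Longrightarrow> g * k \<in> T_set"
  unfolding T_set_def using K_mult by (fastforce simp: mult.assoc)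

lemma T_set_left: "g \<in> T_set \<Longrightarrow> k \<in> K \<Longrightarrow> k * g \<in> T_set"
proof -
  assume g: "g \<in> T_set" and k: "k \<in> K"
  then obtain k1 k2 where "g = k1 * mir (of_nat p) 0 * k2" "k1 \<in> K" "k2 \<in> K" by (auto simp: T_set_def)
  then have "k * g = (k * k1) * mir (of_nat p) 0 * k2" "k * k1 \<in> K" "k2 \<in> K" using k K_mult by (auto simp: mult.assoc)
  then show ?thesis unfolding T_set_def by blast
qed

lemma T_reps_subset: "T_reps \<subseteq> T_set"
proof -
  have "mir (of_nat p) 0 \<in> T_set" unfolding T_set_def using K_one by force
  moreover have "mir (of_nat p :: 'k) (of_nat c) = mir 1 (of_nat c) * mir (of_nat p) 0" for c
    by (simp add: mir_mult)
  moreover have "gl2_of 1 0 0 (of_nat p) = w_elt * mir (of_nat p) 0 * w_elt"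
    by (simp add: w_elt_def gl2_of_mult)
  moreover have "mir 1 (of_nat c :: 'k) \<in> K" for c by (simp add: mir_K_iff nv_of_nat_le)
  ultimately show ?thesis using w_elt_K
    by (auto simp: T_reps_def intro: T_set_left T_set_right)
qed

text \<open>The determinant vanishes modulo \<open>p\<close>. If the lower row is nonzero modulo
  \<open>p\<close>, the upper row is therefore \<open>e\<close> times it and \<open>mir p e\<close>
  splits off; otherwise the lower row is divisible by \<open>p\<close>. The quotient has unit
  determinant.\<close>

lemma T_cover:
  assumes "g \<in> gl2_ball 1 (1 / real p)"
  shows "\<exists>r\<in>T_reps. \<exists>k\<in>K. g = r * k"
proof -
  let ?p = "of_nat p :: 'k"
  obtain a b c d where g: "g = gl2_of a b c d" "a * d - b * c \<noteq> 0" by (rule gl2_cases)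
  then have le: "nv a \<le> 1" "nv b \<le> 1" "nv c \<le> 1" "nv d \<le> 1" and det: "nv (a * d - b * c) = 1 / real p"
    using assms by (auto simp: gl2_ball_iff)
  have det1: "nv (a * d - b * c) < 1" using det unfolding nv_less_1_iff by simp
  have divp: "nv (x / ?p) \<le> 1" if "nv x < 1" for x
    using that p_gt_0 unfolding nv_less_1_iff by (simp add: nv_divide nv_p field_simps)
  have one: "\<exists>r\<in>T_reps. \<exists>k\<in>K. g = r * k" if e: "e < p" "nv (a - of_nat e * c) < 1" "nv (b - of_nat e * d) < 1" for e
  proof -
    let ?a = "(a - of_nat e * c) / ?p" and ?b = "(b - of_nat e * d) / ?p"
    have D: "?a * d - ?b * c = (a * d - b * c) / ?p" by (simp add: field_simps)
    have D1: "nv (?a * d - ?b * c) = 1" unfolding D by (simp add: nv_divide det nv_p)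
    then have nz: "?a * d - ?b * c \<noteq> 0" by auto
    have "gl2_of ?a ?b c d \<in> K" using le e divp D1 by (intro K_intro) auto
    moreover have "g = mir ?p (of_nat e) * gl2_of ?a ?b c d"
      unfolding g(1) by (subst gl2_of_mult[OF _ nz]) simp_all
    moreover have "mir ?p (of_nat e) \<in> T_reps" using e by (auto simp: T_reps_def)
    ultimately show ?thesis by blast
  qed
  have unit_cancel: "nv x < 1" if "nv (u * x) < 1" "nv u = 1" for u x using that by (simp add: nv_mult)
  consider "nv c = 1" | "nv d = 1" | "nv c < 1" "nv d < 1" using le by linarith
  then show ?thesis
  proof cases
    case 1
    then obtain e where e: "e < p" "nv (a / c - of_nat e) < 1" using residue[of "a / c"] le by (auto simp: nv_divide)
    have c: "c \<noteq> 0" using 1 by auto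
    have "nv (c * (a / c - of_nat e)) < 1" using e 1 by (simp add: nv_mult)
    then have ea: "nv (a - of_nat e * c) < 1" using c by (simp add: algebra_simps)
    have "c * (b - of_nat e * d) = (a - of_nat e * c) * d - (a * d - b * c)" by (simp add: algebra_simps)
    moreover have "nv ((a - of_nat e * c) * d) < 1"
      using ea le(4) by (simp add: nv_mult) (metis mult.commute mult_left_le_one_le nv_nonneg order_le_less_trans)
    ultimately have "nv (c * (b - of_nat e * d)) < 1"
      using det1 nv_diff[of "(a - of_nat e * c) * d" "a * d - b * c"] by simp
    then show ?thesis using one[OF e(1) ea] unit_cancel 1 by blast
  next
    case 2
    then obtain e where e: "e < p" "nv (b / d - of_nat e) < 1" using residue[of "b / d"] le by (auto simp: nv_divide)
    have d: "d \<noteq> 0" using 2 by auto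
    have "nv (d * (b / d - of_nat e)) < 1" using e 2 by (simp add: nv_mult)
    then have eb: "nv (b - of_nat e * d) < 1" using d by (simp add: algebra_simps)
    have "d * (a - of_nat e * c) = (b - of_nat e * d) * c + (a * d - b * c)" by (simp add: algebra_simps)
    moreover have "nv ((b - of_nat e * d) * c) < 1"
      using eb le(3) by (simp add: nv_mult) (metis mult.commute mult_left_le_one_le nv_nonneg order_le_less_trans)
    ultimately have "nv (d * (a - of_nat e * c)) < 1"
      using det1 nv_add_less by metis
    then show ?thesis using one[OF e(1) _ eb] unit_cancel 2 by blast
  next
    case 3
    have D: "a * (d / ?p) - b * (c / ?p) = (a * d - b * c) / ?p" by (simp add: field_simps)
    have D1: "nv (a * (d / ?p) - b * (c / ?p)) = 1" unfolding D by (simp add: nv_divide det nv_p)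
    then have nz: "a * (d / ?p) - b * (c / ?p) \<noteq> 0" by auto
    have "gl2_of a b (c / ?p) (d / ?p) \<in> K" using le 3 divp D1 by (intro K_intro) auto
    moreover have "g = gl2_of 1 0 0 ?p * gl2_of a b (c / ?p) (d / ?p)"
      unfolding g(1) by (subst gl2_of_mult[OF _ nz]) simp_all
    ultimately show ?thesis by (auto simp: T_reps_def)
  qed
qed

lemma mir_p_dist: "c < p \<Longrightarrow> c' < p \<Longrightarrow> k \<in> K \<Longrightarrow> mir (of_nat p) (of_nat c) = mir (of_nat p) (of_nat c') * k \<Longrightarrow> c = c'"
proof -
  assume c: "c < p" "c' < p" and k: "k \<in> K" and eq: "mir (of_nat p) (of_nat c) = mir (of_nat p) (of_nat c') * k"
  have "k = inverse (mir (of_nat p) (of_nat c')) * mir (of_nat p) (of_nat c)" unfolding eq by simp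
  also have "\<dots> = mir 1 ((of_nat c - of_nat c') / of_nat p)"
    by (simp add: mir_inverse mir_mult diff_divide_distrib)
  finally have "nv ((of_nat c - of_nat c') / of_nat p) \<le> 1" using k by (simp add: mir_K_iff)
  then have "nv (of_nat c - of_nat c') \<le> 1 / real p"
    using p_gt_0 by (simp add: nv_divide nv_p field_simps)
  then have "nv (of_nat c - of_nat c') < 1" by (simp add: nv_less_1_iff)
  then show ?thesis using residue_unique c by blast
qed

lemma mir_p_dist_inf: "k \<in> K \<Longrightarrow> mir (of_nat p) (of_nat c) \<noteq> gl2_of 1 0 0 (of_nat p) * k"
  "k \<in> K \<Longrightarrow> gl2_of 1 0 0 (of_nat p) \<noteq> mir (of_nat p) (of_nat c) * k"
proof -
  have 1: "mir (of_nat p) (of_nat c) \<noteq> gl2_of 1 0 0 (of_nat p) * k" if k: "k \<in> K" for k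
  proof
    let ?p = "of_nat p :: 'k"
    assume eq: "mir ?p (of_nat c) = gl2_of 1 0 0 ?p * k"
    have "k = inverse (gl2_of 1 0 0 ?p) * mir ?p (of_nat c)" unfolding eq by simp
    also have "\<dots> = gl2_of ?p (of_nat c) 0 (1 / ?p)"
      using gl2_of_inverse[of 1 ?p 0 0 ?p] by (simp add: gl2_of_mult)
    finally show False using k p_gt_1 by (simp add: K_iff nv_divide nv_p)
  qed
  then show "k \<in> K \<Longrightarrow> mir (of_nat p) (of_nat c) \<noteq> gl2_of 1 0 0 (of_nat p) * k" by blast
  show "k \<in> K \<Longrightarrow> gl2_of 1 0 0 (of_nat p) \<noteq> mir (of_nat p) (of_nat c) * k"
    using 1[of "inverse k"] K_inverse[of k] by (auto simp: mult.assoc)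
qed

lemma T_coset_reps: "coset_reps K T_set T_reps"
  unfolding coset_reps_def
proof (intro conjI ballI impI)
  show "T_set = (\<Union>r\<in>T_reps. lcoset r K)"
    using T_set_ball T_cover T_reps_subset T_set_right by (fastforce simp: lcoset_def)
  fix r r' k assume r: "r \<in> T_reps" "r' \<in> T_reps" "k \<in> K" "r = r' * k"
  then show "r = r'"
    using mir_p_dist[of _ _ k] mir_p_dist_inf[of k] unfolding T_reps_def by (elim insertE imageE) (metis lessThan_iff)+
qed

lemma sum_T_reps: "(\<Sum>r\<in>T_reps. f r) = (\<Sum>c<p. f (mir (of_nat p) (of_nat c))) + f (gl2_of 1 0 0 (of_nat p))"
proof -
  have inj: "inj_on (\<lambda>c. mir (of_nat p) (of_nat c :: 'k)) {..<p}"
    by (rule inj_onI) (metis K_one lessThan_iff mir_p_dist mult.right_neutral)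
  have "gl2_of 1 0 0 (of_nat p) \<notin> (\<lambda>c. mir (of_nat p) (of_nat c :: 'k)) ` {..<p}"
    using mir_p_dist_inf(2)[OF K_one] by auto
  then show ?thesis unfolding T_reps_def by (simp add: sum.reindex[OF inj] add.commute)
qed

definition hecke_T :: "('k gl2 \<Rightarrow> complex) \<Rightarrow> 'k gl2 \<Rightarrow> complex" where
  "hecke_T F x = (\<Sum>c<p. F (x * mir (of_nat p) (of_nat c))) + F (x * gl2_of 1 0 0 (of_nat p))"

lemma T_p_eq: "T_p p nv = indicator T_set"
  by (simp add: T_p_def T_set_def)

lemma hecke_act_T: "right_inv K F \<Longrightarrow> hecke_act K (T_p p nv) F = hecke_T F"
  unfolding T_p_eq
  by (rule ext, subst hecke_act_reps[OF K_one lcoset_K T_coset_reps]) (simp_all add: hecke_T_def sum_T_reps)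

lemma lcoset_inverse_image: "(\<lambda>x. inverse k * x) ` (\<lambda>x. k * x) ` C = C" "(\<lambda>x. k * x) ` (\<lambda>x. inverse k * x) ` C = C"
  for k :: "'k gl2"
  by (simp_all add: image_image)

text \<open>Left multiplication by an element of \<open>K\<close> permutes the left cosets contained
  in the double coset \<open>T_set\<close>.\<close>

lemma right_inv_hecke_T:
  assumes F: "right_inv K F"
  shows "right_inv K (hecke_T F)"
proof (rule right_invI)
  fix x k assume k: "k \<in> K"
  let ?C = "{lcoset g K | g. g \<in> T_set}"
  have img: "(\<lambda>y. h * y) ` lcoset g K = lcoset (h * g) K" for h g
    by (auto simp: lcoset_def image_image mult.assoc)
  have bij: "bij_betw (\<lambda>C. (\<lambda>y. k * y) ` C) ?C ?C"
  proof (rule bij_betw_byWitness[where f' = "\<lambda>C. (\<lambda>y. inverse k * y) ` C"])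
    show "(\<lambda>C. (\<lambda>y. k * y) ` C) ` ?C \<subseteq> ?C" "(\<lambda>C. (\<lambda>y. inverse k * y) ` C) ` ?C \<subseteq> ?C"
      using T_set_left[OF _ k] T_set_left[OF _ K_inverse[OF k]] by (auto simp: img; blast)+
  qed (auto simp: lcoset_inverse_image)
  have eq: "hecke_T F x = (\<Sum>C\<in>?C. F (x * (SOME g. g \<in> C)))" for x
  proof -
    have "hecke_T F x = hecke_act K (indicator T_set) F x" using hecke_act_T[OF F] T_p_eq by simp
    also have "\<dots> = (\<Sum>C\<in>?C. indicator T_set (SOME g. g \<in> C) * F (x * (SOME g. g \<in> C)))"
      unfolding hecke_act_def rtrans_def
      by (rule sum.cong) (auto simp: lcoset_def indicator_def)
    also have "\<dots> = (\<Sum>C\<in>?C. F (x * (SOME g. g \<in> C)))"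
    proof (rule sum.cong[OF refl])
      fix C assume "C \<in> ?C"
      then obtain g where g: "C = lcoset g K" "g \<in> T_set" by blast
      have "g \<in> C" using g K_one by (force simp: lcoset_def)
      then have "(SOME g. g \<in> C) \<in> C" by (rule someI)
      then have "(SOME g. g \<in> C) \<in> T_set" using g T_set_right by (auto simp: lcoset_def)
      then show "indicator T_set (SOME g. g \<in> C) * F (x * (SOME g. g \<in> C)) = F (x * (SOME g. g \<in> C))" by simp
    qed
    finally show ?thesis .
  qed
  have "hecke_T F (x * k) = (\<Sum>C\<in>?C. F (x * (k * (SOME g. g \<in> C))))" unfolding eq by (simp add: mult.assoc)
  also have "\<dots> = (\<Sum>C\<in>?C. F (x * (SOME g. g \<in> C)))"
  proof (rule coset_sum_reindex[where H = K and F = "\<lambda>y. F (x * y)", OF _ _ _ _ bij])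
    show "F (x * (y * h)) = F (x * y)" if "h \<in> K" for y h
      using right_invD[OF F that, of "x * y"] by (simp add: mult.assoc)
  qed (use K_one in auto)
  finally show "hecke_T F (x * k) = hecke_T F x" unfolding eq .
qed

end

section \<open>Polynomials in a linear operator\<close>

definition fun_linear :: "(('g \<Rightarrow> complex) \<Rightarrow> 'g \<Rightarrow> complex) \<Rightarrow> bool" where
  "fun_linear T \<longleftrightarrow> (\<forall>F G a b. T (\<lambda>x. a * F x + b * G x) = (\<lambda>x. a * T F x + b * T G x))"

lemma fun_linearD: "fun_linear T \<Longrightarrow> T (\<lambda>x. a * F x + b * G x) = (\<lambda>x. a * T F x + b * T G x)"
  unfolding fun_linear_def by blast

lemma fun_linear_zero: "fun_linear T \<Longrightarrow> T (\<lambda>x. 0) = (\<lambda>x. 0)"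
  using fun_linearD[of T 0 "\<lambda>x. 0" 0 "\<lambda>x. 0"] by simp

lemma fun_linear_add: "fun_linear T \<Longrightarrow> T (\<lambda>x. F x + G x) = (\<lambda>x. T F x + T G x)"
  using fun_linearD[of T 1 F 1 G] by simp

lemma fun_linear_scale: "fun_linear T \<Longrightarrow> T (\<lambda>x. a * F x) = (\<lambda>x. a * T F x)"
  using fun_linearD[of T a F 0 F] by simp

lemma fun_linear_sum:
  assumes "fun_linear T" "finite I"
  shows "T (\<lambda>x. \<Sum>i\<in>I. c i * F i x) = (\<lambda>x. \<Sum>i\<in>I. c i * T (F i) x)"
  using assms(2)
  by (induction I rule: finite_induct)
    (simp_all add: fun_linear_zero[OF assms(1)] fun_linear_add[OF assms(1)] fun_linear_scale[OF assms(1)])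

lemma fun_linear_rtrans: "fun_linear (rtrans g)"
  by (auto simp: fun_linear_def rtrans_def)

text \<open>Horner's scheme for \<open>P(T) F\<close>, which makes functions a module over the
  polynomials.\<close>

definition pact :: "(('g \<Rightarrow> complex) \<Rightarrow> 'g \<Rightarrow> complex) \<Rightarrow> complex poly \<Rightarrow> ('g \<Rightarrow> complex) \<Rightarrow> 'g \<Rightarrow> complex" where
  "pact T P F = fold_coeffs (\<lambda>a G x. a * F x + T G x) P (\<lambda>_. 0)"

lemma pact_0 [simp]: "pact T 0 F = (\<lambda>_. 0)"
  by (simp add: pact_def)

lemma pact_pCons:
  assumes "fun_linear T"
  shows "pact T (pCons a P) F = (\<lambda>x. a * F x + T (pact T P F) x)"
  using fun_linear_zero[OF assms] by (cases "a = 0 \<and> P = 0") (auto simp: pact_def)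

lemma pact_add:
  assumes "fun_linear T"
  shows "pact T (P + Q) F = (\<lambda>x. pact T P F x + pact T Q F x)"
proof (induction P arbitrary: Q rule: pCons_induct)
  case (pCons a P)
  obtain b Q' where Q: "Q = pCons b Q'" by (cases Q)
  show ?case unfolding Q by (simp add: pact_pCons[OF assms] pCons.IH fun_linear_add[OF assms] algebra_simps)
qed simp

lemma pact_smult:
  assumes "fun_linear T"
  shows "pact T (smult c P) F = (\<lambda>x. c * pact T P F x)"
  by (induction P rule: pCons_induct) (simp_all add: pact_pCons[OF assms] fun_linear_scale[OF assms] algebra_simps)

lemma pact_sum:
  assumes "fun_linear T" "finite I"
  shows "pact T (\<Sum>i\<in>I. P i) F = (\<lambda>x. \<Sum>i\<in>I. pact T (P i) F x)"
  using assms(2) by (induction I rule: finite_induct) (simp_all add: pact_add[OF assms(1)])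

lemma pact_commute:
  assumes "fun_linear T"
  shows "pact T P (T F) = T (pact T P F)"
  by (induction P rule: pCons_induct)
    (simp_all add: pact_pCons[OF assms] fun_linear_zero[OF assms] fun_linear_add[OF assms] fun_linear_scale[OF assms])

lemma pact_linear:
  assumes "fun_linear T"
  shows "fun_linear (pact T P)"
proof (induction P rule: pCons_induct)
  case (pCons a P)
  then show ?case using assms by (simp add: fun_linear_def pact_pCons[OF assms] algebra_simps)
qed (simp add: fun_linear_def)

lemma pact_linear_factor:
  assumes "fun_linear T"
  shows "pact T ([:- c, 1:] * P) F = (\<lambda>x. T (pact T P F) x - c * pact T P F x)"
proof -
  have "[:- c, 1:] * P = smult (- c) P + pCons 0 P" by simp
  then show ?thesis by (simp only: pact_add[OF assms] pact_smult[OF assms] pact_pCons[OF assms]) simp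
qed

lemma pact_eigen:
  assumes "fun_linear T" "T F = (\<lambda>x. c * F x)"
  shows "pact T P F = (\<lambda>x. poly P c * F x)"
proof (induction P rule: pCons_induct)
  case (pCons a P)
  have "pact T (pCons a P) F = (\<lambda>x. a * F x + poly P c * (c * F x))"
    by (simp only: pact_pCons[OF assms(1)] pCons.IH fun_linear_scale[OF assms(1)] assms(2))
  then show ?case by (simp add: algebra_simps)
qed simp

lemma pact_mem:
  assumes "fun_linear T" "\<And>G. G \<in> U \<Longrightarrow> T G \<in> U" "(\<lambda>_. 0) \<in> U"
    "\<And>G H c. G \<in> U \<Longrightarrow> H \<in> U \<Longrightarrow> (\<lambda>x. c * G x + H x) \<in> U" "F \<in> U"
  shows "pact T P F \<in> U"
  by (induction P rule: pCons_induct) (use assms in \<open>auto simp: pact_pCons\<close>)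

text \<open>Over the complex numbers \<open>P\<close> loses linear factors one at a time. If
  removing \<open>X - z\<close> leaves a nonzero vector, that vector is an eigenvector for
  \<open>z\<close>; otherwise the shorter polynomial still annihilates \<open>F\<close>.\<close>

lemma eigenvector_of_annihilator:
  assumes "fun_linear T" "P \<noteq> 0" "pact T P F = (\<lambda>_. 0)" "F \<noteq> (\<lambda>_. 0)"
  shows "\<exists>c Q. pact T Q F \<noteq> (\<lambda>_. 0) \<and> T (pact T Q F) = (\<lambda>x. c * pact T Q F x)"
  using assms(2,3)
proof (induction "degree P" arbitrary: P rule: less_induct)
  case less
  show ?case
  proof (cases "degree P = 0")
    case True
    then obtain a where "P = [:a:]" by (meson degree_eq_zeroE)
    then have "F = (\<lambda>_. 0)" using less.prems by (auto simp: pact_pCons[OF assms(1)] fun_linear_zero[OF assms(1)] fun_eq_iff)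
    then show ?thesis using assms(4) by simp
  next
    case False
    then obtain z where "poly P z = 0"
      using fundamental_theorem_of_algebra[of P] by (auto simp: constant_degree)
    then obtain Q where Q: "P = [:- z, 1:] * Q" by (metis dvdE poly_eq_0_iff_dvd)
    then have Q0: "Q \<noteq> 0" using less.prems by auto
    have deg: "degree P = Suc (degree Q)" unfolding Q using Q0 by (subst degree_mult_eq) auto
    show ?thesis
    proof (cases "pact T Q F = (\<lambda>_. 0)")
      case True
      then show ?thesis using less.hyps[of Q] deg Q0 by simp
    next
      case False
      have "T (pact T Q F) = (\<lambda>x. z * pact T Q F x)"
        using less.prems(2) unfolding Q pact_linear_factor[OF assms(1)] by (simp add: fun_eq_iff)
      then show ?thesis using False by blast
    qed
  qed
qed

section \<open>Schur's lemma in countable dimension\<close>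

lemma invariant_subspaceD:
  assumes "invariant_subspace V"
  shows "(\<lambda>_. 0) \<in> V" "F \<in> V \<Longrightarrow> F' \<in> V \<Longrightarrow> (\<lambda>x. F x + F' x) \<in> V"
    "F \<in> V \<Longrightarrow> (\<lambda>x. c * F x) \<in> V" "F \<in> V \<Longrightarrow> rtrans g F \<in> V"
  using assms unfolding invariant_subspace_def by blast+

lemma invariant_subspace_lincomb:
  assumes "invariant_subspace V" "F \<in> V" "F' \<in> V"
  shows "(\<lambda>x. a * F x + b * F' x) \<in> V"
  using invariant_subspaceD(2)[OF assms(1) invariant_subspaceD(3)[OF assms(1,2), of a] invariant_subspaceD(3)[OF assms(1,3), of b]] .

lemma invariant_subspace_sum:
  assumes "invariant_subspace V" "finite I" "\<And>i. i \<in> I \<Longrightarrow> F i \<in> V"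
  shows "(\<lambda>x. \<Sum>i\<in>I. c i * F i x) \<in> V"
  using assms(2,3)
  by (induction I rule: finite_induct) (auto intro!: invariant_subspaceD[OF assms(1)])

lemma rtrans_rtrans: "rtrans g (rtrans h F) = rtrans (g * h) F" for g :: "'g::semigroup_mult"
  by (simp add: rtrans_def mult.assoc)

lemma rtrans_one [simp]: "rtrans 1 F = F" for F :: "'g::monoid_mult \<Rightarrow> complex"
  by (simp add: rtrans_def)

lemma rtrans_span_over:
  fixes g :: "'g::semigroup_mult"
  assumes "F \<in> span_over UNIV {rtrans h F0 | h. True}"
  shows "rtrans g F \<in> span_over UNIV {rtrans h F0 | h. True}"
proof -
  obtain S c where S: "F = (\<lambda>x. \<Sum>b\<in>S. c b * b x)" "finite S" "S \<subseteq> {rtrans h F0 | h. True}"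
    using assms unfolding span_over_def by blast
  have "rtrans g F = (\<lambda>x. \<Sum>b\<in>S. c b * rtrans g b x)" by (simp add: S(1) rtrans_def)
  moreover have "rtrans g b \<in> {rtrans h F0 | h. True}" if "b \<in> S" for b
    using that S(3) rtrans_rtrans by fastforce
  ultimately show ?thesis using span_over_sum[OF S(2), of "rtrans g"] by simp
qed

lemma span_over_add:
  assumes "F \<in> span_over UNIV B" "G \<in> span_over UNIV B"
  shows "(\<lambda>x. a * F x + b * G x) \<in> span_over UNIV B"
proof -
  obtain S c where S: "F = (\<lambda>x. \<Sum>b\<in>S. c b * b x)" "finite S" "S \<subseteq> B"
    using assms(1) unfolding span_over_def by blast
  obtain S' c' where S': "G = (\<lambda>x. \<Sum>b\<in>S'. c' b * b x)" "finite S'" "S' \<subseteq> B"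
    using assms(2) unfolding span_over_def by blast
  let ?I = "Inl ` S \<union> Inr ` S'"
  let ?f = "case_sum (\<lambda>y. y) (\<lambda>y. y)" and ?c = "case_sum (\<lambda>y. a * c y) (\<lambda>y. b * c' y)"
  have "(\<lambda>x. a * F x + b * G x) = (\<lambda>x. \<Sum>i\<in>?I. ?c i * ?f i x)"
    unfolding S(1) S'(1)
    by (rule ext, subst sum.union_disjoint)
      (use S(2) S'(2) in \<open>auto simp: sum.reindex sum_distrib_left mult.assoc\<close>)
  moreover have "(\<lambda>x. \<Sum>i\<in>?I. ?c i * ?f i x) \<in> span_over UNIV B"
    by (rule span_over_sum) (use S(2,3) S'(2,3) in auto)
  ultimately show ?thesis by simp
qed

lemma span_over_base: "b \<in> B \<Longrightarrow> b \<in> span_over UNIV B"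
  using span_over_sum[of "{()}" "\<lambda>_. b" B "\<lambda>_. 1"] by simp

lemma span_over_zero: "(\<lambda>_. 0) \<in> span_over UNIV B"
  using span_over_sum[of "{}" "\<lambda>_. _" B] by simp

lemma invariant_subspace_orbit_span:
  fixes F0 :: "'g::monoid_mult \<Rightarrow> complex"
  shows "invariant_subspace (span_over UNIV {rtrans h F0 | h. True})"
  unfolding invariant_subspace_def
proof (intro conjI allI ballI)
  fix F F' c assume F: "F \<in> span_over UNIV {rtrans h F0 | h. True}"
  show "(\<lambda>x. c * F x) \<in> span_over UNIV {rtrans h F0 | h. True}"
    using span_over_add[OF F F, of c 0] by simp
  assume F': "F' \<in> span_over UNIV {rtrans h F0 | h. True}"
  show "(\<lambda>x. F x + F' x) \<in> span_over UNIV {rtrans h F0 | h. True}"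
    using span_over_add[OF F F', of 1 1] by simp
qed (rule span_over_zero, rule rtrans_span_over)

lemma irreducible_cyclic:
  fixes V :: "('g::monoid_mult \<Rightarrow> complex) set"
  assumes V: "invariant_subspace V" "irreducible_rep V" and F0: "F0 \<in> V" "F0 \<noteq> (\<lambda>_. 0)"
  shows "V = span_over UNIV {rtrans h F0 | h. True}"
proof -
  let ?U = "span_over UNIV {rtrans h F0 | h. True}"
  have "rtrans 1 F0 \<in> ?U" by (rule span_over_base) blast
  then have "F0 \<in> ?U" by simp
  moreover have "?U \<subseteq> V"
  proof
    fix F assume "F \<in> ?U"
    then obtain S c where S: "F = (\<lambda>x. \<Sum>b\<in>S. c b * b x)" "finite S" "S \<subseteq> {rtrans h F0 | h. True}"
      unfolding span_over_def by blast
    show "F \<in> V" unfolding S(1)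
      using S(3) F0 invariant_subspaceD(4)[OF V(1)] by (intro invariant_subspace_sum[OF V(1) S(2)]) auto
  qed
  ultimately show ?thesis
    using V(2) invariant_subspace_orbit_span[of F0] F0(2) unfolding irreducible_rep_def by blast
qed

text \<open>An eigenspace of an operator that commutes with the group is an invariant
  subspace.\<close>

lemma irreducible_scalar:
  assumes V: "invariant_subspace V" "irreducible_rep V" and T: "fun_linear T"
    and comm: "\<And>g F. T (rtrans g F) = rtrans g (T F)"
    and G: "G \<in> V" "G \<noteq> (\<lambda>_. 0)" "T G = (\<lambda>x. c * G x)" and F: "F \<in> V"
  shows "T F = (\<lambda>x. c * F x)"
proof -
  let ?U = "{F \<in> V. T F = (\<lambda>x. c * F x)}"
  have "invariant_subspace ?U"
    unfolding invariant_subspace_def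
    by (auto intro: invariant_subspaceD[OF V(1)]
        simp: fun_linear_zero[OF T] fun_linear_add[OF T] fun_linear_scale[OF T] comm algebra_simps)
      (simp add: rtrans_def)
  then have "?U = V" using V(2) G unfolding irreducible_rep_def by blast
  then show ?thesis using F by blast
qed

lemma sum_fun_pointwise: "(\<Sum>i\<in>I. f i) x = (\<Sum>i\<in>I. f i x)"
  for f :: "'i \<Rightarrow> 'g \<Rightarrow> complex"
  by (induction I rule: infinite_finite_induct) auto

lemma linear_relation:
  fixes G :: "'i \<Rightarrow> 'g \<Rightarrow> complex"
  assumes S: "finite S" and D: "finite D" "card D > card S" and inj: "inj_on G D"
    and G: "\<And>c. c \<in> D \<Longrightarrow> G c \<in> span_over UNIV S"
  shows "\<exists>a. (\<exists>c\<in>D. a c \<noteq> 0) \<and> (\<forall>x. (\<Sum>c\<in>D. a c * G c x) = 0)"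
proof -
  interpret cf: vector_space "\<lambda>(c::complex) (f::'g \<Rightarrow> complex) x. c * f x"
    by unfold_locales (simp_all add: fun_eq_iff distrib_left distrib_right)
  have "G ` D \<subseteq> cf.span S"
  proof
    fix y assume "y \<in> G ` D"
    then obtain S' c where S': "y = (\<lambda>x. \<Sum>b\<in>S'. c b * b x)" "S' \<subseteq> S"
      using G unfolding span_over_def by blast
    have "y = (\<Sum>b\<in>S'. (\<lambda>x. c b * b x))" unfolding S' by (auto simp: sum_fun_pointwise)
    also have "\<dots> \<in> cf.span S" using S' by (intro cf.span_sum cf.span_scale cf.span_base) auto
    finally show "y \<in> cf.span S" .
  qed
  then have "cf.dependent (G ` D)"
    using cf.independent_span_bound[OF S, of "G ` D"] D(2) card_image[OF inj] by auto
  then obtain u v where u: "v \<in> G ` D" "u v \<noteq> 0" "(\<Sum>v\<in>G ` D. (\<lambda>x. u v * v x)) = 0"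
    using cf.dependent_finite[of "G ` D"] D(1) by auto
  have "(\<Sum>c\<in>D. u (G c) * G c x) = 0" for x
    using fun_cong[OF u(3), of x] by (simp add: sum_fun_pointwise sum.reindex[OF inj])
  then show ?thesis using u by (intro exI[of _ "\<lambda>c. u (G c)"]) auto
qed

text \<open>
  Dixmier's argument: if \<open>T\<close> had no eigenvector, all \<open>T - c\<close> would be invertible, and the vectors
  \<open>(T - c)\<^sup>-\<^sup>1 F0\<close> would be uncountably many independent ones, a relation between them being a
  polynomial relation for \<open>T\<close>.
\<close>

lemma irreducible_eigenvector:
  fixes V :: "('g::monoid_mult \<Rightarrow> complex) set"
  assumes V: "invariant_subspace V" "irreducible_rep V"
    and T: "fun_linear T" "\<And>F. F \<in> V \<Longrightarrow> T F \<in> V"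
    and comm: "\<And>g F. T (rtrans g F) = rtrans g (T F)"
    and B: "countable B" "V = span_over UNIV B"
  shows "\<exists>G c. G \<in> V \<and> G \<noteq> (\<lambda>_. 0) \<and> T G = (\<lambda>x. c * G x)"
proof (rule ccontr)
  assume no: "\<not> ?thesis"
  note VD = invariant_subspaceD[OF V(1)] invariant_subspace_lincomb[OF V(1)]
  have "V \<noteq> {\<lambda>_. 0}" using V(2) unfolding irreducible_rep_def by blast
  then obtain F0 where F0: "F0 \<in> V" "F0 \<noteq> (\<lambda>_. 0)" using VD(1) by blast
  \<comment> \<open>The image of \<open>T - c\<close> is invariant, and nonzero because
    \<open>F0\<close> is not an eigenvector, so irreducibility makes it all of
    \<open>V\<close>.\<close>
  have "\<exists>G\<in>V. (\<lambda>x. T G x - c * G x) = F0" for c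
  proof -
    let ?R = "\<lambda>G x. T G x - c * G x"
    let ?U = "?R ` V"
    have "invariant_subspace ?U"
      unfolding invariant_subspace_def
    proof (intro conjI ballI allI)
      show "(\<lambda>_. 0) \<in> ?U" using VD(1) by (intro image_eqI[of _ _ "\<lambda>_. 0"]) (auto simp: fun_linear_zero[OF T(1)])
      fix F assume "F \<in> ?U"
      then obtain G where G: "G \<in> V" "F = ?R G" by blast
      show "(\<lambda>x. d * F x) \<in> ?U" for d
        using G VD(3) by (intro image_eqI[of _ _ "\<lambda>x. d * G x"]) (auto simp: fun_linear_scale[OF T(1)] algebra_simps)
      show "rtrans g F \<in> ?U" for g
        using G VD(4) by (intro image_eqI[of _ _ "rtrans g G"]) (auto simp: comm, simp add: rtrans_def)
      fix F' assume "F' \<in> ?U"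
      then obtain G' where G': "G' \<in> V" "F' = ?R G'" by blast
      show "(\<lambda>x. F x + F' x) \<in> ?U"
        using G G' VD(2) by (intro image_eqI[of _ _ "\<lambda>x. G x + G' x"]) (auto simp: fun_linear_add[OF T(1)] algebra_simps)
    qed
    moreover have "?U \<subseteq> V"
    proof
      fix F assume "F \<in> ?U"
      then obtain G where G: "G \<in> V" "F = ?R G" by blast
      show "F \<in> V" using VD(5)[OF T(2)[OF G(1)] G(1), of 1 "- c"] G(2) by simp
    qed
    moreover have "?U \<noteq> {\<lambda>_. 0}"
    proof
      assume "?U = {\<lambda>_. 0}"
      then have "?R F0 = (\<lambda>_. 0)" using F0(1) by blast
      then have "T F0 = (\<lambda>x. c * F0 x)" by (simp add: fun_eq_iff)
      then show False using no F0 by blast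
    qed
    ultimately have "?U = V" using V(2) unfolding irreducible_rep_def by blast
    then have "F0 \<in> ?U" using F0(1) by simp
    then show ?thesis by (elim imageE) (rule bexI, rule sym)
  qed
  then obtain G where G: "\<And>c. G c \<in> V" "\<And>c. (\<lambda>x. T (G c) x - c * G c x) = F0" by metis
  have inj: "inj G"
  proof (rule injI, rule ccontr)
    fix c d assume cd: "G c = G d" "c \<noteq> d"
    have "(c - d) * G c x = 0" for x
      using fun_cong[OF G(2)[of c], of x] fun_cong[OF G(2)[of d], of x] cd by (simp add: algebra_simps)
    then have "G c = (\<lambda>_. 0)" using cd by auto
    then show False using G(2)[of c] F0(2) fun_linear_zero[OF T(1)] by simp
  qed
  have "\<exists>S. finite S \<and> S \<subseteq> B \<and> G c \<in> span_over UNIV S" for c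
    using G(1)[of c] unfolding B(2) span_over_def by blast
  then obtain S where S: "\<And>c. finite (S c)" "\<And>c. S c \<subseteq> B" "\<And>c. G c \<in> span_over UNIV (S c)" by metis
  \<comment> \<open>There are uncountably many \<open>c\<close> but only countably many finite
    subsets of \<open>B\<close>, so infinitely many \<open>G c\<close> lie in one finite-dimensional
    span.\<close>
  have "\<exists>A. infinite {c. S c = A}"
  proof (rule ccontr)
    assume "\<not> ?thesis"
    then have "countable {c. S c = A}" for A by (simp add: countable_finite)
    moreover have "countable {A. finite A \<and> A \<subseteq> B}" using B(1) by (rule countable_Collect_finite_subset)
    ultimately have "countable (\<Union>A\<in>{A. finite A \<and> A \<subseteq> B}. {c. S c = A})" by blast
    moreover have "(\<Union>A\<in>{A. finite A \<and> A \<subseteq> B}. {c. S c = A}) = (UNIV :: complex set)" using S by blast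
    ultimately show False using uncountable_UNIV_complex by simp
  qed
  then obtain A where A: "infinite {c. S c = A}" by blast
  obtain D where D: "D \<subseteq> {c. S c = A}" "finite D" "card D = Suc (card A)"
    using infinite_arbitrarily_large[OF A] by blast
  have SA: "S c = A" if "c \<in> D" for c using that D(1) by blast
  have "D \<noteq> {}" using D(3) by auto
  then have finA: "finite A" using SA S(1) by (metis ex_in_conv)
  have "\<exists>a. (\<exists>c\<in>D. a c \<noteq> 0) \<and> (\<forall>x. (\<Sum>c\<in>D. a c * G c x) = 0)"
  proof (rule linear_relation[OF finA D(2)])
    show "inj_on G D" using inj by (rule inj_on_subset) simp
    show "G c \<in> span_over UNIV A" if "c \<in> D" for c using S(3)[of c] SA[OF that] by simp
  qed (simp add: D(3))
  then obtain a c0 where a: "c0 \<in> D" "a c0 \<noteq> 0" "\<And>x. (\<Sum>c\<in>D. a c * G c x) = 0" by blast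
  \<comment> \<open>Formally the relation reads
    \<open>(\<Sum>c\<in>D. a c / (T - c)) F0 = 0\<close>; \<open>Q\<close> is its numerator over the
    common denominator.\<close>
  define Q where "Q = (\<Sum>c\<in>D. smult (a c) (\<Prod>d\<in>D - {c}. [:- d, 1:]))"
  have "pact T Q F0 = (\<lambda>x. \<Sum>c\<in>D. a c * pact T (\<Prod>d\<in>D. [:- d, 1:]) (G c) x)"
  proof -
    have "pact T (\<Prod>d\<in>D - {c}. [:- d, 1:]) F0 = pact T (\<Prod>d\<in>D. [:- d, 1:]) (G c)" if "c \<in> D" for c
    proof -
      let ?P = "\<Prod>d\<in>D - {c}. [:- d, 1:]"
      have "pact T (\<Prod>d\<in>D. [:- d, 1:]) (G c) = pact T ([:- c, 1:] * ?P) (G c)"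
        using prod.remove[OF D(2) that] by metis
      also have "\<dots> = (\<lambda>x. 1 * pact T ?P (T (G c)) x + (- c) * pact T ?P (G c) x)"
        unfolding pact_linear_factor[OF T(1)] by (simp add: pact_commute[OF T(1)])
      also have "\<dots> = pact T ?P (\<lambda>x. 1 * T (G c) x + (- c) * G c x)"
        by (rule fun_linearD[OF pact_linear[OF T(1)], symmetric])
      also have "\<dots> = pact T ?P F0" using G(2)[of c] by simp
      finally show ?thesis by simp
    qed
    then show ?thesis unfolding Q_def pact_sum[OF T(1) D(2)] pact_smult[OF T(1)] by simp
  qed
  also have "\<dots> = pact T (\<Prod>d\<in>D. [:- d, 1:]) (\<lambda>x. \<Sum>c\<in>D. a c * G c x)"
    by (rule fun_linear_sum[OF pact_linear[OF T(1)] D(2), symmetric])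
  also have "\<dots> = (\<lambda>_. 0)" using a(3) fun_linear_zero[OF pact_linear[OF T(1)]] by simp
  finally have ann: "pact T Q F0 = (\<lambda>_. 0)" .
  \<comment> \<open>At \<open>c0\<close> every summand but one contains the factor
    \<open>c0 - c0\<close>, which shows that the annihilating polynomial is not zero.\<close>
  have "poly Q c0 = a c0 * (\<Prod>d\<in>D - {c0}. c0 - d)"
  proof -
    have "poly Q c0 = (\<Sum>c\<in>D. a c * (\<Prod>d\<in>D - {c}. c0 - d))"
      by (simp add: Q_def poly_sum poly_prod)
    also have "\<dots> = a c0 * (\<Prod>d\<in>D - {c0}. c0 - d) + (\<Sum>c\<in>D - {c0}. a c * (\<Prod>d\<in>D - {c}. c0 - d))"
      by (rule sum.remove[OF D(2) a(1)])
    also have "(\<Sum>c\<in>D - {c0}. a c * (\<Prod>d\<in>D - {c}. c0 - d)) = 0"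
      using D(2) a(1) by (intro sum.neutral) auto
    finally show ?thesis by simp
  qed
  then have "Q \<noteq> 0" using a D(2) by auto
  then obtain c P where "pact T P F0 \<noteq> (\<lambda>_. 0)" "T (pact T P F0) = (\<lambda>x. c * pact T P F0 x)"
    using eigenvector_of_annihilator[OF T(1) _ ann F0(2)] by blast
  moreover have "pact T P F0 \<in> V"
    using T(2) VD F0(1) by (intro pact_mem[OF T(1)]) (auto intro: VD(2,3))
  ultimately show False using no by blast
qed

section \<open>Averaging over the maximal compact subgroup\<close>

context padic_gl2
begin

definition mbound :: "'k^2^2 \<Rightarrow> real \<Rightarrow> bool" where
  "mbound M r \<longleftrightarrow> (\<forall>i j. nv (M $ i $ j) \<le> r)"

lemma mbound_add: "mbound M r \<Longrightarrow> mbound N r \<Longrightarrow> mbound (M + N) r"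
  by (auto simp: mbound_def intro: nv_add_le)

lemma mbound_mult:
  assumes "mbound M r" "mbound N s"
  shows "mbound (M ** N) (r * s)"
proof -
  have "0 \<le> r" using assms(1) nv_nonneg order_trans unfolding mbound_def by blast
  then show ?thesis
    using assms unfolding mbound_def matrix_matrix_mult_def
    by (auto simp: sum_2 nv_mult intro!: nv_add_le mult_mono)
qed

lemma matrix_diff_ldistrib: "A ** (B - C) = A ** B - A ** C" for A B C :: "'k^2^2"
  by (simp add: matrix_matrix_mult_def vec_eq_iff right_diff_distrib sum_subtractf)

lemma matrix_diff_rdistrib: "(B - C) ** A = B ** A - C ** A" for A B C :: "'k^2^2"
  by (simp add: matrix_matrix_mult_def vec_eq_iff left_diff_distrib sum_subtractf)

lemma mbound_exists: "\<exists>r>0. mbound M r"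
proof -
  define r where "r = 1 + (\<Sum>i\<in>UNIV. \<Sum>j\<in>UNIV. nv (M $ i $ j))"
  have "nv (M $ i $ j) \<le> r" for i j
  proof -
    have "nv (M $ i $ j) \<le> (\<Sum>j\<in>UNIV. nv (M $ i $ j))" by (rule member_le_sum) auto
    also have "\<dots> \<le> (\<Sum>i\<in>UNIV. \<Sum>j\<in>UNIV. nv (M $ i $ j))"
      by (rule member_le_sum) (auto intro: sum_nonneg)
    finally show ?thesis by (simp add: r_def)
  qed
  moreover have "r > 0" unfolding r_def by (intro add_pos_nonneg sum_nonneg) auto
  ultimately show ?thesis unfolding mbound_def by blast
qed

lemma mbound_mono: "mbound M r \<Longrightarrow> r \<le> s \<Longrightarrow> mbound M s"
  unfolding mbound_def by (meson order_trans)

lemma mbound_one: "mbound (mat 1) 1"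
  by (auto simp: mbound_def mat_def)

lemma K_eq_mbound: "g \<in> K \<longleftrightarrow> mbound (mat_of g) 1 \<and> nv (gl2_det g) = 1"
  by (simp add: gl2_int_def mbound_def)

text \<open>The principal congruence subgroup of level \<open>p^n\<close>, normal and of finite
  index in \<open>K\<close>.\<close>

definition Kc :: "nat \<Rightarrow> 'k gl2 set" where
  "Kc n = {h \<in> K. mbound (mat_of h - mat 1) ((1 / real p) ^ n)}"

lemma eps_pos: "(1 / real p) ^ n > 0"
  using p_gt_0 by simp

lemma mat_of_mult: "mat_of (g * h) = mat_of g ** mat_of h" for g h :: "'k gl2"
  by (rule times_gl2.rep_eq)

lemma mat_of_one: "mat_of (1 :: 'k gl2) = mat 1"
  by (rule one_gl2.rep_eq)

lemma mat_of_inverse_mult: "mat_of (inverse g) ** mat_of g = mat 1" for g :: "'k gl2"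
  by (metis gl2_inverse(1) mat_of_mult mat_of_one)

lemma nv_det_inverse: "nv (gl2_det (inverse g)) * nv (gl2_det g) = 1"
  by (metis gl2_det_mult gl2_inverse(1) mat_of_one det_I nv_1 nv_mult)

lemma conj_minus_one:
  "mat_of (inverse g * h * g) - mat 1 = mat_of (inverse g) ** (mat_of h - mat 1) ** mat_of g" for g h :: "'k gl2"
  using mat_of_inverse_mult[of g]
  by (simp add: mat_of_mult matrix_diff_ldistrib matrix_diff_rdistrib)

lemma Kc_subset: "Kc n \<subseteq> K" by (auto simp: Kc_def)

lemma Kc_one: "1 \<in> Kc n"
  using K_one by (simp add: Kc_def mat_of_one mbound_def)

lemma Kc_conj:
  assumes "h \<in> Kc n" "k \<in> K"
  shows "inverse k * h * k \<in> Kc n"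
proof -
  have "mbound (mat_of (inverse k)) 1" "mbound (mat_of k) 1"
    using assms K_inverse K_eq_mbound by blast+
  then have "mbound (mat_of (inverse k) ** (mat_of h - mat 1) ** mat_of k) (1 * (1 / real p) ^ n * 1)"
    using assms(1) by (intro mbound_mult) (auto simp: Kc_def)
  then show ?thesis
    using assms K_mult K_inverse Kc_subset[of n] by (auto simp: Kc_def conj_minus_one)
qed

text \<open>Conjugation by \<open>g\<close> enlarges the entries of \<open>h - 1\<close> by at most
  a factor depending on \<open>g\<close>, which \<open>p^-n\<close> eventually outweighs.\<close>

lemma Kc_conj_K:
  shows "eventually (\<lambda>n. \<forall>h\<in>Kc n. inverse g * h * g \<in> K) sequentially"
proof -
  obtain r where r: "r > 0" "mbound (mat_of (inverse g)) r" using mbound_exists by blast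
  obtain s where s: "s > 0" "mbound (mat_of g) s" using mbound_exists by blast
  have "(\<lambda>n. (1 / real p) ^ n) \<longlonglongrightarrow> 0" using p_gt_1 by (intro LIMSEQ_power_zero) auto
  then have "eventually (\<lambda>n. (1 / real p) ^ n < 1 / (r * s)) sequentially"
    using r s by (intro order_tendstoD) auto
  then show ?thesis
  proof eventually_elim
    case (elim n)
    show ?case
    proof
      fix h assume h: "h \<in> Kc n"
      have "mbound (mat_of (inverse g * h * g) - mat 1) (r * (1 / real p) ^ n * s)"
        unfolding conj_minus_one using h r s by (intro mbound_mult) (auto simp: Kc_def)
      moreover have "r * (1 / real p) ^ n * s \<le> 1"
        using elim r s by (simp add: field_simps)
      ultimately have "mbound (mat_of (inverse g * h * g) - mat 1) 1" by (rule mbound_mono)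
      from mbound_add[OF this mbound_one] have "mbound (mat_of (inverse g * h * g)) 1" by simp
      moreover have "nv (gl2_det (inverse g * h * g)) = 1"
        using h nv_det_inverse[of g] by (auto simp: Kc_def K_eq_mbound gl2_det_mult nv_mult)
      ultimately show "inverse g * h * g \<in> K" by (simp add: K_eq_mbound)
    qed
  qed
qed

text \<open>No single level serves all translates of a spherical function. The form with
  \<open>eventually\<close> lets finitely many of them share one.\<close>

lemma right_inv_rtrans_Kc:
  assumes "right_inv K F"
  shows "eventually (\<lambda>n. right_inv (Kc n) (rtrans g F)) sequentially"
  using Kc_conj_K[of g]
proof eventually_elim
  case (elim n)
  show ?case
  proof (rule right_invI)
    fix x h assume h: "h \<in> Kc n"
    have "x * h * g = x * g * (inverse g * h * g)" by (simp add: mult.assoc)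
    then show "rtrans g F (x * h) = rtrans g F x"
      unfolding rtrans_def using right_invD[OF assms, of "inverse g * h * g" "x * g"] elim h by simp
  qed
qed

definition Kcosets :: "nat \<Rightarrow> 'k gl2 set set" where
  "Kcosets n = {lcoset k (Kc n) | k. k \<in> K}"

lemma Kc_diff:
  assumes "k \<in> K" "k' \<in> K" "mbound (mat_of k' - mat_of k) ((1 / real p) ^ n)"
  shows "inverse k * k' \<in> Kc n"
proof -
  have "mat_of (inverse k * k') - mat 1 = mat_of (inverse k) ** (mat_of k' - mat_of k)"
    using mat_of_inverse_mult[of k] by (simp add: mat_of_mult matrix_diff_ldistrib)
  moreover have "mbound (mat_of (inverse k) ** (mat_of k' - mat_of k)) (1 * (1 / real p) ^ n)"
    using assms K_inverse K_eq_mbound by (intro mbound_mult) blast+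
  ultimately show ?thesis using assms K_mult K_inverse by (simp add: Kc_def)
qed

lemma Kc_mult: "h \<in> Kc n \<Longrightarrow> h' \<in> Kc n \<Longrightarrow> h * h' \<in> Kc n"
proof -
  assume h: "h \<in> Kc n" and h': "h' \<in> Kc n"
  have e: "mat_of (h * h') - mat 1 = mat_of h ** (mat_of h' - mat 1) + (mat_of h - mat 1)"
    by (simp add: mat_of_mult matrix_diff_ldistrib)
  have "mbound (mat_of h ** (mat_of h' - mat 1)) (1 * (1 / real p) ^ n)"
    using h h' by (intro mbound_mult) (auto simp: Kc_def K_eq_mbound)
  then have "mbound (mat_of (h * h') - mat 1) ((1 / real p) ^ n)"
    unfolding e using h by (intro mbound_add) (auto simp: Kc_def)
  then show ?thesis using h h' K_mult by (auto simp: Kc_def)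
qed

lemma mbound_minus: "mbound (M - N) r \<Longrightarrow> mbound (N - M) r"
  by (simp add: mbound_def) (metis nv_diff_commute)

lemma Kc_inverse: "h \<in> Kc n \<Longrightarrow> inverse h \<in> Kc n"
  using Kc_diff[of h 1 n] K_one mbound_minus[of "mat_of h" "mat 1"] by (auto simp: Kc_def mat_of_one)

lemma lcoset_Kc_eq:
  assumes "h \<in> Kc n"
  shows "lcoset (k * h) (Kc n) = lcoset k (Kc n)"
proof (intro equalityI subsetI)
  fix x assume "x \<in> lcoset k (Kc n)"
  then obtain y where y: "y \<in> Kc n" "x = k * y" by (auto simp: lcoset_def)
  then have "x = k * h * (inverse h * y)" "inverse h * y \<in> Kc n"
    using Kc_mult Kc_inverse assms by (auto simp: mult.assoc)
  then show "x \<in> lcoset (k * h) (Kc n)" unfolding lcoset_def by blast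
qed (use Kc_mult assms in \<open>auto simp: lcoset_def mult.assoc\<close>)

text \<open>Two elements of \<open>K\<close> whose entries have the same residues modulo
  \<open>p^n\<close> lie in the same coset.\<close>

lemma finite_Kcosets: "finite (Kcosets n)"
proof -
  have "\<forall>x. nv x \<le> 1 \<longrightarrow> (\<exists>c<p^n. nv (x - of_nat c) \<le> (1 / real p) ^ n)"
    using residue_power by blast
  then obtain c where c: "\<And>x. nv x \<le> 1 \<Longrightarrow> c x < p^n" "\<And>x. nv x \<le> 1 \<Longrightarrow> nv (x - of_nat (c x)) \<le> (1 / real p) ^ n"
    by metis
  define t where "t = (\<lambda>k :: 'k gl2. \<lambda>(i, j). c (mat_of k $ i $ j))"
  have ent: "nv (mat_of k $ i $ j) \<le> 1" if "k \<in> K" for k i j using that by (auto simp: gl2_int_def)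
  have "t ` K \<subseteq> PiE UNIV (\<lambda>_. {..<p^n})"
    using c(1) ent by (auto simp: t_def)
  then have "finite (t ` K)" by (rule finite_subset) (intro finite_PiE, auto)
  moreover have same: "lcoset k (Kc n) = lcoset k' (Kc n)" if k: "k \<in> K" "k' \<in> K" "t k = t k'" for k k'
  proof -
    have "mbound (mat_of k' - mat_of k) ((1 / real p) ^ n)"
      unfolding mbound_def
    proof (intro allI)
      fix i j
      have "c (mat_of k $ i $ j) = c (mat_of k' $ i $ j)"
        using fun_cong[OF k(3), of "(i, j)"] by (simp add: t_def)
      then have "nv ((mat_of k' $ i $ j - of_nat (c (mat_of k' $ i $ j))) - (mat_of k $ i $ j - of_nat (c (mat_of k' $ i $ j)))) \<le> (1 / real p) ^ n"
        using c(2)[OF ent[OF k(1)], of i j] c(2)[OF ent[OF k(2)], of i j] by (intro nv_diff_le[of "_ - _" _ "_ - _"]) auto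
      then show "nv ((mat_of k' - mat_of k) $ i $ j) \<le> (1 / real p) ^ n" by simp
    qed
    then have "inverse k * k' \<in> Kc n" using Kc_diff k by blast
    from lcoset_Kc_eq[OF this, of k] show ?thesis by simp
  qed
  define q where "q = (\<lambda>y. lcoset (SOME k. k \<in> K \<and> t k = y) (Kc n))"
  have "lcoset k (Kc n) = q (t k)" if "k \<in> K" for k
    unfolding q_def using that by (intro same) (auto intro: someI2[of _ k])
  then have "Kcosets n \<subseteq> q ` t ` K" unfolding Kcosets_def by blast
  ultimately show ?thesis using finite_subset by blast
qed

text \<open>On functions fixed by \<open>Kc n\<close> this is the integral over \<open>K\<close> of
  total mass \<open>1\<close>, written as a finite sum; on others it depends on the chosen
  representatives.\<close>

definition Av :: "nat \<Rightarrow> ('k gl2 \<Rightarrow> complex) \<Rightarrow> 'k gl2 \<Rightarrow> complex" where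
  "Av n F x = (\<Sum>C\<in>Kcosets n. F (x * (SOME c. c \<in> C))) / of_nat (card (Kcosets n))"

lemma card_Kcosets: "card (Kcosets n) \<noteq> 0"
  using finite_Kcosets K_one by (auto simp: Kcosets_def card_eq_0_iff)

lemma some_Kcosets:
  assumes "C \<in> Kcosets n"
  shows "(SOME c. c \<in> C) \<in> K"
proof -
  obtain k where k: "C = lcoset k (Kc n)" "k \<in> K" using assms by (auto simp: Kcosets_def)
  then have "k \<in> C" using Kc_one by (force simp: lcoset_def)
  then have "(SOME c. c \<in> C) \<in> C" by (rule someI)
  then obtain h where "h \<in> Kc n" "(SOME c. c \<in> C) = k * h" using k(1) by (auto simp: lcoset_def)
  then show ?thesis using K_mult[OF k(2) subsetD[OF Kc_subset[of n]]] by simp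
qed

lemma Av_fixed: "right_inv K F \<Longrightarrow> Av n F = F"
  using card_Kcosets[of n] some_Kcosets right_invD[of K F] by (auto simp: Av_def fun_eq_iff)

lemma Av_linear: "fun_linear (Av n)"
  by (auto simp: fun_linear_def Av_def sum.distrib sum_distrib_left add_divide_distrib)

text \<open>As \<open>Kc n\<close> is normal in \<open>K\<close>, right multiplication by
  \<open>k\<close> permutes its left cosets.\<close>

lemma Av_rtrans:
  assumes F: "right_inv (Kc n) F" and k: "k \<in> K"
  shows "Av n (rtrans k F) = Av n F"
proof (rule ext)
  fix x
  have img: "(\<lambda>y. y * h) ` lcoset g (Kc n) = lcoset (g * h) (Kc n)" if h: "h \<in> K" for h g
  proof (intro equalityI subsetI)
    fix y assume "y \<in> (\<lambda>y. y * h) ` lcoset g (Kc n)"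
    then obtain z where z: "z \<in> Kc n" "y = g * z * h" by (auto simp: lcoset_def)
    then have "y = g * h * (inverse h * z * h)" by (simp add: mult.assoc)
    then show "y \<in> lcoset (g * h) (Kc n)" using Kc_conj[OF z(1) h] by (auto simp: lcoset_def)
  next
    fix y assume "y \<in> lcoset (g * h) (Kc n)"
    then obtain z where z: "z \<in> Kc n" "y = g * h * z" by (auto simp: lcoset_def)
    then have "y = g * (inverse (inverse h) * z * inverse h) * h" by (simp add: mult.assoc)
    then show "y \<in> (\<lambda>y. y * h) ` lcoset g (Kc n)"
      using Kc_conj[OF z(1) K_inverse[OF h]] unfolding lcoset_def by blast
  qed
  have bij: "bij_betw (\<lambda>C. (\<lambda>y. y * k) ` C) (Kcosets n) (Kcosets n)"
  proof (rule bij_betw_byWitness[where f' = "\<lambda>C. (\<lambda>y. y * inverse k) ` C"])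
    show "(\<lambda>C. (\<lambda>y. y * k) ` C) ` Kcosets n \<subseteq> Kcosets n" "(\<lambda>C. (\<lambda>y. y * inverse k) ` C) ` Kcosets n \<subseteq> Kcosets n"
      using K_mult[OF _ k] K_mult[OF _ K_inverse[OF k]] unfolding Kcosets_def
      by (auto simp: img[OF k] img[OF K_inverse[OF k]]; blast)+
  qed (auto simp: image_image mult.assoc)
  have "(\<Sum>C\<in>Kcosets n. F (x * ((SOME c. c \<in> C) * k))) = (\<Sum>C\<in>Kcosets n. F (x * (SOME c. c \<in> C)))"
  proof (rule coset_sum_reindex[where H = "Kc n" and F = "\<lambda>y. F (x * y)" and \<tau> = "\<lambda>y. y * k", OF _ _ _ _ bij])
    show "F (x * (y * h)) = F (x * y)" if "h \<in> Kc n" for y h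
      using right_invD[OF F that, of "x * y"] by (simp add: mult.assoc)
  qed (use Kc_one in \<open>auto simp: Kcosets_def\<close>)
  then show "Av n (rtrans k F) x = Av n F x" unfolding Av_def rtrans_def by (simp add: mult.assoc)
qed

section \<open>The spherical line\<close>

abbreviation dg :: "nat \<Rightarrow> 'k gl2" where "dg n \<equiv> mir (of_nat p ^ n) 0"

lemma hecke_T_linear: "fun_linear hecke_T"
  by (auto simp: fun_linear_def hecke_T_def sum.distrib sum_distrib_left algebra_simps)

lemma hecke_T_eq_rtrans:
  "hecke_T F = (\<lambda>x. (\<Sum>c<p. rtrans (mir (of_nat p) (of_nat c)) F x) + rtrans (gl2_of 1 0 0 (of_nat p)) F x)"
  by (rule ext) (simp add: hecke_T_def rtrans_def)

lemma hecke_T_mem: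
  assumes "invariant_subspace V" "F \<in> V"
  shows "hecke_T F \<in> V"
proof -
  have "(\<lambda>x. \<Sum>c<p. 1 * rtrans (mir (of_nat p) (of_nat c)) F x) \<in> V"
    by (rule invariant_subspace_sum[OF assms(1) finite_lessThan invariant_subspaceD(4)[OF assms]])
  from invariant_subspaceD(2)[OF assms(1) this invariant_subspaceD(4)[OF assms]]
  show ?thesis unfolding hecke_T_eq_rtrans by simp
qed

text \<open>Of the neighbours of \<open>dg n\<close>, \<open>p\<close> are \<open>dg (Suc n)\<close>
  up to a unipotent element of \<open>K\<close> on the left, which averaging absorbs, and one is
  \<open>dg (n - 1)\<close> up to a scalar. For \<open>n = 0\<close> the last one is
  \<open>dg 1\<close> again, up to \<open>w_elt\<close> on both sides.\<close>

lemma dg_T_reps: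
  "dg n * mir (of_nat p) (of_nat c) = mir 1 (of_nat p ^ n * of_nat c) * dg (Suc n)"
  "dg (Suc n) * gl2_of 1 0 0 (of_nat p) = scal (of_nat p) * dg n"
  "gl2_of 1 0 0 (of_nat p) = w_elt * (dg 1 * w_elt)"
  by (simp_all add: gl2_of_mult w_elt_def mult.commute)

text \<open>Averaging the translate of \<open>hecke_T F\<close> by \<open>dg (Suc j)\<close> gives
  \<open>p\<close> times the average for \<open>dg (Suc (Suc j))\<close> plus
  \<open>\<omega>\<close> times that for \<open>dg j\<close>, which can be solved for the deepest
  term. At the base vertex all \<open>p + 1\<close> neighbours average to the same function, whence
  the constant \<open>1 / (p + 1)\<close>. The induction is over all \<open>F\<close> because it is
  also applied to \<open>hecke_T F\<close>.\<close>

lemma Av_dg: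
  assumes V: "invariant_subspace V" and om: "\<And>F. F \<in> V \<Longrightarrow> rtrans (scal (of_nat p)) F = (\<lambda>x. \<omega> * F x)"
    and F: "F \<in> V" "right_inv K F"
  shows "\<exists>P. eventually (\<lambda>m. Av m (rtrans (dg n) F) = pact hecke_T P F) sequentially"
  using F
proof (induction n arbitrary: F rule: less_induct)
  case (less n)
  note inv = right_inv_rtrans_Kc[OF less.prems(2)]
  have T: "hecke_T F \<in> V" "right_inv K (hecke_T F)"
    using hecke_T_mem[OF V less.prems(1)] right_inv_hecke_T[OF less.prems(2)] by auto
  have upper: "eventually (\<lambda>m. \<forall>c<p. Av m (rtrans (dg n * mir (of_nat p) (of_nat c)) F) = Av m (rtrans (dg (Suc n)) F)) sequentially" for n
    using inv[of "dg (Suc n)"]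
  proof eventually_elim
    case (elim m)
    have "mir 1 (of_nat p ^ n * of_nat c) \<in> K" for c
      by (subst mir_K_iff) (auto intro!: nv_mult_le_1 simp: nv_power nv_of_nat_le power_le_one)
    then show ?case unfolding dg_T_reps(1) rtrans_rtrans[symmetric] using Av_rtrans[OF elim] by blast
  qed
  have split: "Av m (rtrans (dg n) (hecke_T F)) = (\<lambda>x. (\<Sum>c<p. Av m (rtrans (dg n * mir (of_nat p) (of_nat c)) F) x)
      + Av m (rtrans (dg n * gl2_of 1 0 0 (of_nat p)) F) x)" for m n
  proof -
    have "rtrans (dg n) (hecke_T F) = (\<lambda>x. (\<Sum>c<p. 1 * rtrans (dg n * mir (of_nat p) (of_nat c)) F x)
      + rtrans (dg n * gl2_of 1 0 0 (of_nat p)) F x)"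
      by (simp add: hecke_T_def rtrans_def mult.assoc)
    then show ?thesis by (simp only: fun_linear_add[OF Av_linear] fun_linear_sum[OF Av_linear finite_lessThan]) simp
  qed
  consider "n = 0" | "n = 1" | j where "n = Suc (Suc j)" by (metis One_nat_def not0_implies_Suc)
  then show ?case
  proof cases
    case 1
    have "Av m (rtrans (dg n) F) = pact hecke_T [:1:] F" for m
      using 1 Av_fixed[OF less.prems(2)] by (simp add: pact_pCons[OF hecke_T_linear] fun_linear_zero[OF hecke_T_linear])
    then show ?thesis by (intro exI[of _ "[:1:]"]) simp
  next
    case 2
    have low: "eventually (\<lambda>m. Av m (rtrans (gl2_of 1 0 0 (of_nat p)) F) = Av m (rtrans (dg 1) F)) sequentially"
      using inv[of "dg 1"]
    proof eventually_elim
      case (elim m)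
      have "rtrans w_elt F = F" using less.prems(2) w_elt_K by (auto simp: right_inv_def)
      then show ?case unfolding dg_T_reps(3) rtrans_rtrans[symmetric]
        using Av_rtrans[OF elim w_elt_K] by simp
    qed
    have "eventually (\<lambda>m. Av m (rtrans (dg 1) F) = pact hecke_T [:0, 1 / (of_nat p + 1):] F) sequentially"
      using low upper[of 0]
    proof eventually_elim
      case (elim m)
      have "hecke_T F x = (of_nat p + 1) * Av m (rtrans (dg 1) F) x" for x
        using fun_cong[OF split[of m 0], of x] elim Av_fixed[OF T(2)] by (simp add: algebra_simps)
      moreover have "(of_nat p + 1 :: complex) \<noteq> 0" by (metis of_nat_Suc of_nat_eq_0_iff nat.distinct(2) add.commute)
      moreover have "pact hecke_T (smult (1 / (of_nat p + 1)) [:0, 1:]) F = (\<lambda>x. 1 / (of_nat p + 1) * hecke_T F x)"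
        unfolding pact_smult[OF hecke_T_linear]
        by (simp add: pact_pCons[OF hecke_T_linear] fun_linear_zero[OF hecke_T_linear])
      ultimately show ?case by (simp add: fun_eq_iff)
    qed
    then show ?thesis using 2 by auto
  next
    case 3
    obtain P where P: "eventually (\<lambda>m. Av m (rtrans (dg (Suc j)) (hecke_T F)) = pact hecke_T P (hecke_T F)) sequentially"
      using less.IH[of "Suc j" "hecke_T F"] 3 T by auto
    obtain Q where Q: "eventually (\<lambda>m. Av m (rtrans (dg j) F) = pact hecke_T Q F) sequentially"
      using less.IH[of j F] 3 less.prems by auto
    let ?R = "smult (1 / of_nat p) (pCons 0 P + smult (- \<omega>) Q)"
    have "eventually (\<lambda>m. Av m (rtrans (dg n) F) = pact hecke_T ?R F) sequentially"
      using P Q upper[of "Suc j"]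
    proof eventually_elim
      case (elim m)
      have sc: "rtrans (dg (Suc j) * gl2_of 1 0 0 (of_nat p)) F = (\<lambda>x. \<omega> * rtrans (dg j) F x)"
        unfolding dg_T_reps(2) rtrans_rtrans[symmetric]
        by (rule om[OF invariant_subspaceD(4)[OF V less.prems(1)]])
      have "pact hecke_T P (hecke_T F) x = of_nat p * Av m (rtrans (dg n) F) x + \<omega> * pact hecke_T Q F x" for x
        using fun_cong[OF split[of m "Suc j"], of x] elim 3
        unfolding sc fun_linear_scale[OF Av_linear] by simp
      moreover have "pact hecke_T ?R F = (\<lambda>x. 1 / of_nat p * (pact hecke_T P (hecke_T F) x - \<omega> * pact hecke_T Q F x))"
        by (simp only: pact_smult[OF hecke_T_linear] pact_add[OF hecke_T_linear] pact_pCons[OF hecke_T_linear]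
            pact_commute[OF hecke_T_linear]) simp
      ultimately show ?case by (simp add: fun_eq_iff)
    qed
    then show ?thesis by blast
  qed
qed

text \<open>By irreducibility \<open>F'\<close> is a combination of translates of \<open>F\<close>.
  Averaging fixes \<open>F'\<close>, and by the Cartan decomposition it turns each translate into a
  multiple of the average for some \<open>dg n\<close>, hence into a polynomial in
  \<open>hecke_T\<close> applied to \<open>F\<close>.\<close>

lemma K_fixed_cyclic:
  assumes V: "invariant_subspace V" "irreducible_rep V"
    and om: "\<And>a. a \<noteq> 0 \<Longrightarrow> \<exists>c. \<forall>F\<in>V. rtrans (scal a) F = (\<lambda>x. c * F x)"
    and F: "F \<in> V" "right_inv K F" "F \<noteq> (\<lambda>_. 0)" and F': "F' \<in> V" "right_inv K F'"
  shows "\<exists>P. F' = pact hecke_T P F"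
proof -
  obtain \<omega> where omp: "\<And>F. F \<in> V \<Longrightarrow> rtrans (scal (of_nat p)) F = (\<lambda>x. \<omega> * F x)" using om[of "of_nat p"] by auto
  have each: "\<exists>P. eventually (\<lambda>m. Av m (rtrans g F) = pact hecke_T P F) sequentially" for g
  proof -
    obtain k z n k' where g: "g = k * (scal z * dg n) * k'" "k \<in> K" "k' \<in> K" "z \<noteq> 0" by (rule cartan)
    obtain c where c: "\<And>F. F \<in> V \<Longrightarrow> rtrans (scal z) F = (\<lambda>x. c * F x)" using om g by blast
    obtain P where P: "eventually (\<lambda>m. Av m (rtrans (dg n) F) = pact hecke_T P F) sequentially"
      using Av_dg[OF V(1) omp F(1,2)] by blast
    have "rtrans k' F = F" using g F by (auto simp: right_inv_def)
    then have eq: "rtrans g F = rtrans k (\<lambda>x. c * rtrans (dg n) F x)"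
      unfolding g(1) rtrans_rtrans[symmetric] using c invariant_subspaceD(4)[OF V(1) F(1)] by simp
    have "eventually (\<lambda>m. Av m (rtrans g F) = pact hecke_T (smult c P) F) sequentially"
      using P right_inv_rtrans_Kc[OF F(2), of "dg n"]
    proof eventually_elim
      case (elim m)
      have "right_inv (Kc m) (\<lambda>x. c * rtrans (dg n) F x)"
        using elim(2) by (auto simp: right_inv_def rtrans_def fun_eq_iff)
      then have "Av m (rtrans g F) = Av m (\<lambda>x. c * rtrans (dg n) F x)" unfolding eq by (rule Av_rtrans) fact
      then show ?case using elim(1) by (simp add: fun_linear_scale[OF Av_linear] pact_smult[OF hecke_T_linear])
    qed
    then show ?thesis by blast
  qed
  obtain S c where S: "F' = (\<lambda>x. \<Sum>b\<in>S. c b * b x)" "finite S" "S \<subseteq> {rtrans h F | h. True}"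
    using F'(1) irreducible_cyclic[OF V F(1,3)] unfolding span_over_def by blast
  have "\<forall>b\<in>S. \<exists>P. eventually (\<lambda>m. Av m b = pact hecke_T P F) sequentially" using S(3) each by blast
  then obtain P where P: "\<And>b. b \<in> S \<Longrightarrow> eventually (\<lambda>m. Av m b = pact hecke_T (P b) F) sequentially" by metis
  then have "eventually (\<lambda>m. \<forall>b\<in>S. Av m b = pact hecke_T (P b) F) sequentially"
    using S(2) by (intro eventually_ball_finite) auto
  then obtain m where m: "\<forall>b\<in>S. Av m b = pact hecke_T (P b) F"
    using eventually_happens trivial_limit_sequentially by blast
  have "F' = Av m F'" using Av_fixed[OF F'(2)] by simp
  also have "\<dots> = (\<lambda>x. \<Sum>b\<in>S. c b * Av m b x)"
    unfolding S(1) by (rule fun_linear_sum[OF Av_linear S(2)])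
  also have "\<dots> = pact hecke_T (\<Sum>b\<in>S. smult (c b) (P b)) F"
    unfolding pact_sum[OF hecke_T_linear S(2)] pact_smult[OF hecke_T_linear] using m by simp
  finally show ?thesis by blast
qed

text \<open>Schur's lemma is needed only for the scalar \<open>p\<close>. Unit scalars lie in
  \<open>K\<close> and fix \<open>F0\<close>, hence act trivially on all of \<open>V\<close>, and
  every scalar is a power of \<open>p\<close> times a unit.\<close>

lemma central_irreducible:
  assumes V: "invariant_subspace V" "irreducible_rep V"
    and F: "F0 \<in> V" "right_inv K F0" "F0 \<noteq> (\<lambda>_. 0)" and a: "a \<noteq> 0"
  shows "\<exists>c. \<forall>F\<in>V. rtrans (scal a) F = (\<lambda>x. c * F x)"
proof -
  have comm: "rtrans (scal z) (rtrans g F) = rtrans g (rtrans (scal z) F)" if "z \<noteq> 0" for z g and F :: "'k gl2 \<Rightarrow> complex"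
    using scal_commute[OF that, of g] by (simp add: rtrans_rtrans)
  let ?P = "of_nat p :: 'k"
  let ?B = "(\<lambda>(n, m, q). rtrans (scal (?P powi n) * mir (?P powi m) (of_rat q)) F0) ` (UNIV :: (int \<times> int \<times> rat) set)"
  have "{rtrans h F0 | h. True} = ?B"
  proof (intro equalityI subsetI)
    fix y assume "y \<in> {rtrans h F0 | h. True}"
    then obtain h where h: "y = rtrans h F0" by blast
    obtain n m q k where nm: "h = scal (?P powi n) * mir (?P powi m) (of_rat q) * k" "k \<in> K" by (rule iwasawa_rat)
    have "rtrans k F0 = F0" using F nm by (auto simp: right_inv_def)
    then have "y = rtrans (scal (?P powi n) * mir (?P powi m) (of_rat q)) F0"
      unfolding h nm(1) by (metis rtrans_rtrans)
    then show "y \<in> ?B" by (intro image_eqI[of _ _ "(n, m, q)"]) auto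
  qed auto
  then have B: "countable ?B" "V = span_over UNIV ?B" using irreducible_cyclic[OF V F(1,3)] by auto
  obtain G \<omega> where G: "G \<in> V" "G \<noteq> (\<lambda>_. 0)" "rtrans (scal ?P) G = (\<lambda>x. \<omega> * G x)"
    using irreducible_eigenvector[OF V fun_linear_rtrans invariant_subspaceD(4)[OF V(1)] comm[OF pk_nz] B] by blast
  have om: "rtrans (scal ?P) F = (\<lambda>x. \<omega> * F x)" if "F \<in> V" for F
    by (rule irreducible_scalar[OF V fun_linear_rtrans comm[OF pk_nz] G that])
  have om_inv: "F x = \<omega> * rtrans (scal (inverse ?P)) F x" if "F \<in> V" for F x
    using fun_cong[OF om[OF invariant_subspaceD(4)[OF V(1) that]], of "scal (inverse ?P)" x]
    by (simp add: rtrans_rtrans scal_mult)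
  have nz: "\<omega> \<noteq> 0" using om_inv[OF F(1)] F(3) by auto
  have unit: "rtrans (scal u) F = F" if u: "nv u = 1" and "F \<in> V" for u F
  proof -
    have "u \<noteq> 0" using u by auto
    moreover have "rtrans (scal u) F0 = (\<lambda>x. 1 * F0 x)" using F(2) scal_K[OF u] by (auto simp: right_inv_def)
    ultimately show ?thesis
      using irreducible_scalar[OF V fun_linear_rtrans comm F(1,3) _ that(2), of u 1] by simp
  qed
  have pow: "rtrans (scal (?P ^ n)) F = (\<lambda>x. \<omega> ^ n * F x)" if "F \<in> V" for F n
  proof (induction n)
    case (Suc n)
    have "rtrans (scal (?P ^ Suc n)) F = rtrans (scal ?P) (rtrans (scal (?P ^ n)) F)"
      by (simp add: rtrans_rtrans scal_mult)
    then show ?case using Suc om[OF that] by (simp add: rtrans_def fun_eq_iff)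
  qed simp
  obtain n u where nu: "a = ?P powi n * u" "nv u = 1" using unit_decomp[OF a] by blast
  then have u0: "u \<noteq> 0" by auto
  have "rtrans (scal a) F = (\<lambda>x. \<omega> powi n * F x)" if FV: "F \<in> V" for F
  proof -
    have au: "rtrans (scal a) F = rtrans (scal (?P powi n)) F"
      using unit[OF nu(2) FV] u0 by (simp add: nu(1) scal_mult[symmetric] rtrans_rtrans[symmetric])
    show ?thesis
    proof (cases "n \<ge> 0")
      case True
      then show ?thesis using pow[OF FV, of "nat n"] au by (simp add: power_int_def)
    next
      case False
      let ?n = "nat (- n)"
      have "rtrans (scal (?P ^ ?n)) (rtrans (scal (?P powi n)) F) = F"
        using False by (simp add: rtrans_rtrans scal_mult power_int_def power_inverse)
      then have "F x = \<omega> ^ ?n * rtrans (scal (?P powi n)) F x" for x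
        using pow[OF invariant_subspaceD(4)[OF V(1) FV], of ?n "scal (?P powi n)"] by metis
      then show ?thesis using False nz unfolding au by (simp add: power_int_def field_simps fun_eq_iff power_inverse)
    qed
  qed
  then show ?thesis by blast
qed

text \<open>Cyclicity applied to \<open>hecke_T F0\<close>, if nonzero, writes \<open>F0\<close> as
  \<open>P(T) T F0\<close>, so \<open>X P - 1\<close> annihilates \<open>F0\<close> and an
  eigenvector \<open>G\<close> of \<open>hecke_T\<close> exists. Cyclicity from \<open>G\<close>
  then confines all spherical vectors to the line through \<open>G\<close>.\<close>

lemma spherical_line_irreducible:
  assumes V: "invariant_subspace V" "irreducible_rep V"
    and F: "F0 \<in> V" "right_inv K F0" "F0 \<noteq> (\<lambda>_. 0)" and F': "F \<in> V" "right_inv K F"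
  shows "\<exists>c. F = (\<lambda>x. c * F0 x)"
proof -
  note cyc = K_fixed_cyclic[OF V central_irreducible[OF V F]]
  note HL = hecke_T_linear
  have V_K: "pact hecke_T P F0 \<in> V \<and> right_inv K (pact hecke_T P F0)" for P
  proof -
    have "pact hecke_T P F0 \<in> {G \<in> V. right_inv K G}"
    proof (rule pact_mem[OF HL])
      fix G H c assume "G \<in> {G \<in> V. right_inv K G}" "H \<in> {G \<in> V. right_inv K G}"
      then show "(\<lambda>x. c * G x + H x) \<in> {G \<in> V. right_inv K G}"
        using invariant_subspace_lincomb[OF V(1), of G H c 1] by (auto simp: right_inv_def rtrans_def fun_eq_iff)
    qed (use F hecke_T_mem[OF V(1)] right_inv_hecke_T invariant_subspaceD(1)[OF V(1)] in
          \<open>auto simp: right_inv_def rtrans_def\<close>)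
    then show ?thesis by simp
  qed
  have "\<exists>c G. G \<in> V \<and> right_inv K G \<and> G \<noteq> (\<lambda>_. 0) \<and> hecke_T G = (\<lambda>x. c * G x)"
  proof (cases "hecke_T F0 = (\<lambda>_. 0)")
    case True
    then show ?thesis using F by (intro exI[of _ 0] exI[of _ F0]) auto
  next
    case False
    obtain P where P: "F0 = pact hecke_T P (hecke_T F0)"
      using cyc[OF _ hecke_T_mem[OF V(1) F(1)] right_inv_hecke_T[OF F(2)] False F(1,2)] by auto
    \<comment> \<open>\<open>pCons (- 1) P\<close> is \<open>X P - 1\<close>, nonzero because of its
      constant term.\<close>
    have "pact hecke_T (pCons (- 1) P) F0 = (\<lambda>_. 0)"
      using fun_cong[OF P] by (simp add: pact_pCons[OF HL] pact_commute[OF HL])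
    then obtain c Q where "pact hecke_T Q F0 \<noteq> (\<lambda>_. 0)" "hecke_T (pact hecke_T Q F0) = (\<lambda>x. c * pact hecke_T Q F0 x)"
      using eigenvector_of_annihilator[OF HL _ _ F(3)] by (metis pCons_eq_0_iff neg_equal_0_iff_equal zero_neq_one)
    then show ?thesis using V_K[of Q] by blast
  qed
  then obtain c G where G: "G \<in> V" "right_inv K G" "G \<noteq> (\<lambda>_. 0)" "hecke_T G = (\<lambda>x. c * G x)" by blast
  have line: "\<exists>d. H = (\<lambda>x. d * G x)" if "H \<in> V" "right_inv K H" for H
    using cyc[OF _ G(1,2,3) that] pact_eigen[OF HL G(4)] by fastforce
  obtain d where d: "F0 = (\<lambda>x. d * G x)" using line[OF F(1,2)] by blast
  obtain e where e: "F = (\<lambda>x. e * G x)" using line[OF F'] by blast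
  have "d \<noteq> 0" using d F(3) by auto
  then have "F = (\<lambda>x. (e / d) * F0 x)" unfolding d e by auto
  then show ?thesis by blast
qed

end

section \<open>Spherical Whittaker functions\<close>

context padic_gl2
begin

section \<open>The spherical line in twists of the reducible principal series\<close>

lemma steinberg_central:
  assumes eta: "quasi_character nv \<eta>" and X: "X \<in> twist \<eta> (steinberg_series nv)" and a: "a \<noteq> 0"
  shows "rtrans (scal a) X = (\<lambda>x. \<eta> (a * a) * X x)"
proof (rule ext)
  fix g
  obtain f where f: "X = (\<lambda>g. \<eta> (gl2_det g) * f g)" "f \<in> steinberg_series nv" using X by (auto simp: twist_def)
  have "f (scal a * g) = f g" using f(2) a by (simp add: steinberg_series_def)
  moreover have "\<eta> (a * a * gl2_det g) = \<eta> (a * a) * \<eta> (gl2_det g)"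
    using eta a gl2_det_nz[of g] by (simp add: quasi_character_def)
  ultimately show "rtrans (scal a) X g = \<eta> (a * a) * X g"
    using a by (simp add: rtrans_def f(1) gl2_det_mult gl2_det_of flip: scal_commute)
qed

text \<open>By the Iwasawa decomposition a spherical vector is determined by its value at
  \<open>1\<close>. The factor \<open>\<kappa>\<close> does not depend on the vector, so any two are
  proportional.\<close>

lemma steinberg_spherical:
  assumes eta: "quasi_character nv \<eta>"
  shows "\<exists>\<kappa>. \<forall>X\<in>twist \<eta> (steinberg_series nv). right_inv K X \<longrightarrow> X = (\<lambda>g. \<kappa> g * X 1)"
proof -
  have "\<exists>c. \<forall>X\<in>twist \<eta> (steinberg_series nv). right_inv K X \<longrightarrow> X g = c * X 1" for g
  proof -
    obtain z a b k where g: "g = scal z * mir a b * k" "z \<noteq> 0" "a \<noteq> 0" "k \<in> K" by (rule iwasawa)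
    let ?b = "gl2_of (z * a) (z * b) 0 z"
    have gb: "g = ?b * k" using g by (simp add: gl2_of_mult)
    have "X g = (\<eta> (gl2_det ?b) * nv (z * a / z)) * X 1"
      if X: "X \<in> twist \<eta> (steinberg_series nv)" "right_inv K X" for X
    proof -
      obtain f where f: "X = (\<lambda>g. \<eta> (gl2_det g) * f g)" "f \<in> steinberg_series nv" using X(1) by (auto simp: twist_def)
      have "\<And>a b d g. a \<noteq> 0 \<Longrightarrow> d \<noteq> 0 \<Longrightarrow> f (gl2_of a b 0 d * g) = of_real (nv (a / d)) * f g"
        using f(2) unfolding steinberg_series_def by simp
      from this[of "z * a" z "z * b" 1] have "f (?b * 1) = of_real (nv (z * a / z)) * f 1"
        using g(2,3) by simp
      moreover have "\<eta> (gl2_det (1 :: 'k gl2)) = 1"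
        using eta by (simp add: mat_of_one quasi_character_def)
      moreover have "X g = X ?b" unfolding gb using right_invD[OF X(2) g(4)] by simp
      ultimately show ?thesis by (simp add: f(1))
    qed
    then show ?thesis by blast
  qed
  then obtain \<kappa> where "\<And>g. \<forall>X\<in>twist \<eta> (steinberg_series nv). right_inv K X \<longrightarrow> X g = \<kappa> g * X 1" by metis
  then show ?thesis by (intro exI[of _ \<kappa>]) (auto simp: fun_eq_iff)
qed

lemma spherical_line_steinberg:
  assumes V: "invariant_subspace V" and eta: "quasi_character nv \<eta>"
    and iso: "isomorphic_reps V (twist \<eta> (steinberg_series nv))"
  shows "a \<noteq> 0 \<Longrightarrow> \<exists>c. \<forall>F\<in>V. rtrans (scal a) F = (\<lambda>x. c * F x)"
    and "F0 \<in> V \<Longrightarrow> right_inv K F0 \<Longrightarrow> F0 \<noteq> (\<lambda>_. 0) \<Longrightarrow> F \<in> V \<Longrightarrow> right_inv K F \<Longrightarrow> \<exists>c. F = (\<lambda>x. c * F0 x)"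
proof -
  let ?V' = "twist \<eta> (steinberg_series nv)"
  obtain T where bij: "bij_betw T V ?V'"
    and sc: "\<And>c F. F \<in> V \<Longrightarrow> T (\<lambda>x. c * F x) = (\<lambda>x. c * T F x)"
    and eq: "\<And>g F. F \<in> V \<Longrightarrow> T (rtrans g F) = rtrans g (T F)"
    using iso unfolding isomorphic_reps_def by blast
  have inj: "T F = T G \<Longrightarrow> F \<in> V \<Longrightarrow> G \<in> V \<Longrightarrow> F = G" for F G
    using bij by (auto simp: bij_betw_def inj_on_def)
  have mem: "F \<in> V \<Longrightarrow> T F \<in> ?V'" for F using bij by (auto simp: bij_betw_def)
  note VD = invariant_subspaceD[OF V]
  show "\<exists>c. \<forall>F\<in>V. rtrans (scal a) F = (\<lambda>x. c * F x)" if a: "a \<noteq> 0" for a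
  proof (intro exI ballI)
    fix F assume F: "F \<in> V"
    have "T (rtrans (scal a) F) = T (\<lambda>x. \<eta> (a * a) * F x)"
      using steinberg_central[OF eta mem[OF F] a] by (simp add: eq[OF F] sc[OF F])
    then show "rtrans (scal a) F = (\<lambda>x. \<eta> (a * a) * F x)" by (rule inj) (auto intro: VD F)
  qed
  obtain \<kappa> where chi: "\<And>X. X \<in> ?V' \<Longrightarrow> right_inv K X \<Longrightarrow> X = (\<lambda>g. \<kappa> g * X 1)"
    using steinberg_spherical[OF eta] by blast
  have inv: "right_inv K (T F)" if "F \<in> V" "right_inv K F" for F
    using that eq[OF that(1)] by (simp add: right_inv_def) metis
  show "\<exists>c. F = (\<lambda>x. c * F0 x)"
    if F0: "F0 \<in> V" "right_inv K F0" "F0 \<noteq> (\<lambda>_. 0)" and F: "F \<in> V" "right_inv K F" for F0 F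
  proof -
    note c0 = chi[OF mem[OF F0(1)] inv[OF F0(1,2)]] and c1 = chi[OF mem[OF F(1)] inv[OF F]]
    have "T F0 1 \<noteq> 0"
    proof
      assume "T F0 1 = 0"
      then have "T F0 = (\<lambda>x. 0 * T F0 x)" using c0 by simp
      also have "\<dots> = T (\<lambda>x. 0 * F0 x)" using sc[OF F0(1), of 0] by simp
      finally have "F0 = (\<lambda>x. 0 * F0 x)" by (rule inj) (use F0 VD in auto)
      then show False using F0(3) by simp
    qed
    then have "T F = (\<lambda>x. (T F 1 / T F0 1) * T F0 x)" by (subst c1, subst (2) c0) auto
    also have "\<dots> = T (\<lambda>x. (T F 1 / T F0 1) * F0 x)"
      by (rule sc[OF F0(1), symmetric])
    finally have "F = (\<lambda>x. (T F 1 / T F0 1) * F0 x)" by (rule inj) (rule F VD(3) F0(1))+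
    then show ?thesis by blast
  qed
qed

text \<open>On the torus \<open>F\<close> satisfies a two-term recursion in the exponent of
  \<open>p\<close>, by the Hecke relation. It vanishes at negative exponents because of the
  conductor of the character, and at exponent \<open>0\<close> by assumption, so it vanishes
  everywhere; Iwasawa does the rest.\<close>

lemma whittaker_value_one:
  assumes psi: "conductor_one p nv \<psi>" and model: "\<And>b g. F (mir 1 b * g) = \<psi> b * F g"
    and F: "right_inv K F" and T: "hecke_T F = (\<lambda>x. l * F x)"
    and cen: "\<And>a. a \<noteq> 0 \<Longrightarrow> rtrans (scal a) F = (\<lambda>x. c a * F x)" and one: "F 1 = 0"
  shows "F = (\<lambda>_. 0)"
proof -
  let ?P = "of_nat p :: 'k"
  have cen': "F (scal a * g) = c a * F g" if "a \<noteq> 0" for a g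
    using fun_cong[OF cen[OF that], of g] scal_commute[OF that, of g] by (simp add: rtrans_def)
  have psi1: "\<psi> x = 1" if "nv x \<le> 1" for x using psi that by (simp add: conductor_one_def)
  obtain x where x: "nv x \<le> real p" "\<psi> x \<noteq> 1" using psi by (auto simp: conductor_one_def)
  \<comment> \<open>\<open>mir 1 (x / a)\<close> lies in \<open>K\<close> and can be inserted on the
    right. Moved across \<open>mir a 0\<close> it becomes \<open>mir 1 x\<close> and contributes
    \<open>\<psi> x\<close>, which differs from \<open>1\<close>.\<close>
  have neg: "F (mir a 0) = 0" if "nv a \<ge> real p" for a
  proof -
    have a: "a \<noteq> 0" using that p_gt_0 by auto
    have "nv (x / a) \<le> 1" using x that p_gt_0 by (simp add: nv_divide divide_le_eq_1)
    then have "mir 1 (x / a) \<in> K" by (simp add: mir_K_iff)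
    then have "F (mir a 0) = F (mir a 0 * mir 1 (x / a))" using right_invD[OF F] by simp
    also have "mir a 0 * mir 1 (x / a) = mir 1 x * mir a 0" using a by (simp add: mir_mult)
    finally show ?thesis using model x(2) by simp
  qed
  have rec: "l * F (dg m) = of_nat p * F (dg (Suc m)) + F (dg m * gl2_of 1 0 0 ?P)" for m
  proof -
    have "F (dg m * mir ?P (of_nat e)) = F (dg (Suc m))" for e
    proof -
      have "nv (?P ^ m * of_nat e) \<le> 1"
        by (auto intro!: nv_mult_le_1 simp: nv_power nv_of_nat_le power_le_one)
      then show ?thesis unfolding dg_T_reps(1) model using psi1 by simp
    qed
    then show ?thesis using fun_cong[OF T, of "dg m"] by (simp add: hecke_T_def)
  qed
  have nonneg: "F (dg m) = 0" for m
  proof (induction m rule: less_induct)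
    case (less m)
    show ?case
    proof (cases m)
      case 0
      then show ?thesis using one by simp
    next
      case (Suc j)
      have "F (dg j * gl2_of 1 0 0 ?P) = 0"
      proof (cases j)
        case 0
        have "dg j * gl2_of 1 0 0 ?P = scal ?P * mir (1 / ?P) 0" using 0 by (simp add: gl2_of_mult)
        moreover have "F (mir (1 / ?P) 0) = 0" by (rule neg) (simp add: nv_divide nv_p)
        ultimately show ?thesis using cen' by simp
      next
        case (Suc i)
        then show ?thesis using less.IH[of i] \<open>m = Suc j\<close> dg_T_reps(2)[of i] cen' by simp
      qed
      then show ?thesis using rec[of j] less.IH[of j] Suc by simp
    qed
  qed
  have diag: "F (mir a 0) = 0" if a: "a \<noteq> 0" for a
  proof (cases "nv a \<ge> real p")
    case False
    obtain n u where nu: "a = ?P powi n * u" "nv u = 1" using unit_decomp[OF a] by blast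
    have "nv a = real p powi (- n)" using nu by (simp add: nv_mult nv_powi nv_p p_inv_powi)
    have n: "n \<ge> 0"
    proof (rule ccontr)
      assume "\<not> n \<ge> 0"
      then have "real p powi 1 \<le> real p powi (- n)" using p_gt_1 by (intro power_int_increasing) auto
      then show False using False \<open>nv a = _\<close> by simp
    qed
    have "u \<noteq> 0" using nu by auto
    then have "mir a 0 = dg (nat n) * mir u 0" using n nu by (simp add: mir_mult power_int_def)
    moreover have "mir u 0 \<in> K" using nu \<open>u \<noteq> 0\<close> by (simp add: mir_K_iff)
    ultimately show ?thesis using right_invD[OF F] nonneg by simp
  qed (rule neg)
  show ?thesis
  proof
    fix g
    obtain z a b k where g: "g = scal z * mir a b * k" "z \<noteq> 0" "a \<noteq> 0" "k \<in> K" by (rule iwasawa)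
    have "mir a b = mir 1 b * mir a 0" using g by (simp add: mir_mult)
    then have "F (mir a b) = 0" using model diag[OF g(3)] by simp
    then show "F g = 0" unfolding g(1) using right_invD[OF F g(4)] cen'[OF g(2)] by simp
  qed
qed

end

section \<open>Existence and uniqueness behind \<open>W_sph\<close>, \<open>central_char\<close> and
  the Hecke eigenvalue\<close>

locale spherical = padic_gl2 +
  fixes \<psi> :: "'a \<Rightarrow> complex" and V :: "('a gl2 \<Rightarrow> complex) set"
  assumes psi: "conductor_one p nv \<psi>" and type: "whittaker_type nv \<psi> V"
    and unram: "unramified_rep nv V" and model: "in_whittaker_model \<psi> V"
begin

abbreviation "W \<equiv> W_sph nv V"
abbreviation "\<omega> \<equiv> central_char V"
abbreviation "\<tau> \<equiv> hecke_eigenvalue K W (T_p p nv)"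

lemma inv_V: "invariant_subspace V"
  using type by (simp add: whittaker_type_def smooth_rep_def)

lemma central_exists:
  assumes "a \<noteq> 0"
  shows "\<exists>c. \<forall>F\<in>V. rtrans (scal a) F = (\<lambda>x. c * F x)"
proof -
  obtain F0 where F0: "F0 \<in> V" "F0 \<noteq> (\<lambda>_. 0)" "right_inv K F0"
    using unram by (auto simp: unramified_rep_def right_inv_def)
  from type show ?thesis unfolding whittaker_type_def
    using central_irreducible[OF inv_V _ F0(1,3,2) assms] spherical_line_steinberg(1)[OF inv_V _ _ assms] by blast
qed

lemma spherical_line:
  assumes "F0 \<in> V" "right_inv K F0" "F0 \<noteq> (\<lambda>_. 0)" "F \<in> V" "right_inv K F"
  shows "\<exists>c. F = (\<lambda>x. c * F0 x)"
  using type unfolding whittaker_type_def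
  using spherical_line_irreducible[OF inv_V _ assms] spherical_line_steinberg(2)[OF inv_V _ _ assms] by blast

text \<open>A generator of the spherical line is a Hecke eigenvector, so its value at
  \<open>1\<close> cannot vanish and may be normalised to \<open>1\<close>.\<close>

lemma W_exists: "\<exists>!W. W \<in> V \<and> right_inv K W \<and> W 1 = 1"
proof -
  obtain F0 where F0: "F0 \<in> V" "right_inv K F0" "F0 \<noteq> (\<lambda>_. 0)"
    using unram by (auto simp: unramified_rep_def right_inv_def)
  obtain l where l: "hecke_T F0 = (\<lambda>x. l * F0 x)"
    using spherical_line[OF F0 hecke_T_mem[OF inv_V F0(1)] right_inv_hecke_T[OF F0(2)]] by blast
  obtain c where c: "\<And>a. a \<noteq> 0 \<Longrightarrow> rtrans (scal a) F0 = (\<lambda>x. c a * F0 x)" using central_exists F0(1) by metis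
  have nz: "F0 1 \<noteq> 0"
    using whittaker_value_one[OF psi _ F0(2) l c] F0(3) model F0(1) unfolding in_whittaker_model_def by blast
  let ?W = "\<lambda>x. (1 / F0 1) * F0 x"
  have W: "?W \<in> V" "right_inv K ?W" "?W 1 = 1"
    using nz invariant_subspaceD(3)[OF inv_V F0(1), of "1 / F0 1"] F0(2) by (auto simp: right_inv_def rtrans_def fun_eq_iff)
  show ?thesis
  proof (rule ex1I[of _ ?W])
    fix W' assume W': "W' \<in> V \<and> right_inv K W' \<and> W' 1 = 1"
    then obtain d where d: "W' = (\<lambda>x. d * F0 x)" using spherical_line[OF F0] by blast
    then have "d = 1 / F0 1" using W' nz by (simp add: field_simps)
    then show "W' = ?W" using d by simp
  qed (use W in simp)
qed

lemma W: "W \<in> V" "right_inv K W" "W 1 = 1"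
proof -
  have "W = (THE W. W \<in> V \<and> right_inv K W \<and> W 1 = 1)" by (simp add: W_sph_def right_inv_def)
  then show "W \<in> V" "right_inv K W" "W 1 = 1" using theI'[OF W_exists] by simp_all
qed

lemma W_nz: "W \<noteq> (\<lambda>_. 0)"
  using W(3) by auto

lemma hecke_T_W: "hecke_T W = (\<lambda>x. \<tau> * W x)"
proof -
  obtain l where l: "hecke_T W = (\<lambda>x. l * W x)"
    using spherical_line[OF W(1,2) W_nz hecke_T_mem[OF inv_V W(1)] right_inv_hecke_T[OF W(2)]] by blast
  have "\<tau> = l" unfolding hecke_eigenvalue_def hecke_act_T[OF W(2)] l
  proof (rule the_equality)
    fix c assume "(\<lambda>x. l * W x) = (\<lambda>x. c * W x)"
    from fun_cong[OF this, of 1] show "c = l" using W(3) by simp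
  qed simp
  then show ?thesis using l by simp
qed

lemma central_W:
  assumes "a \<noteq> 0" "F \<in> V"
  shows "rtrans (scal a) F = (\<lambda>x. \<omega> a * F x)"
proof -
  have "\<exists>!c. \<forall>F\<in>V. rtrans (scal a) F = (\<lambda>x. c * F x)"
  proof (rule ex_ex1I[OF central_exists[OF assms(1)]])
    fix c d
    assume c: "\<forall>F\<in>V. rtrans (scal a) F = (\<lambda>x. c * F x)" and d: "\<forall>F\<in>V. rtrans (scal a) F = (\<lambda>x. d * F x)"
    have "c * W 1 = d * W 1" 
      by (rule trans[OF fun_cong[OF bspec[OF c W(1)], of 1, symmetric] fun_cong[OF bspec[OF d W(1)], of 1]])
    then show "c = d" using W(3) by simp
  qed
  from theI'[OF this] show ?thesis using assms by (simp add: central_char_def)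
qed

lemma W_scal: "a \<noteq> 0 \<Longrightarrow> W (g * scal a) = \<omega> a * W g" "a \<noteq> 0 \<Longrightarrow> W (scal a * g) = \<omega> a * W g"
  using fun_cong[OF central_W[OF _ W(1)], of a g] scal_commute[of a g] by (simp_all add: rtrans_def)

lemma omega_mult: "a \<noteq> 0 \<Longrightarrow> b \<noteq> 0 \<Longrightarrow> \<omega> (a * b) = \<omega> a * \<omega> b"
  using W_scal(2)[of a "scal b"] W_scal(2)[of b 1] W_scal(2)[of "a * b" 1] W(3) by (simp add: scal_mult)

lemma omega_unit: "nv u = 1 \<Longrightarrow> \<omega> u = 1"
  using right_invD[OF W(2) scal_K[of u], of 1] W_scal(2)[of u 1] W(3) nv_eq_0[of u] by fastforce

end

section \<open>Topology of the groups\<close>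

context padic_gl2
begin

sublocale nvm: Metric_space "UNIV :: 'k set" "\<lambda>x y. nv (x - y)"
proof
  fix x y z
  show "nv (x - z) \<le> nv (x - y) + nv (y - z)"
    using order_trans[OF nv_add[of "x - y" "y - z"], of "nv (x - y) + nv (y - z)"] by simp
qed (auto simp: nv_diff_commute)

abbreviation ktop where "ktop \<equiv> product_topology (\<lambda>_ :: 2 \<times> 2. padic_topology nv) UNIV"

definition ent :: "'k gl2 \<Rightarrow> 2 \<times> 2 \<Rightarrow> 'k" where
  "ent g = (\<lambda>(i, j). mat_of g $ i $ j)"

lemma gl2_topology_ent: "gl2_topology nv = pullback_topology UNIV ent ktop"
  by (simp add: gl2_topology_def ent_def[abs_def])

lemma topspace_padic [simp]: "topspace (padic_topology nv) = UNIV"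
  by (simp add: padic_topology_def)

lemma topspace_ktop [simp]: "topspace ktop = UNIV"
  by simp

lemma openin_ktopI:
  assumes "\<And>e. e \<in> C \<Longrightarrow> \<exists>\<epsilon>>0. \<forall>e'. (\<forall>i. nv (e' i - e i) < \<epsilon>) \<longrightarrow> e' \<in> C"
  shows "openin ktop C"
proof (subst openin_subopen, intro ballI)
  fix e assume "e \<in> C"
  then obtain \<epsilon> where eps: "\<epsilon> > 0" "\<And>e'. (\<And>i. nv (e' i - e i) < \<epsilon>) \<Longrightarrow> e' \<in> C" using assms by blast
  let ?B = "PiE UNIV (\<lambda>i. nvm.mball (e i) \<epsilon>)"
  have "openin ktop ?B" by (subst openin_PiE) (auto simp: padic_topology_def)
  moreover have "e \<in> ?B" using eps by auto
  moreover have "?B \<subseteq> C" using eps(2) by (auto simp: PiE_iff nv_diff_commute)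
  ultimately show "\<exists>T. openin ktop T \<and> e \<in> T \<and> T \<subseteq> C" by blast
qed

text \<open>An entrywise criterion for openness, so that the pullback of a product topology need be
  handled only once.\<close>

definition eopen :: "'k gl2 set \<Rightarrow> bool" where
  "eopen A \<longleftrightarrow> (\<forall>g\<in>A. \<exists>\<epsilon>>0. \<forall>h. mbound (mat_of h - mat_of g) \<epsilon> \<longrightarrow> h \<in> A)"

text \<open>The topology is pulled back from all tuples of entries, invertible or not, so an open
  set \<open>C\<close> of tuples with preimage \<open>A\<close> has to be exhibited. A union of
  balls around points of \<open>A\<close> works: by the ultrametric inequality its members stay in
  the same ball under small changes.\<close>

lemma eopen_openin:
  assumes "eopen A"
  shows "openin (gl2_topology nv) A"
proof -
  define C where "C = {e. \<exists>g\<in>A. \<exists>\<epsilon>>0. (\<forall>i. nv (e i - ent g i) < \<epsilon>) \<and> (\<forall>h. mbound (mat_of h - mat_of g) \<epsilon> \<longrightarrow> h \<in> A)}"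
  have "openin ktop C"
  proof (rule openin_ktopI)
    fix e assume "e \<in> C"
    then obtain g \<epsilon> where g: "g \<in> A" "\<epsilon> > 0" "\<And>i. nv (e i - ent g i) < \<epsilon>" "\<And>h. mbound (mat_of h - mat_of g) \<epsilon> \<Longrightarrow> h \<in> A"
      unfolding C_def by blast
    have "e' \<in> C" if e': "\<And>i. nv (e' i - e i) < \<epsilon>" for e'
    proof -
      have "nv (e' i - ent g i) < \<epsilon>" for i using nv_add_less[OF e' g(3), of i i] by simp
      then show ?thesis using g unfolding C_def by blast
    qed
    then show "\<exists>\<epsilon>>0. \<forall>e'. (\<forall>i. nv (e' i - e i) < \<epsilon>) \<longrightarrow> e' \<in> C" using g(2) by blast
  qed
  moreover have "A = ent -` C \<inter> UNIV"
  proof (intro equalityI subsetI)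
    fix g assume g: "g \<in> A"
    then obtain \<epsilon> where eps: "\<epsilon> > 0" "\<forall>h. mbound (mat_of h - mat_of g) \<epsilon> \<longrightarrow> h \<in> A"
      using assms unfolding eopen_def by blast
    have "\<forall>i. nv (ent g i - ent g i) < \<epsilon>" using eps(1) by simp
    then have "ent g \<in> C" using g eps unfolding C_def by blast
    then show "g \<in> ent -` C \<inter> UNIV" by simp
  next
    fix h assume "h \<in> ent -` C \<inter> UNIV"
    then obtain g \<epsilon> where g: "\<And>i. nv (ent h i - ent g i) < \<epsilon>" "\<And>h. mbound (mat_of h - mat_of g) \<epsilon> \<Longrightarrow> h \<in> A"
      unfolding C_def by auto
    have "nv ((mat_of h - mat_of g) $ i $ j) \<le> \<epsilon>" for i j using g(1)[of "(i, j)"] by (simp add: ent_def)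
    then show "h \<in> A" using g(2) by (simp add: mbound_def)
  qed
  ultimately show ?thesis unfolding gl2_topology_ent openin_pullback_topology by blast
qed

lemma eopen_lcoset:
  assumes "eopen A"
  shows "eopen (lcoset x A)"
  unfolding eopen_def
proof
  fix g assume "g \<in> lcoset x A"
  then obtain a where a: "g = x * a" "a \<in> A" by (auto simp: lcoset_def)
  obtain \<epsilon> where eps: "\<epsilon> > 0" "\<And>h. mbound (mat_of h - mat_of a) \<epsilon> \<Longrightarrow> h \<in> A"
    using assms a(2) unfolding eopen_def by blast
  obtain r where r: "r > 0" "mbound (mat_of (inverse x)) r" using mbound_exists by blast
  have "h \<in> lcoset x A" if h: "mbound (mat_of h - mat_of g) (\<epsilon> / r)" for h
  proof -
    have "mat_of (inverse x * h) - mat_of a = mat_of (inverse x) ** (mat_of h - mat_of g)"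
      using mat_of_inverse_mult[of x] by (simp add: a(1) mat_of_mult matrix_diff_ldistrib matrix_mul_assoc)
    then have "mbound (mat_of (inverse x * h) - mat_of a) (r * (\<epsilon> / r))" using mbound_mult[OF r(2) h] by simp
    then have "inverse x * h \<in> A" using eps(2) r(1) by simp
    then show ?thesis unfolding lcoset_def by (intro image_eqI[of _ _ "inverse x * h"]) auto
  qed
  then show "\<exists>\<epsilon>>0. \<forall>h. mbound (mat_of h - mat_of g) \<epsilon> \<longrightarrow> h \<in> lcoset x A" using eps(1) r(1) by (meson divide_pos_pos)
qed

lemma compact_gl2I:
  assumes "compactin ktop (ent ` S)"
  shows "compactin (gl2_topology nv) S"
  unfolding compactin_def
proof (intro conjI allI impI)
  show "S \<subseteq> topspace (gl2_topology nv)" by (auto simp: gl2_topology_ent topspace_pullback_topology)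
  fix \<U> assume U: "(\<forall>U\<in>\<U>. openin (gl2_topology nv) U) \<and> S \<subseteq> \<Union>\<U>"
  then have "\<forall>U\<in>\<U>. \<exists>T. openin ktop T \<and> U = ent -` T"
    by (simp add: gl2_topology_ent openin_pullback_topology)
  then obtain T where T: "\<And>U. U \<in> \<U> \<Longrightarrow> openin ktop (T U)" "\<And>U. U \<in> \<U> \<Longrightarrow> U = ent -` T U" by metis
  have "ent ` S \<subseteq> \<Union>(T ` \<U>)" using U T(2) by blast
  moreover have "\<forall>U\<in>T ` \<U>. openin ktop U" using T(1) by blast
  ultimately obtain \<F> where F: "finite \<F>" "\<F> \<subseteq> T ` \<U>" "ent ` S \<subseteq> \<Union>\<F>"
    using assms unfolding compactin_def by meson
  then obtain \<G> where G: "\<G> \<subseteq> \<U>" "finite \<G>" "\<F> = T ` \<G>" by (meson finite_subset_image)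
  then have "S \<subseteq> \<Union>\<G>" using F(3) T(2) by blast
  then show "\<exists>\<F>. finite \<F> \<and> \<F> \<subseteq> \<U> \<and> S \<subseteq> \<Union>\<F>" using G by blast
qed

text \<open>The fractions \<open>c / p^k\<close> with \<open>c < p^n\<close> form a finite net, so
  the ball is totally bounded; it is closed in a complete space.\<close>

lemma compact_ball: "compactin (padic_topology nv) {x. nv x \<le> real p ^ k}"
proof -
  let ?S = "{x. nv x \<le> real p ^ k}" and ?P = "of_nat p ^ k :: 'k"
  have P: "nv ?P = 1 / real p ^ k" "?P \<noteq> 0" by (auto simp: nv_power nv_p power_one_over)
  have ball: "?S = nvm.mcball 0 (real p ^ k)" by (auto simp: nvm.mcball_def)
  have "nvm.mtotally_bounded ?S"
    unfolding nvm.mtotally_bounded_def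
  proof (intro allI impI)
    fix \<epsilon> :: real assume "\<epsilon> > 0"
    then obtain n where n: "(1 / real p) ^ n < \<epsilon> / real p ^ k" using nv_small p_gt_0 by (meson divide_pos_pos of_nat_0_less_iff zero_less_power)
    let ?C = "(\<lambda>c. of_nat c / ?P) ` {..<p ^ n}"
    have "?C \<subseteq> ?S"
      using P mult_right_mono[OF nv_of_nat_le, of "real p ^ k"] by (auto simp: nv_divide)
    moreover have "?S \<subseteq> (\<Union>x\<in>?C. nvm.mball x \<epsilon>)"
    proof
      fix x assume "x \<in> ?S"
      then have "nv (x * ?P) \<le> 1" unfolding nv_mult P(1) using p_gt_0 by (simp add: field_simps)
      then obtain c where c: "c < p ^ n" "nv (x * ?P - of_nat c) \<le> (1 / real p) ^ n" using residue_power by blast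
      have "nv (of_nat c / ?P - x) = nv (x * ?P - of_nat c) * real p ^ k"
      proof -
        have "of_nat c / ?P - x = - (x * ?P - of_nat c) / ?P" using P by (simp add: field_simps)
        then show ?thesis using P by (simp only: nv_divide nv_minus) simp
      qed
      also have "\<dots> \<le> (1 / real p) ^ n * real p ^ k" using c by (intro mult_right_mono) auto
      also have "\<dots> < \<epsilon>" using n p_gt_0 by (simp add: pos_less_divide_eq)
      finally show "x \<in> (\<Union>x\<in>?C. nvm.mball x \<epsilon>)" using c by auto
    qed
    ultimately show "\<exists>C. finite C \<and> C \<subseteq> ?S \<and> ?S \<subseteq> (\<Union>x\<in>C. nvm.mball x \<epsilon>)" by (intro exI[of _ ?C]) auto
  qed
  moreover have "nvm.mcomplete" using padic unfolding padic_field_def by blast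
  ultimately have "compactin nvm.mtopology (nvm.mtopology closure_of ?S)"
    using nvm.mtotally_bounded_eq_compact_closure_of by blast
  moreover have "nvm.mtopology closure_of ?S = ?S"
    unfolding ball by (rule closure_of_closedin) simp
  ultimately show ?thesis by (simp add: padic_topology_def)
qed

text \<open>Since \<open>c > 0\<close>, the determinant condition keeps tuples invertible, so the
  image under \<open>ent\<close> is cut out by conditions on entries alone: a closed subset of a
  product of compact balls.\<close>

lemma compact_gl2_ball:
  assumes "c > 0"
  shows "compactin (gl2_topology nv) (gl2_ball r c)"
proof (rule compact_gl2I)
  obtain k where k: "r \<le> real p ^ k" using real_arch_pow[of "real p" r] p_gt_1 by (auto intro: less_imp_le)
  let ?d = "\<lambda>e :: 2 \<times> 2 \<Rightarrow> 'k. e (1, 1) * e (2, 2) - e (1, 2) * e (2, 1)"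
  have eq: "ent ` gl2_ball r c = {e. (\<forall>i. nv (e i) \<le> r) \<and> nv (?d e) = c}" (is "_ = ?C")
  proof (intro equalityI subsetI)
    fix e assume "e \<in> ?C"
    then have e: "\<And>i. nv (e i) \<le> r" "nv (?d e) = c" by auto
    then have nz: "?d e \<noteq> 0" using assms by auto
    let ?g = "gl2_of (e (1, 1)) (e (1, 2)) (e (2, 1)) (e (2, 2))"
    have "?g \<in> gl2_ball r c" using e by (subst gl2_ball_iff[OF nz]) auto
    moreover have "ent ?g = e"
    proof
      fix ij :: "2 \<times> 2"
      show "ent ?g ij = e ij"
        using exhaust_2[of "fst ij"] exhaust_2[of "snd ij"] gl2_of_nth[OF nz] by (cases ij) (auto simp: ent_def)
    qed
    ultimately show "e \<in> ent ` gl2_ball r c" by force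
  qed (auto simp: ent_def gl2_ball_def det_2)
  have "compactin ktop (PiE UNIV (\<lambda>_. {x. nv x \<le> real p ^ k}))"
    using compact_ball by (simp add: compactin_PiE)
  moreover have "?C \<subseteq> PiE UNIV (\<lambda>_. {x. nv x \<le> real p ^ k})" using k by (auto intro: order_trans)
  moreover have "closedin ktop ?C"
  proof -
    have "openin ktop (- ?C)"
    proof (rule openin_ktopI)
      fix e assume e: "e \<in> - ?C"
      show "\<exists>\<epsilon>>0. \<forall>e'. (\<forall>i. nv (e' i - e i) < \<epsilon>) \<longrightarrow> e' \<in> - ?C"
      proof (cases "\<forall>i. nv (e i) \<le> r")
        case False
        then obtain i where i: "nv (e i) > r" by (auto simp: not_le)
        show ?thesis
        proof (cases "r < 0")
          case True
          then have "\<not> nv (e' (1, 1)) \<le> r" for e' :: "2 \<times> 2 \<Rightarrow> 'k" using nv_nonneg[of "e' (1, 1)"] by linarith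
          then have "e' \<in> - ?C" for e' :: "2 \<times> 2 \<Rightarrow> 'k" by blast
          then show ?thesis by (intro exI[of _ 1]) auto
        next
          case False
          have "e' \<in> - ?C" if "nv (e' i - e i) < nv (e i)" for e' :: "2 \<times> 2 \<Rightarrow> 'k"
          proof -
            have "\<not> nv (e' i) \<le> r" using nv_add_eq[OF that] i by simp
            then show ?thesis by blast
          qed
          then show ?thesis using nv_pos[of "e i"] i False by (intro exI[of _ "nv (e i)"]) (meson nv_nonneg le_less_trans not_le)
        qed
      next
        case True
        then have d: "nv (?d e) \<noteq> c" using e by auto
        define s where "s = max r 1"
        \<comment> \<open>The first bound keeps the new entries within \<open>s\<close>; the second
          makes the determinant move by less than \<open>c\<close>, so that it could only reach
          absolute value \<open>c\<close> if it had it before.\<close>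
        define \<epsilon> where "\<epsilon> = min s (c / (2 * s))"
        have s: "s > 0" "\<epsilon> > 0" "s * \<epsilon> < c" "\<epsilon> \<le> s" "r \<le> s"
        proof -
          show "s > 0" by (simp add: s_def)
          then show "\<epsilon> > 0" using assms by (simp add: \<epsilon>_def)
          have "s * \<epsilon> \<le> s * (c / (2 * s))" using \<open>s > 0\<close> by (intro mult_left_mono) (auto simp: \<epsilon>_def)
          also have "\<dots> < c" using \<open>s > 0\<close> assms by simp
          finally show "s * \<epsilon> < c" .
        qed (auto simp: \<epsilon>_def s_def)
        have "e' \<in> - ?C" if e': "\<And>i. nv (e' i - e i) < \<epsilon>" for e'
        proof -
          have le: "nv (e i) \<le> s" "nv (e' i) \<le> s" for i
          proof -
            show "nv (e i) \<le> s" using True s(5) order_trans by blast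
            then show "nv (e' i) \<le> s"
              using nv_add_le[of "e' i - e i" s "e i"] less_imp_le[OF e'[of i]] s(4) by simp
          qed
          have prod: "nv (e' i * e' j - e i * e j) \<le> s * \<epsilon>" for i j
          proof -
            have "e' i * e' j - e i * e j = e' i * (e' j - e j) + e j * (e' i - e i)" by (simp add: algebra_simps)
            moreover have "nv (e' i * (e' j - e j)) \<le> s * \<epsilon>" "nv (e j * (e' i - e i)) \<le> s * \<epsilon>"
              unfolding nv_mult
              by (rule mult_mono[OF le(2) less_imp_le[OF e'[of j]]], use s in simp_all)
                (rule mult_mono[OF le(1) less_imp_le[OF e'[of i]]], use s in simp_all)
            ultimately show ?thesis by (metis nv_add_le)
          qed
          have "?d e' - ?d e = (e' (1,1) * e' (2,2) - e (1,1) * e (2,2)) - (e' (1,2) * e' (2,1) - e (1,2) * e (2,1))" by simp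
          then have "nv (?d e' - ?d e) \<le> s * \<epsilon>" using nv_diff_le[OF prod prod] by metis
          then have "nv (?d e - ?d e') < c" using s(3) by (simp add: nv_diff_commute)
          then have "nv (?d e') \<noteq> c" using d nv_add_eq[of "?d e - ?d e'" "?d e'"] by auto
          then show ?thesis by auto
        qed
        then show ?thesis using s(2) by blast
      qed
    qed
    then show ?thesis by (simp add: closedin_def Compl_eq_Diff_UNIV)
  qed
  ultimately show "compactin ktop (ent ` gl2_ball r c)" unfolding eq by (rule closed_compactin)
qed

section \<open>Hecke eigenvalues in the coefficient ring\<close>

lemma K_ball: "K = gl2_ball 1 1"
  by (simp add: gl2_int_def gl2_ball_def)

definition bi_inv :: "'k gl2 set \<Rightarrow> bool" where
  "bi_inv A \<longleftrightarrow> (\<forall>g\<in>A. \<forall>k\<in>K. k * g \<in> A \<and> g * k \<in> A)"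

lemma bi_inv_iff: "bi_inv A \<Longrightarrow> k \<in> K \<Longrightarrow> k' \<in> K \<Longrightarrow> k * g * k' \<in> A \<longleftrightarrow> g \<in> A"
proof -
  assume A: "bi_inv A" and k: "k \<in> K" "k' \<in> K"
  have "g = inverse k * (k * g * k') * inverse k'" by (simp add: mult.assoc)
  then show ?thesis using A k K_inverse unfolding bi_inv_def by metis
qed

lemma hecke_indicator_mem:
  assumes R: "subalgebra_Z_inv p R" and A: "bi_inv A" "A \<subseteq> gl2_ball r c" "c > 0"
    and B: "bi_inv B" "B \<subseteq> gl2_ball s d" "d > 0"
  shows "indicator (A \<times> B) \<in> hecke_algebra_G nv R"
  unfolding hecke_algebra_G_def
proof (intro CollectI conjI ballI allI exI)
  have "1 \<in> R" "1 - 1 \<in> R" using R unfolding subalgebra_Z_inv_def by blast+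
  then show "range (indicator (A \<times> B) :: _ \<Rightarrow> complex) \<subseteq> R" by (auto simp: indicator_def)
  show "indicator (A \<times> B) (k * g * k') = (indicator (A \<times> B) g :: complex)"
    if "k \<in> G_int nv" "k' \<in> G_int nv" for k k' g
    using that bi_inv_iff[OF A(1)] bi_inv_iff[OF B(1)]
    by (cases g, cases k, cases k') (auto simp: G_int_def times_prod_def indicator_def)
  show "compactin (prod_topology (gl2_topology nv) (gl2_topology nv)) (gl2_ball r c \<times> gl2_ball s d)"
    using compact_gl2_ball A(3) B(3) by (simp add: compactin_Times)
  show "{g. indicator (A \<times> B) g \<noteq> (0::complex)} \<subseteq> gl2_ball r c \<times> gl2_ball s d"
    using A(2) B(2) by (auto simp: indicator_def)
qed

lemma bi_inv_K: "bi_inv K" by (auto simp: bi_inv_def intro: K_mult)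
lemma bi_inv_T: "bi_inv T_set" by (auto simp: bi_inv_def intro: T_set_left T_set_right)

lemma bi_inv_scal: "a \<noteq> 0 \<Longrightarrow> bi_inv (lcoset (scal a) K)"
  unfolding bi_inv_def
proof (intro ballI conjI)
  fix g k assume a: "a \<noteq> 0" and g: "g \<in> lcoset (scal a) K" and k: "k \<in> K"
  then obtain h where h: "h \<in> K" "g = scal a * h" unfolding lcoset_def by blast
  have "k * g = scal a * (k * h)" unfolding h(2) using scal_commute[OF a, of k] by (metis mult.assoc)
  then show "k * g \<in> lcoset (scal a) K" unfolding lcoset_def using h k K_mult by blast
  have "g * k = scal a * (h * k)" unfolding h(2) by (simp add: mult.assoc)
  then show "g * k \<in> lcoset (scal a) K" unfolding lcoset_def using h k K_mult by blast
qed

lemma scal_K_ball: "a \<noteq> 0 \<Longrightarrow> lcoset (scal a) K \<subseteq> gl2_ball (nv a) (nv a * nv a)"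
proof -
  assume a: "a \<noteq> 0"
  then have "scal a \<in> gl2_ball (nv a) (nv a * nv a)" by (subst gl2_ball_iff) (auto simp: nv_mult)
  then show ?thesis by (auto simp: lcoset_def intro: gl2_ball_K)
qed

lemma coset_reps_K: "coset_reps K K {1}"
  using coset_reps_scal[of 1] lcoset_K[OF K_one] by simp

text \<open>On indicators of product sets the two variables separate, which gives access to the
  eigenvalue of each factor on its own.\<close>

lemma Theta_value:
  assumes W1: "right_inv K (W_sph nv V1)" "W_sph nv V1 1 = 1" and W2: "right_inv K (W_sph nv V2)" "W_sph nv V2 1 = 1"
    and A: "coset_reps K A S" "\<And>x. (\<Sum>r\<in>S. W_sph nv V1 (x * r)) = c1 * W_sph nv V1 x"
    and B: "coset_reps K B S'" "\<And>x. (\<Sum>r\<in>S'. W_sph nv V2 (x * r)) = c2 * W_sph nv V2 x"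
  shows "Theta nv V1 V2 (indicator (A \<times> B)) = c1 * c2"
proof -
  let ?v = "v_sph nv V1 V2"
  have v: "?v (x, y) = W_sph nv V1 x * W_sph nv V2 y" for x y by (simp add: v_sph_def tensor_fun_def)
  have sum: "hecke_act (K \<times> K) (indicator (A \<times> B)) ?v x = (\<Sum>r\<in>S \<times> S'. ?v (x * r))" for x
  proof (rule hecke_act_reps[OF _ _ coset_reps_prod[OF A(1) B(1)]])
    show "1 \<in> K \<times> K" using K_one by (simp add: one_prod_def)
    show "lcoset h (K \<times> K) = K \<times> K" if "h \<in> K \<times> K" for h
      using that lcoset_K by (cases h) (auto simp: lcoset_prod)
    show "right_inv (K \<times> K) ?v"
    proof (rule right_invI)
      fix x h :: "'k gl2 \<times> 'k gl2" assume "h \<in> K \<times> K"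
      then show "?v (x * h) = ?v x"
        using right_invD[OF W1(1)] right_invD[OF W2(1)] by (cases x, cases h) (auto simp: times_prod_def v)
    qed
  qed
  have act: "hecke_act (K \<times> K) (indicator (A \<times> B)) ?v = (\<lambda>x. (c1 * c2) * ?v x)"
  proof
    fix x :: "'k gl2 \<times> 'k gl2"
    obtain x1 x2 where x: "x = (x1, x2)" by (cases x)
    have "(\<Sum>r\<in>S \<times> S'. ?v (x * r)) = (\<Sum>r\<in>S. \<Sum>r'\<in>S'. W_sph nv V1 (x1 * r) * W_sph nv V2 (x2 * r'))"
      unfolding x sum.cartesian_product by (intro sum.cong) (auto simp: times_prod_def v)
    also have "\<dots> = (c1 * W_sph nv V1 x1) * (c2 * W_sph nv V2 x2)"
      unfolding A(2)[symmetric] B(2)[symmetric] by (simp add: sum_product)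
    finally show "hecke_act (K \<times> K) (indicator (A \<times> B)) ?v x = (c1 * c2) * ?v x" unfolding sum by (simp add: x v)
  qed
  show ?thesis unfolding Theta_def hecke_eigenvalue_def G_int_def act
  proof (rule the_equality)
    fix c assume "(\<lambda>x. (c1 * c2) * ?v x) = (\<lambda>x. c * ?v x)"
    from fun_cong[OF this, of "(1, 1)"] show "c = c1 * c2" using W1(2) W2(2) by (simp add: v)
  qed simp
qed

end

section \<open>Integrality of the Hecke eigenvalues and of the central characters\<close>

locale rs_pair = padic_gl2 p nv + S1: spherical p nv \<psi>1 V1 + S2: spherical p nv \<psi>2 V2
  for p :: nat and nv :: "'k::field_char_0 \<Rightarrow> real" and \<psi>1 \<psi>2 V1 V2 +
  fixes R :: "complex set"
  assumes R: "subalgebra_Z_inv p R" and Theta_R: "\<forall>\<phi>\<in>hecke_algebra_G nv R. Theta nv V1 V2 \<phi> \<in> R"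
begin

lemma T_W1: "(\<Sum>r\<in>T_reps. S1.W (x * r)) = S1.\<tau> * S1.W x"
  using fun_cong[OF S1.hecke_T_W, of x] by (simp add: sum_T_reps hecke_T_def)

lemma T_W2: "(\<Sum>r\<in>T_reps. S2.W (x * r)) = S2.\<tau> * S2.W x"
  using fun_cong[OF S2.hecke_T_W, of x] by (simp add: sum_T_reps hecke_T_def)

text \<open>The test function is \<open>T_set\<close> in one variable and \<open>K\<close> in the
  other, where the eigenvalue is \<open>1\<close>.\<close>

lemma tau_R: "S1.\<tau> \<in> R" "S2.\<tau> \<in> R"
proof -
  note Th = Theta_value[OF S1.W(2,3) S2.W(2,3)]
  have T: "1 / real p > 0" using p_gt_0 by simp
  have "Theta nv V1 V2 (indicator (T_set \<times> K)) = S1.\<tau> * 1"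
    by (rule Th[OF T_coset_reps T_W1 coset_reps_K]) simp
  then show "S1.\<tau> \<in> R"
    using Theta_R hecke_indicator_mem[OF R bi_inv_T T_set_ball T bi_inv_K, of 1 1] K_ball by auto
  have "Theta nv V1 V2 (indicator (K \<times> T_set)) = 1 * S2.\<tau>"
    by (rule Th[OF coset_reps_K _ T_coset_reps T_W2]) simp
  then show "S2.\<tau> \<in> R"
    using Theta_R hecke_indicator_mem[OF R bi_inv_K _ _ bi_inv_T T_set_ball T, of 1 1] K_ball by auto
qed

lemma omega_R:
  assumes a: "a \<noteq> 0"
  shows "S1.\<omega> a \<in> R" "S2.\<omega> a \<in> R"
proof -
  note Th = Theta_value[OF S1.W(2,3) S2.W(2,3)]
  have pos: "nv a * nv a > 0" using nv_pos[OF a] by simp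
  have "Theta nv V1 V2 (indicator (lcoset (scal a) K \<times> K)) = S1.\<omega> a * 1"
    by (rule Th[OF coset_reps_scal _ coset_reps_K]) (simp_all add: S1.W_scal a)
  then show "S1.\<omega> a \<in> R"
    using Theta_R hecke_indicator_mem[OF R bi_inv_scal[OF a] scal_K_ball[OF a] pos bi_inv_K, of 1 1] K_ball by auto
  have "Theta nv V1 V2 (indicator (K \<times> lcoset (scal a) K)) = 1 * S2.\<omega> a"
    by (rule Th[OF coset_reps_K _ coset_reps_scal]) (simp_all add: S2.W_scal a)
  then show "S2.\<omega> a \<in> R"
    using Theta_R hecke_indicator_mem[OF R bi_inv_K _ _ bi_inv_scal[OF a] scal_K_ball[OF a] pos, of 1 1] K_ball by auto
qed

end

section \<open>Volumes in the mirabolic subgroup\<close>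

lemma ennreal_div_nat:
  assumes "of_nat k * e = ennreal x" "k > 0" "x \<ge> 0"
  shows "e = ennreal (x / real k)"
proof -
  have "e \<noteq> \<infinity>" using assms(1,2) by (metis ennreal_mult_eq_top_iff ennreal_neq_top infinity_ennreal_def of_nat_0_eq_iff less_numeral_extra(3))
  then obtain y where y: "e = ennreal y" "y \<ge> 0" by (cases e) auto
  then have "ennreal (real k * y) = ennreal x" using assms by (simp add: ennreal_mult ennreal_of_nat_eq_real_of_nat)
  then have "real k * y = x" using y assms by simp
  then have "y = x / real k" using assms(2) by auto
  then show ?thesis using y by simp
qed

context padic_gl2
begin

lemma nv_diff_less: "nv x < r \<Longrightarrow> nv y < r \<Longrightarrow> nv (x - y) < r"
  using nv_diff[of x y] by simp

text \<open>For \<open>n \<ge> 1\<close> the stabiliser in \<open>P\<close> of the ball \<open>b + a \<int>\<^sub>p\<close>, restricted to \<open>det \<in> 1 + p\<^sup>n \<int>\<^sub>p\<close>;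
  for \<open>n = 0\<close> there is no restriction.\<close>

definition Stab :: "nat \<Rightarrow> 'k \<Rightarrow> 'k \<Rightarrow> 'k gl2 set" where
  "Stab n b a = {mir u t | u t. nv u = 1 \<and> nv (u - 1) \<le> (1 / real p) ^ n \<and> nv (t - (1 - u) * b) \<le> nv a}"

lemma mir_Stab:
  "u \<noteq> 0 \<Longrightarrow> mir u t \<in> Stab n b a \<longleftrightarrow> nv u = 1 \<and> nv (u - 1) \<le> (1 / real p) ^ n \<and> nv (t - (1 - u) * b) \<le> nv a"
proof -
  assume u: "u \<noteq> 0"
  show ?thesis
  proof
    assume "mir u t \<in> Stab n b a"
    then obtain u' t' where ut: "mir u t = mir u' t'" "nv u' = 1" "nv (u' - 1) \<le> (1 / real p) ^ n" "nv (t' - (1 - u') * b) \<le> nv a"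
      unfolding Stab_def by blast
    then have "u' \<noteq> 0" by auto
    then show "nv u = 1 \<and> nv (u - 1) \<le> (1 / real p) ^ n \<and> nv (t - (1 - u) * b) \<le> nv a"
      using ut mir_inject[OF u] by simp
  qed (auto simp: Stab_def)
qed

lemma mirabolicE: assumes "x \<in> mirabolic" obtains u t where "x = mir u t" "u \<noteq> 0"
  using assms unfolding mirabolic_def by blast

lemma Stab_mirabolic: "Stab n b a \<subseteq> mirabolic"
  unfolding Stab_def mirabolic_def by fastforce

lemma Stab_eqI:
  assumes "\<And>u t. nv u = 1 \<Longrightarrow> nv (u - 1) \<le> (1 / real p) ^ n \<Longrightarrow> nv (t - (1 - u) * b) \<le> nv a \<longleftrightarrow> nv (t - (1 - u) * b') \<le> nv a'"
  shows "Stab n b a = Stab n b' a'"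
  unfolding Stab_def using assms by blast

text \<open>Moving the centre changes \<open>t - (1 - u) * b\<close> by
  \<open>(1 - u) * (b - b')\<close>, which the congruence on \<open>u\<close> makes small.\<close>

lemma Stab_cong_center:
  assumes "(1 / real p) ^ n * nv (b - b') \<le> nv a"
  shows "Stab n b a = Stab n b' a"
proof (rule Stab_eqI)
  fix u t assume u: "nv (u - 1) \<le> (1 / real p) ^ n"
  have le: "nv ((1 - u) * (b - b')) \<le> nv a"
    using assms mult_right_mono[OF u nv_nonneg[of "b - b'"]] by (simp add: nv_mult nv_diff_commute[of 1 u])
  have e: "t - (1 - u) * b' = (t - (1 - u) * b) + (1 - u) * (b - b')" by (simp add: algebra_simps)
  have e': "t - (1 - u) * b = (t - (1 - u) * b') - (1 - u) * (b - b')" by (simp add: algebra_simps)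
  show "nv (t - (1 - u) * b) \<le> nv a \<longleftrightarrow> nv (t - (1 - u) * b') \<le> nv a"
    using le nv_add_le[of "t - (1 - u) * b" "nv a"] nv_diff_le[of "t - (1 - u) * b'" "nv a"] e e' by metis
qed

lemma Stab_eopen:
  assumes a: "a \<noteq> 0"
  shows "\<exists>U. eopen U \<and> Stab n b a = U \<inter> mirabolic"
proof -
  let ?U = "{g :: 'k gl2. nv (mat_of g $ 1 $ 1) = 1 \<and> nv (mat_of g $ 1 $ 1 - 1) \<le> (1 / real p) ^ n \<and>
      nv (mat_of g $ 1 $ 2 - (1 - mat_of g $ 1 $ 1) * b) \<le> nv a}"
  have "eopen ?U"
    unfolding eopen_def
  proof
    fix g assume g: "g \<in> ?U"
    \<comment> \<open>One bound for each condition: below \<open>1\<close> to keep the absolute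
      value of the unit \<open>u\<close>, \<open>p^-n\<close> for the congruence, and the last for
      the shift \<open>(u' - u) * b\<close> of the translation part.\<close>
    define \<epsilon> where "\<epsilon> = min (1 / 2) (min ((1 / real p) ^ n) (nv a / (nv b + 1)))"
    have b1: "nv b + 1 > 0" using nv_nonneg[of b] by linarith
    have eps: "\<epsilon> > 0" "\<epsilon> < 1" "\<epsilon> \<le> (1 / real p) ^ n" "\<epsilon> * (nv b + 1) \<le> nv a"
    proof -
      show "\<epsilon> > 0" using nv_pos[OF a] b1 eps_pos[of n] by (simp add: \<epsilon>_def)
      show "\<epsilon> < 1" "\<epsilon> \<le> (1 / real p) ^ n" by (simp_all add: \<epsilon>_def min_less_iff_disj min_le_iff_disj)
      have "\<epsilon> \<le> nv a / (nv b + 1)" by (simp add: \<epsilon>_def)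
      then show "\<epsilon> * (nv b + 1) \<le> nv a" using b1 by (simp only: pos_le_divide_eq)
    qed
    have "h \<in> ?U" if h: "mbound (mat_of h - mat_of g) \<epsilon>" for h
    proof -
      let ?x = "mat_of g $ 1 $ 1" and ?x' = "mat_of h $ 1 $ 1" and ?y = "mat_of g $ 1 $ 2" and ?y' = "mat_of h $ 1 $ 2"
      have d: "nv (?x' - ?x) \<le> \<epsilon>" "nv (?y' - ?y) \<le> \<epsilon>" using h by (simp_all add: mbound_def)
      have "nv (?x' - ?x + ?x) = nv ?x" using d(1) eps g by (intro nv_add_eq) auto
      moreover have "nv ((?x' - ?x) + (?x - 1)) \<le> (1 / real p) ^ n"
        using d(1) eps g by (intro nv_add_le) auto
      moreover have "nv ((?y - (1 - ?x) * b) + ((?y' - ?y) + (?x' - ?x) * b)) \<le> nv a"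
      proof (intro nv_add_le)
        have "\<epsilon> \<le> \<epsilon> * (nv b + 1)" "\<epsilon> * nv b \<le> \<epsilon> * (nv b + 1)" using eps(1) by (simp_all add: distrib_left)
        then show "nv (?y' - ?y) \<le> nv a" "nv ((?x' - ?x) * b) \<le> nv a"
          using d eps(4) mult_right_mono[OF d(1) nv_nonneg[of b]] by (simp_all add: nv_mult)
      qed (use g in simp)
      moreover have "(?y - (1 - ?x) * b) + ((?y' - ?y) + (?x' - ?x) * b) = ?y' - (1 - ?x') * b" by (simp add: algebra_simps)
      ultimately show ?thesis using g by simp
    qed
    then show "\<exists>\<epsilon>>0. \<forall>h. mbound (mat_of h - mat_of g) \<epsilon> \<longrightarrow> h \<in> ?U" using eps(1) by blast
  qed
  moreover have "Stab n b a = ?U \<inter> mirabolic"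
  proof (intro equalityI subsetI)
    fix x assume x: "x \<in> Stab n b a"
    then obtain u t where ut: "x = mir u t" "u \<noteq> 0" using Stab_mirabolic mirabolicE by blast
    then show "x \<in> ?U \<inter> mirabolic" using x mir_Stab[OF ut(2), of t n b a] gl2_of_nth[of u 1 t 0] Stab_mirabolic by auto
  next
    fix x assume x: "x \<in> ?U \<inter> mirabolic"
    then obtain u t where ut: "x = mir u t" "u \<noteq> 0" using mirabolicE by blast
    then show "x \<in> Stab n b a" using x mir_Stab[OF ut(2), of t n b a] gl2_of_nth[of u 1 t 0] by auto
  qed
  ultimately show ?thesis by blast
qed

lemma mirabolic_mult: "x \<in> mirabolic \<Longrightarrow> y \<in> mirabolic \<Longrightarrow> x * y \<in> mirabolic"
proof -
  assume "x \<in> mirabolic" "y \<in> mirabolic"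
  then obtain u t u' t' where "x = mir u t" "u \<noteq> 0" "y = mir u' t'" "u' \<noteq> 0" by (metis mirabolicE)
  then show ?thesis by (auto simp: mir_mult mirabolic_def)
qed

lemma mirabolic_inverse: "x \<in> mirabolic \<Longrightarrow> inverse x \<in> mirabolic"
proof -
  assume "x \<in> mirabolic"
  then obtain u t where ut: "x = mir u t" "u \<noteq> 0" by (rule mirabolicE)
  then have "inverse x = mir (1 / u) (- t / u)" "1 / u \<noteq> 0" by (auto simp: mir_inverse)
  then show ?thesis unfolding mirabolic_def by blast
qed

lemma lcoset_Stab_eopen:
  assumes "a \<noteq> 0" "x \<in> mirabolic"
  shows "\<exists>U. eopen U \<and> lcoset x (Stab n b a) = U \<inter> mirabolic"
proof -
  obtain U where U: "eopen U" "Stab n b a = U \<inter> mirabolic" using Stab_eopen[OF assms(1)] by blast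
  have "lcoset x (U \<inter> mirabolic) = lcoset x U \<inter> mirabolic"
  proof (intro equalityI subsetI)
    fix y assume "y \<in> lcoset x U \<inter> mirabolic"
    then obtain z where z: "z \<in> U" "y = x * z" "y \<in> mirabolic" by (auto simp: lcoset_def)
    then have "z = inverse x * y" by simp
    then have "z \<in> mirabolic" using mirabolic_mult[OF mirabolic_inverse[OF assms(2)] z(3)] by simp
    then show "y \<in> lcoset x (U \<inter> mirabolic)" using z by (auto simp: lcoset_def)
  qed (use mirabolic_mult assms(2) in \<open>auto simp: lcoset_def\<close>)
  then show ?thesis using eopen_lcoset[OF U(1)] U(2) by metis
qed

lemma mem_lcoset_Stab:
  assumes c: "nv c = 1" and u: "u \<noteq> 0"
  shows "mir u t \<in> lcoset (mir c e) (Stab n b a) \<longleftrightarrow>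
    nv u = 1 \<and> nv (u - c) \<le> (1 / real p) ^ n \<and> nv (t - e - (c - u) * b) \<le> nv a"
proof -
  have c0: "c \<noteq> 0" using c by auto
  have "mir u t \<in> lcoset (mir c e) (Stab n b a) \<longleftrightarrow> inverse (mir c e) * mir u t \<in> Stab n b a"
    by (force simp: lcoset_def)
  also have "inverse (mir c e) * mir u t = mir (u / c) ((t - e) / c)"
    using c0 u by (simp add: mir_inverse mir_mult diff_divide_distrib)
  also have "mir (u / c) ((t - e) / c) \<in> Stab n b a \<longleftrightarrow> nv (u / c) = 1 \<and> nv (u / c - 1) \<le> (1 / real p) ^ n \<and>
      nv ((t - e) / c - (1 - u / c) * b) \<le> nv a" using c0 u by (intro mir_Stab) simp
  also have "u / c - 1 = (u - c) / c" using c0 by (simp add: field_simps)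
  also have "(t - e) / c - (1 - u / c) * b = (t - e - (c - u) * b) / c" using c0 by (simp add: field_simps)
  finally show ?thesis by (simp add: nv_divide c)
qed

lemma mirabolic_Int_K: "mirabolic \<inter> K = Stab 0 0 1"
proof (intro equalityI subsetI)
  fix x assume x: "x \<in> mirabolic \<inter> K"
  then obtain u t where ut: "x = mir u t" "u \<noteq> 0" using mirabolicE by blast
  then show "x \<in> Stab 0 0 1" using x nv_diff_le[of u 1 1] by (auto simp: mir_Stab mir_K_iff)
next
  fix x assume x: "x \<in> Stab 0 0 1"
  then have m: "x \<in> mirabolic" using Stab_mirabolic by blast
  then obtain u t where ut: "x = mir u t" "u \<noteq> 0" using mirabolicE by blast
  then show "x \<in> mirabolic \<inter> K" using x m by (auto simp: mir_Stab mir_K_iff)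
qed

end

section \<open>Haar measure of the stabilisers \<open>Stab n b a\<close>\<close>

locale padic_haar = padic_gl2 +
  fixes vol :: "'a gl2 measure"
  assumes haar: "haar_measure_P nv vol"
begin

lemma lcoset_Stab_sets: "a \<noteq> 0 \<Longrightarrow> x \<in> mirabolic \<Longrightarrow> lcoset x (Stab n b a) \<in> sets vol"
proof -
  assume "a \<noteq> 0" "x \<in> mirabolic"
  then obtain U where U: "eopen U" "lcoset x (Stab n b a) = U \<inter> mirabolic" using lcoset_Stab_eopen by blast
  have "openin (subtopology (gl2_topology nv) mirabolic) (lcoset x (Stab n b a))"
    unfolding U(2) openin_subtopology using eopen_openin[OF U(1)] by blast
  then show ?thesis using haar unfolding haar_measure_P_def left_invariant_borel_measure_def
    by (auto intro: sigma_sets.Basic)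
qed

lemma one_mirabolic: "1 \<in> mirabolic"
  unfolding mirabolic_def one_gl2_eq by fastforce

lemma Stab_sets: "a \<noteq> 0 \<Longrightarrow> Stab n b a \<in> sets vol"
  using lcoset_Stab_sets[OF _ one_mirabolic] by (simp add: lcoset_def)

lemma emeasure_lcoset: "a \<noteq> 0 \<Longrightarrow> x \<in> mirabolic \<Longrightarrow> emeasure vol (lcoset x (Stab n b a)) = emeasure vol (Stab n b a)"
  using haar Stab_sets unfolding haar_measure_P_def left_invariant_borel_measure_def lcoset_def by auto

text \<open>The conditions \<open>mem\<close> and \<open>dist\<close> say, in coordinates, that
  \<open>Stab n b a\<close> is a disjoint union of left translates of \<open>Stab n' b' a'\<close>
  indexed by \<open>J\<close>; left invariance then counts them.\<close>

lemma Stab_decomp: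
  assumes a: "a' \<noteq> 0" and J: "finite J" "\<And>j. j \<in> J \<Longrightarrow> nv (c j) = 1"
    and mem: "\<And>u t. nv u = 1 \<Longrightarrow> mir u t \<in> Stab n b a \<longleftrightarrow>
      (\<exists>j\<in>J. nv (u - c j) \<le> (1 / real p) ^ n' \<and> nv (t - e j - (c j - u) * b') \<le> nv a')"
    and dist: "\<And>u t i j. i \<in> J \<Longrightarrow> j \<in> J \<Longrightarrow> nv u = 1 \<Longrightarrow>
      nv (u - c i) \<le> (1 / real p) ^ n' \<Longrightarrow> nv (t - e i - (c i - u) * b') \<le> nv a' \<Longrightarrow>
      nv (u - c j) \<le> (1 / real p) ^ n' \<Longrightarrow> nv (t - e j - (c j - u) * b') \<le> nv a' \<Longrightarrow> i = j"
  shows "emeasure vol (Stab n b a) = of_nat (card J) * emeasure vol (Stab n' b' a')"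
proof -
  let ?X = "\<lambda>j. lcoset (mir (c j) (e j)) (Stab n' b' a')"
  have cm: "mir (c j) (e j) \<in> mirabolic" if "j \<in> J" for j
  proof -
    have "c j \<noteq> 0" using J(2)[OF that] by auto
    then show ?thesis unfolding mirabolic_def by blast
  qed
  have Xm: "?X j \<subseteq> mirabolic" if "j \<in> J" for j
    using cm[OF that] Stab_mirabolic mirabolic_mult by (fastforce simp: lcoset_def)
  have memX: "mir u t \<in> ?X j \<longleftrightarrow> nv u = 1 \<and> nv (u - c j) \<le> (1 / real p) ^ n' \<and> nv (t - e j - (c j - u) * b') \<le> nv a'"
    if "j \<in> J" "u \<noteq> 0" for j u t using mem_lcoset_Stab[OF J(2)[OF that(1)] that(2)] .
  have "Stab n b a = (\<Union>j\<in>J. ?X j)"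
  proof (intro equalityI subsetI)
    fix x assume x: "x \<in> Stab n b a"
    then obtain u t where ut: "x = mir u t" "u \<noteq> 0" using Stab_mirabolic mirabolicE by blast
    then have "nv u = 1" using x mir_Stab by blast
    then show "x \<in> (\<Union>j\<in>J. ?X j)" using x mem memX ut by blast
  next
    fix x assume "x \<in> (\<Union>j\<in>J. ?X j)"
    then obtain j where j: "j \<in> J" "x \<in> ?X j" by blast
    then obtain u t where ut: "x = mir u t" "u \<noteq> 0" using Xm mirabolicE by blast
    then show "x \<in> Stab n b a" using j memX[OF j(1) ut(2)] mem by blast
  qed
  moreover have "disjoint_family_on ?X J"
    unfolding disjoint_family_on_def
  proof (intro ballI impI equals0I)
    fix i j x assume ij: "i \<in> J" "j \<in> J" "i \<noteq> j" "x \<in> ?X i \<inter> ?X j"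
    then obtain u t where ut: "x = mir u t" "u \<noteq> 0" using Xm mirabolicE by blast
    then have "i = j"
      using ij memX[OF ij(1) ut(2)] memX[OF ij(2) ut(2)] dist[OF ij(1,2), of u t] by simp
    then show False using ij by blast
  qed
  moreover have "?X ` J \<subseteq> sets vol" using lcoset_Stab_sets[OF a cm] by blast
  ultimately have "emeasure vol (Stab n b a) = (\<Sum>j\<in>J. emeasure vol (?X j))"
    using sum_emeasure[of ?X J vol] J(1) by simp
  also have "\<dots> = of_nat (card J) * emeasure vol (Stab n' b' a')"
    using emeasure_lcoset[OF a cm] by simp
  finally show ?thesis .
qed

text \<open>Split by the residue modulo \<open>p\<close> of \<open>(t - (1 - u) * b) / a\<close>;
  the representatives are translations.\<close>

lemma Stab_shrink:
  assumes a: "a \<noteq> 0"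
  shows "emeasure vol (Stab n b a) = of_nat p * emeasure vol (Stab n b (of_nat p * a))"
proof -
  let ?P = "of_nat p :: 'a"
  have div: "nv (y - of_nat j * a) \<le> nv (?P * a) \<longleftrightarrow> nv (y / a - of_nat j) < 1" for y j
  proof -
    have "nv (y - of_nat j * a) = nv (y / a - of_nat j) * nv a"
      using a by (simp add: nv_mult[symmetric] left_diff_distrib)
    then have "nv (y - of_nat j * a) \<le> nv (?P * a) \<longleftrightarrow> nv (y / a - of_nat j) * nv a \<le> 1 / real p * nv a"
      by (simp only: nv_mult nv_p)
    then show ?thesis using nv_pos[OF a] unfolding nv_less_1_iff by (simp only: mult_le_cancel_right_pos)
  qed
  have "emeasure vol (Stab n b a) = of_nat (card {..<p}) * emeasure vol (Stab n b (?P * a))"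
  proof (rule Stab_decomp[where c = "\<lambda>_. 1" and e = "\<lambda>j. of_nat j * a"])
    fix u t assume u: "nv u = 1"
    then have u0: "u \<noteq> 0" by auto
    let ?y = "t - (1 - u) * b"
    have e: "t - of_nat j * a - (1 - u) * b = ?y - of_nat j * a" for j by simp
    have "nv ?y \<le> nv a \<longleftrightarrow> (\<exists>j\<in>{..<p}. nv (?y - of_nat j * a) \<le> nv (?P * a))"
    proof
      assume "nv ?y \<le> nv a"
      then have "nv (?y / a) \<le> 1" using nv_pos[OF a] by (simp add: nv_divide)
      then obtain j where "j < p" "nv (?y / a - of_nat j) < 1" using residue by blast
      then show "\<exists>j\<in>{..<p}. nv (?y - of_nat j * a) \<le> nv (?P * a)" unfolding div by blast
    next
      assume "\<exists>j\<in>{..<p}. nv (?y - of_nat j * a) \<le> nv (?P * a)"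
      then obtain j where "nv (?y - of_nat j * a) \<le> nv (?P * a)" by blast
      moreover have "nv (?P * a) \<le> nv a" "nv (of_nat j * a) \<le> nv a"
        unfolding nv_mult using nv_of_nat_le nv_nonneg by (meson mult_left_le_one_le)+
      ultimately show "nv ?y \<le> nv a" using nv_add_le[of "?y - of_nat j * a" "nv a" "of_nat j * a"] by simp
    qed
    then show "mir u t \<in> Stab n b a \<longleftrightarrow> (\<exists>j\<in>{..<p}. nv (u - 1) \<le> (1 / real p) ^ n \<and> nv (t - of_nat j * a - (1 - u) * b) \<le> nv (?P * a))"
      unfolding mir_Stab[OF u0] e using u by blast
  next
    fix u t i j assume "i \<in> {..<p}" "j \<in> {..<p}" and
      h: "nv (t - of_nat i * a - (1 - u) * b) \<le> nv (?P * a)" "nv (t - of_nat j * a - (1 - u) * b) \<le> nv (?P * a)"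
    then have ij: "i < p" "j < p" by auto
    have "nv ((t - (1 - u) * b) / a - of_nat i) < 1" "nv ((t - (1 - u) * b) / a - of_nat j) < 1"
      using h unfolding div[symmetric] by (simp_all add: algebra_simps)
    then have "nv (((t - (1 - u) * b) / a - of_nat j) - ((t - (1 - u) * b) / a - of_nat i)) < 1"
      by (rule nv_diff_less[rotated])
    then have "nv (of_nat i - of_nat j) < 1" by simp
    then show "i = j" using residue_unique ij by blast
  qed (use a in auto)
  then show ?thesis by simp
qed

text \<open>Split by the residue modulo \<open>p\<close> of \<open>(u - 1) / p^n\<close>. The
  representative \<open>mir (c j) ((1 - c j) * b)\<close> is the dilation by \<open>c j\<close> that
  fixes the point \<open>b\<close>, so the ball is preserved.\<close>

lemma Stab_unit_shrink:
  assumes a: "a \<noteq> 0" and n: "n \<ge> 1"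
  shows "emeasure vol (Stab n b a) = of_nat p * emeasure vol (Stab (Suc n) b a)"
proof -
  let ?P = "of_nat p ^ n :: 'a"
  have P: "nv ?P = (1 / real p) ^ n" "?P \<noteq> 0" by (simp_all add: nv_power nv_p)
  define c where "c = (\<lambda>j. 1 + of_nat j * ?P)"
  have div: "nv (u - c j) \<le> (1 / real p) ^ Suc n \<longleftrightarrow> nv ((u - 1) / ?P - of_nat j) < 1" for u j
  proof -
    have "u - c j = ((u - 1) / ?P - of_nat j) * ?P" using P(2) by (simp add: c_def left_diff_distrib[of "(u - 1) / ?P"])
    then have "nv (u - c j) = nv ((u - 1) / ?P - of_nat j) * (1 / real p) ^ n" by (simp only: nv_mult P)
    then have "nv (u - c j) \<le> (1 / real p) ^ Suc n \<longleftrightarrow> nv ((u - 1) / ?P - of_nat j) * (1 / real p) ^ n \<le> 1 / real p * (1 / real p) ^ n"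
      by (simp only: power_Suc)
    then show ?thesis unfolding nv_less_1_iff using eps_pos[of n] by (simp only: mult_le_cancel_right_pos)
  qed
  have small: "nv (of_nat j * ?P) < 1" for j
  proof -
    have "nv (of_nat j * ?P) \<le> (1 / real p) ^ n" unfolding nv_mult P(1) using nv_of_nat_le eps_pos[of n] by (intro mult_left_le_one_le) auto
    also have "\<dots> \<le> (1 / real p) ^ 1" using n p_gt_1 by (intro power_decreasing) auto
    also have "\<dots> < 1" using p_gt_1 by simp
    finally show ?thesis .
  qed
  have "emeasure vol (Stab n b a) = of_nat (card {..<p}) * emeasure vol (Stab (Suc n) b a)"
  proof (rule Stab_decomp[where c = c and e = "\<lambda>j. (1 - c j) * b"])
    show "nv (c j) = 1" for j using nv_add_eq[of "of_nat j * ?P" 1] small[of j] by (simp add: c_def add.commute)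
    have e: "t - (1 - c j) * b - (c j - u) * b = t - (1 - u) * b" for t u j by (simp add: algebra_simps)
    fix u t assume u: "nv u = 1"
    then have u0: "u \<noteq> 0" by auto
    have "nv (u - 1) \<le> (1 / real p) ^ n \<longleftrightarrow> (\<exists>j\<in>{..<p}. nv (u - c j) \<le> (1 / real p) ^ Suc n)"
    proof
      assume "nv (u - 1) \<le> (1 / real p) ^ n"
      then have "nv ((u - 1) / ?P) \<le> 1" using eps_pos[of n] P by (simp add: nv_divide)
      then obtain j where "j < p" "nv ((u - 1) / ?P - of_nat j) < 1" using residue by blast
      then show "\<exists>j\<in>{..<p}. nv (u - c j) \<le> (1 / real p) ^ Suc n" unfolding div by blast
    next
      assume "\<exists>j\<in>{..<p}. nv (u - c j) \<le> (1 / real p) ^ Suc n"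
      then obtain j where j: "nv ((u - 1) / ?P - of_nat j) < 1" unfolding div by blast
      then have "nv ((u - 1) / ?P) \<le> 1"
        using nv_add_le[of "(u - 1) / ?P - of_nat j" 1 "of_nat j"] nv_of_nat_le[of j] by simp
      then show "nv (u - 1) \<le> (1 / real p) ^ n" using eps_pos[of n] P by (simp add: nv_divide)
    qed
    then show "mir u t \<in> Stab n b a \<longleftrightarrow>
      (\<exists>j\<in>{..<p}. nv (u - c j) \<le> (1 / real p) ^ Suc n \<and> nv (t - (1 - c j) * b - (c j - u) * b) \<le> nv a)"
      unfolding mir_Stab[OF u0] e using u by blast
  next
    fix u i j assume "i \<in> {..<p}" "j \<in> {..<p}" and
      h: "nv (u - c i) \<le> (1 / real p) ^ Suc n" "nv (u - c j) \<le> (1 / real p) ^ Suc n"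
    then have ij: "i < p" "j < p" by auto
    have "nv ((u - 1) / ?P - of_nat i) < 1" "nv ((u - 1) / ?P - of_nat j) < 1" using h unfolding div by auto
    then have "nv (((u - 1) / ?P - of_nat j) - ((u - 1) / ?P - of_nat i)) < 1"
      by (rule nv_diff_less[rotated])
    then have "nv (of_nat i - of_nat j) < 1" by simp
    then show "i = j" using residue_unique ij by blast
  qed (use a in auto)
  then show ?thesis by simp
qed

text \<open>At level \<open>0\<close> only the \<open>p - 1\<close> nonzero residues of
  \<open>u\<close> occur; the representatives are again dilations fixing \<open>b\<close>.\<close>

lemma Stab_unit_index:
  assumes a: "a \<noteq> 0"
  shows "emeasure vol (Stab 0 b a) = of_nat (p - 1) * emeasure vol (Stab 1 b a)"
proof -
  have unit: "nv (of_nat j) = 1" if "j \<in> {1..<p}" for j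
    using that by (intro nv_of_nat_unit) (auto dest: dvd_imp_le)
  have "emeasure vol (Stab 0 b a) = of_nat (card {1..<p}) * emeasure vol (Stab 1 b a)"
  proof (rule Stab_decomp[where c = of_nat and e = "\<lambda>j. (1 - of_nat j) * b"])
    have e: "t - (1 - of_nat j) * b - (of_nat j - u) * b = t - (1 - u) * b" for t u j by (simp add: algebra_simps)
    fix u t assume u: "nv u = 1"
    then have u0: "u \<noteq> 0" by auto
    obtain j where j: "j < p" "nv (u - of_nat j) < 1" using residue[of u] u by auto
    have "j \<noteq> 0" using j(2) u by (intro notI) simp
    then have "\<exists>j\<in>{1..<p}. nv (u - of_nat j) \<le> (1 / real p) ^ 1"
      using j unfolding nv_less_1_iff by (intro bexI[of _ j]) auto
    moreover have "nv (u - 1) \<le> 1" using u by (intro nv_diff_le) auto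
    ultimately show "mir u t \<in> Stab 0 b a \<longleftrightarrow>
      (\<exists>j\<in>{1..<p}. nv (u - of_nat j) \<le> (1 / real p) ^ 1 \<and> nv (t - (1 - of_nat j) * b - (of_nat j - u) * b) \<le> nv a)"
      unfolding mir_Stab[OF u0] e using u by auto
  next
    fix u i j assume "i \<in> {1..<p}" "j \<in> {1..<p}" and
      h: "nv (u - of_nat i) \<le> (1 / real p) ^ 1" "nv (u - of_nat j) \<le> (1 / real p) ^ 1"
    then have ij: "i < p" "j < p" by auto
    have "nv (u - of_nat i) < 1" "nv (u - of_nat j) < 1" using h unfolding nv_less_1_iff by auto
    then have "nv ((u - of_nat j) - (u - of_nat i)) < 1"
      by (rule nv_diff_less[rotated])
    then have "nv (of_nat i - of_nat j) < 1" by simp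
    then show "i = j" using residue_unique ij by blast
  qed (use a unit in auto)
  then show ?thesis by simp
qed

text \<open>The index of \<open>1 + p^n \<int>\<^sub>p\<close> in the units for
  \<open>n \<ge> 1\<close>, and \<open>1\<close> for \<open>n = 0\<close>.\<close>

definition unit_index :: "nat \<Rightarrow> real" where
  "unit_index n = (if n = 0 then 1 else (real p - 1) * real p ^ (n - 1))"

lemma unit_index_pos: "unit_index n > 0"
  using p_gt_1 by (simp add: unit_index_def)

lemma emeasure_Stab_zero: "a \<noteq> 0 \<Longrightarrow> emeasure vol (Stab 0 0 a) = ennreal (nv a)"
proof -
  assume a: "a \<noteq> 0"
  let ?P = "of_nat p :: 'a"
  have base: "emeasure vol (Stab 0 0 1) = ennreal 1"
    using haar mirabolic_Int_K by (simp add: haar_measure_P_def)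
  have pos: "emeasure vol (Stab 0 0 (?P ^ m)) = ennreal (nv (?P ^ m))" for m
  proof (induction m)
    case (Suc m)
    have "of_nat p * emeasure vol (Stab 0 0 (?P ^ Suc m)) = ennreal (nv (?P ^ m))"
      using Stab_shrink[of "?P ^ m" 0 0] Suc by simp
    from ennreal_div_nat[OF this] show ?case using p_gt_0 by (simp add: nv_mult nv_p)
  qed (use base in simp)
  have neg: "emeasure vol (Stab 0 0 (1 / ?P ^ m)) = ennreal (nv (1 / ?P ^ m))" for m
  proof (induction m)
    case (Suc m)
    have "emeasure vol (Stab 0 0 (1 / ?P ^ Suc m)) = of_nat p * emeasure vol (Stab 0 0 (1 / ?P ^ m))"
      using Stab_shrink[of "1 / ?P ^ Suc m" 0 0] by simp
    also have "\<dots> = ennreal (real p * nv (1 / ?P ^ m))"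
      unfolding Suc by (simp add: ennreal_mult ennreal_of_nat_eq_real_of_nat)
    also have "real p * nv (1 / ?P ^ m) = nv (1 / ?P ^ Suc m)" by (simp add: nv_divide nv_mult nv_p)
    finally show ?case .
  qed (use base in simp)
  obtain n u where nu: "a = ?P powi n * u" "nv u = 1" using unit_decomp[OF a] by blast
  have "nv a = nv (?P powi n)" using nu by (simp add: nv_mult)
  then have "Stab 0 0 a = Stab 0 0 (?P powi n)" by (simp add: Stab_def)
  then show ?thesis
    using pos[of "nat n"] neg[of "nat (- n)"] \<open>nv a = _\<close>
    by (cases "n \<ge> 0") (auto simp: power_int_def power_inverse inverse_eq_divide power_one_over)
qed

text \<open>Moving the centre \<open>b\<close> to \<open>0\<close> is a conjugation, which left
  invariance does not directly control. At a deep level the centre is immaterial by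
  \<open>Stab_cong_center\<close>, and the indices, which are the same for every centre, carry the
  value back to level \<open>n\<close>.\<close>

lemma emeasure_Stab:
  assumes a: "a \<noteq> 0"
  shows "emeasure vol (Stab n b a) = ennreal (nv a / unit_index n)"
proof -
  have one: "emeasure vol (Stab 1 0 a) = ennreal (nv a / (real p - 1))"
  proof -
    have "of_nat (p - 1) * emeasure vol (Stab 1 0 a) = ennreal (nv a)"
      using Stab_unit_index[OF a] emeasure_Stab_zero[OF a] by simp
    from ennreal_div_nat[OF this] show ?thesis using p_gt_1 by (simp add: of_nat_diff)
  qed
  have centred: "emeasure vol (Stab (Suc n) 0 a) = ennreal (nv a / unit_index (Suc n))" for n
  proof (induction n)
    case 0
    then show ?case using one by (simp add: unit_index_def)
  next
    case (Suc n)
    have "of_nat p * emeasure vol (Stab (Suc (Suc n)) 0 a) = ennreal (nv a / unit_index (Suc n))"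
      using Stab_unit_shrink[OF a, of "Suc n" 0] Suc by simp
    from ennreal_div_nat[OF this] show ?case
      using p_gt_0 unit_index_pos[of "Suc n"] by (simp add: unit_index_def less_imp_le mult_ac)
  qed
  \<comment> \<open>From this level on \<open>(1 / p)^N0 * nv b\<close> is below
    \<open>nv a\<close>; the summand \<open>1\<close> covers \<open>b = 0\<close>.\<close>
  obtain N0 where N0: "(1 / real p) ^ N0 < nv a / (nv b + 1)"
    using nv_small[of "nv a / (nv b + 1)"] nv_pos[OF a] nv_nonneg[of b] by (metis add_nonneg_pos divide_pos_pos zero_less_one)
  have far: "emeasure vol (Stab (Suc m) b a) = ennreal (nv a / unit_index (Suc m))" if "m \<ge> N0" for m
  proof -
    have "(1 / real p) ^ Suc m \<le> (1 / real p) ^ N0"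
      using that p_gt_1 by (intro power_decreasing) auto
    then have "(1 / real p) ^ Suc m * nv (b - 0) \<le> nv a / (nv b + 1) * nv b"
      using N0 by (intro mult_mono) auto
    also have "\<dots> \<le> nv a / (nv b + 1) * (nv b + 1)" by (intro mult_left_mono divide_nonneg_nonneg) simp_all
    also have "\<dots> = nv a" using nv_nonneg[of b] by (simp add: add_nonneg_eq_0_iff)
    finally have "Stab (Suc m) b a = Stab (Suc m) 0 a" by (rule Stab_cong_center)
    then show ?thesis using centred by simp
  qed
  have pos: "emeasure vol (Stab (Suc m) b a) = ennreal (nv a / unit_index (Suc m))" for m
  proof (cases "m \<ge> N0")
    case False
    then have "m \<le> N0" by simp
    then show ?thesis
    proof (induction m rule: inc_induct)
      case base
      show ?case by (rule far) simp
    next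
      case (step m)
      have "emeasure vol (Stab (Suc m) b a) = of_nat p * ennreal (nv a / unit_index (Suc (Suc m)))"
        using Stab_unit_shrink[OF a, of "Suc m" b] step by simp
      also have "\<dots> = ennreal (real p * (nv a / unit_index (Suc (Suc m))))"
        using unit_index_pos[of "Suc (Suc m)"] by (subst ennreal_mult) (auto simp: ennreal_of_nat_eq_real_of_nat less_imp_le)
      also have "real p * (nv a / unit_index (Suc (Suc m))) = nv a / unit_index (Suc m)"
        by (simp add: unit_index_def)
      finally show ?case .
    qed
  qed (rule far)
  show ?thesis
  proof (cases n)
    case 0
    have "emeasure vol (Stab 0 b a) = of_nat (p - 1) * ennreal (nv a / (real p - 1))"
      using Stab_unit_index[OF a, of b] pos[of 0] by (simp add: unit_index_def)
    also have "\<dots> = ennreal (real (p - 1) * (nv a / (real p - 1)))"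
      using p_gt_1 by (subst ennreal_mult) (auto simp: ennreal_of_nat_eq_real_of_nat)
    also have "real (p - 1) * (nv a / (real p - 1)) = nv a" using p_gt_1 by (simp add: of_nat_diff)
    finally show ?thesis using 0 by (simp add: unit_index_def)
  qed (use pos in simp)
qed

lemma measure_Stab: "a \<noteq> 0 \<Longrightarrow> measure vol (Stab n b a) = nv a / unit_index n"
  using emeasure_Stab unit_index_pos[of n] by (simp add: measure_def less_imp_le)

end

section \<open>The recursion\<close>

locale coeff_ring =
  fixes p :: nat and R :: "complex set"
  assumes p_pos: "p > 0" and R: "subalgebra_Z_inv p R"
begin

lemma R_one: "1 \<in> R" and R_diff: "x \<in> R \<Longrightarrow> y \<in> R \<Longrightarrow> x - y \<in> R"
  and R_mult: "x \<in> R \<Longrightarrow> y \<in> R \<Longrightarrow> x * y \<in> R" and R_inv_p: "inverse (of_nat p) \<in> R"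
  using R unfolding subalgebra_Z_inv_def by blast+

lemma R_zero: "0 \<in> R"
  using R_diff[OF R_one R_one] by simp

lemma R_uminus: "x \<in> R \<Longrightarrow> - x \<in> R"
  using R_diff[OF R_zero] by simp

lemma R_add: "x \<in> R \<Longrightarrow> y \<in> R \<Longrightarrow> x + y \<in> R"
  using R_diff[of x "- y"] R_uminus by simp

lemma R_sum: "(\<And>i. i \<in> I \<Longrightarrow> f i \<in> R) \<Longrightarrow> (\<Sum>i\<in>I. f i) \<in> R"
  by (induction I rule: infinite_finite_induct) (auto intro: R_zero R_add)

lemma R_of_nat: "of_nat n \<in> R"
  by (induction n) (auto intro: R_zero R_one R_add)

lemma R_power: "x \<in> R \<Longrightarrow> x ^ n \<in> R"
  by (induction n) (auto intro: R_one R_mult)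

lemma R_powi: "of_real (real p powi k) \<in> R"
  using R_power[OF R_of_nat, of p "nat k"] R_power[OF R_inv_p, of "nat (- k)"]
  by (cases "k \<ge> 0") (auto simp: power_int_def)

lemma R_div_p: "x \<in> R \<Longrightarrow> x / of_nat p \<in> R"
  using R_mult[OF _ R_inv_p] by (simp add: divide_inverse)

lemma R_cancel_p: "of_nat p * x \<in> R \<Longrightarrow> x \<in> R"
  using R_div_p[of "of_nat p * x"] p_pos by simp

lemma ideal2_mult: "r \<in> R \<Longrightarrow> x \<in> ideal2 R a b \<Longrightarrow> r * x \<in> ideal2 R a b"
proof -
  assume r: "r \<in> R" and "x \<in> ideal2 R a b"
  then obtain y z where "x = y * a + z * b" "y \<in> R" "z \<in> R" unfolding ideal2_def by blast
  then have "r * x = (r * y) * a + (r * z) * b" "r * y \<in> R" "r * z \<in> R" using r R_mult by (auto simp: algebra_simps)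
  then show ?thesis unfolding ideal2_def by blast
qed

lemma ideal2_add: "x \<in> ideal2 R a b \<Longrightarrow> y \<in> ideal2 R a b \<Longrightarrow> x + y \<in> ideal2 R a b"
proof -
  assume "x \<in> ideal2 R a b" "y \<in> ideal2 R a b"
  then obtain x1 x2 y1 y2 where "x = x1 * a + x2 * b" "y = y1 * a + y2 * b" "x1 \<in> R" "x2 \<in> R" "y1 \<in> R" "y2 \<in> R"
    unfolding ideal2_def by blast
  then have "x + y = (x1 + y1) * a + (x2 + y2) * b" "x1 + y1 \<in> R" "x2 + y2 \<in> R" using R_add by (auto simp: algebra_simps)
  then show ?thesis unfolding ideal2_def by blast
qed

lemma ideal2_diff: "x \<in> ideal2 R a b \<Longrightarrow> y \<in> ideal2 R a b \<Longrightarrow> x - y \<in> ideal2 R a b"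
  using ideal2_add[of x a b "(- 1) * y"] ideal2_mult[OF R_uminus[OF R_one], of y a b] by simp

lemma ideal2_left: "x \<in> R \<Longrightarrow> x * a \<in> ideal2 R a b"
  unfolding ideal2_def using R_zero by force

lemma ideal2_right: "x \<in> R \<Longrightarrow> x * b \<in> ideal2 R a b"
  unfolding ideal2_def using R_zero by force

lemma ideal2_zero: "0 \<in> ideal2 R a b"
  using ideal2_left[OF R_zero, of a b] by simp

lemma ideal2_sum: "(\<And>i. i \<in> I \<Longrightarrow> f i \<in> ideal2 R a b) \<Longrightarrow> (\<Sum>i\<in>I. f i) \<in> ideal2 R a b"
  by (induction I rule: infinite_finite_induct) (auto intro: ideal2_zero ideal2_add)

lemma ideal2_div_p: "x \<in> ideal2 R a b \<Longrightarrow> x / of_nat p \<in> ideal2 R a b"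
  using ideal2_mult[OF R_inv_p] by (simp add: divide_inverse mult.commute)

lemma ideal2_cancel_p: "of_nat p * x \<in> ideal2 R a b \<Longrightarrow> x \<in> ideal2 R a b"
  using ideal2_div_p[of "of_nat p * x"] p_pos by simp

end

text \<open>\<open>F a1 b1 a2 b2\<close> is the value of the linear form at the pair of balls
  \<open>b1 + a1 \<int>\<^sub>p\<close>, \<open>b2 + a2 \<int>\<^sub>p\<close>; these are the vertices of the two trees.\<close>

locale ball_form = padic_gl2 p nv for p and nv :: "'k::field_char_0 \<Rightarrow> real" +
  fixes F :: "'k \<Rightarrow> 'k \<Rightarrow> 'k \<Rightarrow> 'k \<Rightarrow> complex" and w1 w2 t1 t2 :: complex
  assumes right1: "a1 \<noteq> 0 \<Longrightarrow> a2 \<noteq> 0 \<Longrightarrow> nv u = 1 \<Longrightarrow> nv s \<le> 1 \<Longrightarrow> F (a1 * u) (b1 + a1 * s) a2 b2 = F a1 b1 a2 b2"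
    and right2: "a1 \<noteq> 0 \<Longrightarrow> a2 \<noteq> 0 \<Longrightarrow> nv u = 1 \<Longrightarrow> nv s \<le> 1 \<Longrightarrow> F a1 b1 (a2 * u) (b2 + a2 * s) = F a1 b1 a2 b2"
    and left: "a1 \<noteq> 0 \<Longrightarrow> a2 \<noteq> 0 \<Longrightarrow> c \<noteq> 0 \<Longrightarrow>
      F (c * a1) (c * b1 + d) (c * a2) (c * b2 + d) = of_real (nv c) * F a1 b1 a2 b2"
    and hecke1: "a1 \<noteq> 0 \<Longrightarrow> a2 \<noteq> 0 \<Longrightarrow>
      (\<Sum>c<p. F (of_nat p * a1) (b1 + of_nat c * a1) a2 b2) + w1 * F (a1 / of_nat p) b1 a2 b2 = t1 * F a1 b1 a2 b2"
    and hecke2: "a1 \<noteq> 0 \<Longrightarrow> a2 \<noteq> 0 \<Longrightarrow>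
      (\<Sum>c<p. F a1 b1 (of_nat p * a2) (b2 + of_nat c * a2)) + w2 * F a1 b1 (a2 / of_nat p) b2 = t2 * F a1 b1 a2 b2"
begin

abbreviation P where "P \<equiv> of_nat p :: 'k"

text \<open>Standard position: the upward rays from \<open>p^i \<int>\<^sub>p\<close> and
  \<open>1 + p^j \<int>\<^sub>p\<close> meet in \<open>\<int>\<^sub>p\<close>, also when
  \<open>i\<close> or \<open>j\<close> is \<open>0\<close>.\<close>

definition f :: "nat \<Rightarrow> nat \<Rightarrow> complex" where
  "f i j = F (P ^ i) 0 (P ^ j) 1"

lemma shift1: "a1 \<noteq> 0 \<Longrightarrow> a2 \<noteq> 0 \<Longrightarrow> nv (b - b1) \<le> nv a1 \<Longrightarrow> F a1 b a2 b2 = F a1 b1 a2 b2"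
  using right1[of a1 a2 1 "(b - b1) / a1" b1 b2] nv_pos[of a1] by (simp add: nv_divide)

lemma shift2: "a1 \<noteq> 0 \<Longrightarrow> a2 \<noteq> 0 \<Longrightarrow> nv (b - b2) \<le> nv a2 \<Longrightarrow> F a1 b1 a2 b = F a1 b1 a2 b2"
  using right2[of a1 a2 1 "(b - b2) / a2" b1 b2] nv_pos[of a2] by (simp add: nv_divide)

lemma unit1: "a1 \<noteq> 0 \<Longrightarrow> a2 \<noteq> 0 \<Longrightarrow> nv u = 1 \<Longrightarrow> F (a1 * u) b1 a2 b2 = F a1 b1 a2 b2"
  using right1[of a1 a2 u 0 b1 b2] by simp

lemma unit2: "a1 \<noteq> 0 \<Longrightarrow> a2 \<noteq> 0 \<Longrightarrow> nv u = 1 \<Longrightarrow> F a1 b1 (a2 * u) b2 = F a1 b1 a2 b2"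
  using right2[of a1 a2 u 0 b1 b2] by simp

lemma translate: "a1 \<noteq> 0 \<Longrightarrow> a2 \<noteq> 0 \<Longrightarrow> F a1 (b1 + d) a2 (b2 + d) = F a1 b1 a2 b2"
  using left[of a1 a2 1 b1 d b2] by simp

lemma scale: "a1 \<noteq> 0 \<Longrightarrow> a2 \<noteq> 0 \<Longrightarrow> c \<noteq> 0 \<Longrightarrow> F (c * a1) (c * b1) (c * a2) (c * b2) = of_real (nv c) * F a1 b1 a2 b2"
  using left[of a1 a2 c b1 0 b2] by simp

text \<open>Dilation by a unit preserves all radii and the centre \<open>0\<close>, and its factor
  under \<open>Z\<close> is \<open>1\<close>.\<close>

lemma unit_center:
  assumes "a1 \<noteq> 0" "a2 \<noteq> 0" "nv u = 1"
  shows "F a1 0 a2 u = F a1 0 a2 1"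
proof -
  have u: "u \<noteq> 0" using assms(3) by auto
  have "F a1 0 a2 u = F (a1 * u) 0 (a2 * u) u" using assms u by (simp add: unit1 unit2)
  also have "\<dots> = F a1 0 a2 1" using scale[OF assms(1,2) u, of 0 1] assms(3) by (simp add: mult.commute)
  finally show ?thesis .
qed

lemma shift_center:
  assumes "a1 \<noteq> 0" "a2 \<noteq> 0"
  shows "F a1 c a2 b = F a1 0 a2 (b - c)"
  using translate[OF assms, of 0 c "b - c"] by simp

text \<open>At distance \<open>Suc i\<close> the first vertex lies strictly below the meeting point,
  so all its \<open>p\<close> children are one step further away and its parent one step closer; no
  branching is visible.\<close>

lemma recursion1: "of_nat p * f (Suc (Suc i)) j + w1 * f i j = t1 * f (Suc i) j"
proof -
  have "F (P * P ^ Suc i) (0 + of_nat c * P ^ Suc i) (P ^ j) 1 = f (Suc (Suc i)) j" for c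
  proof -
    have "nv (of_nat c * P ^ Suc i) < 1"
    proof -
      have "nv (of_nat c * P ^ Suc i) = nv (of_nat c * P ^ i) * (1 / real p)" by (simp add: nv_mult nv_power nv_p)
      also have "\<dots> \<le> 1 * (1 / real p)"
        by (intro mult_right_mono nv_mult_le_1) (auto simp: nv_of_nat_le nv_power power_le_one)
      also have "\<dots> < 1" using p_gt_1 by simp
      finally show ?thesis .
    qed
    then have "nv (- (of_nat c * P ^ Suc i) + 1) = nv 1" by (intro nv_add_eq) simp
    then have "nv (1 - of_nat c * P ^ Suc i) = 1" by simp
    from unit_center[of "P * P ^ Suc i" "P ^ j", OF _ _ this]
    show ?thesis using shift_center[of "P * P ^ Suc i" "P ^ j" "of_nat c * P ^ Suc i" 1] by (simp add: f_def)
  qed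
  then show ?thesis using hecke1[of "P ^ Suc i" "P ^ j" 0 1] by (simp add: f_def)
qed

text \<open>Moving the first vertex up from the meeting point makes its parent the new meeting
  point, one step further from the second vertex. Dilation by \<open>p\<close> restores standard
  position; inverting its factor \<open>nv p = 1 / p\<close> gives \<open>p\<close>.\<close>

lemma parent_top: "F (1 / P) 0 (P ^ j) 1 = of_nat p * f 0 (Suc j)"
proof -
  have "f 0 (Suc j) = F 1 (1 - P) (P ^ Suc j) 1"
    using shift1[of 1 "P ^ Suc j" "1 - P" 0 1] nv_diff_le[of 1 1 P] nv_of_nat_le[of p] by (simp add: f_def)
  also have "\<dots> = F 1 0 (P ^ Suc j) P" using shift_center[of 1 "P ^ Suc j" "1 - P" 1] by simp
  also have "\<dots> = F (P * (1 / P)) (P * 0) (P * P ^ j) (P * 1)" by simp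
  also have "\<dots> = of_real (nv P) * F (1 / P) 0 (P ^ j) 1" by (rule scale) auto
  finally show ?thesis using p_gt_0 by (simp add: nv_p)
qed

lemma recursion1_top0: "of_nat p * f 1 0 + w1 * of_nat p * f 0 1 = t1 * f 0 0"
proof -
  have "F P (of_nat c) 1 1 = f 1 0" for c
    using shift_center[of P 1 "of_nat c" 1] shift2[of P 1 "1 - of_nat c" 1 0] nv_of_nat_le[of c] by (simp add: f_def)
  then show ?thesis using hecke1[of 1 1 0 1] parent_top[of 0] by (simp add: f_def mult.assoc)
qed

text \<open>The first vertex is the meeting point and the second lies below it. The child
  \<open>c = 1\<close> points towards the second vertex and becomes the meeting point, with a factor
  \<open>1 / p\<close> from dilation; the other \<open>p - 1\<close> children branch off. This is
  the source of \<open>p - 1\<close>.\<close>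

lemma recursion1_top:
  "(of_nat p - 1) * f 1 (Suc j) + f 0 j / of_nat p + w1 * of_nat p * f 0 (Suc (Suc j)) = t1 * f 0 (Suc j)"
proof -
  let ?g = "\<lambda>c. F P (of_nat c) (P ^ Suc j) 1"
  have g1: "?g 1 = f 0 j / of_nat p"
  proof -
    have "?g 1 = F P 0 (P * P ^ j) 0" using shift_center[of P "P ^ Suc j" 1 1] by simp
    also have "\<dots> = F P (P * 0) (P * P ^ j) (P * 1)"
      using translate[of P "P * P ^ j" 0 P 0] shift1[of P "P * P ^ j" P 0 P] by simp
    also have "\<dots> = of_real (nv P) * f 0 j" using scale[of 1 "P ^ j" P 0 1] by (simp add: f_def)
    finally show ?thesis by (simp add: nv_p)
  qed
  have gc: "?g c = f 1 (Suc j)" if "c \<in> {..<p} - {1}" for c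
  proof -
    have "\<not> nv (of_nat 1 - of_nat c) < 1" using residue_unique[of 1 c] that p_gt_1 by auto
    moreover have "nv (of_nat 1 - of_nat c) \<le> 1" by (intro nv_diff_le nv_of_nat_le)
    ultimately have "nv (1 - of_nat c) = 1" by simp
    from unit_center[of P "P ^ Suc j", OF _ _ this]
    show ?thesis using shift_center[of P "P ^ Suc j" "of_nat c" 1] by (simp add: f_def)
  qed
  have "(\<Sum>c<p. ?g c) = ?g 1 + (\<Sum>c\<in>{..<p} - {1}. ?g c)"
    using p_gt_1 by (intro sum.remove) auto
  also have "(\<Sum>c\<in>{..<p} - {1}. ?g c) = (of_nat p - 1) * f 1 (Suc j)"
    using gc p_gt_1 by (simp add: of_nat_diff)
  finally have "(\<Sum>c<p. ?g c) = f 0 j / of_nat p + (of_nat p - 1) * f 1 (Suc j)" using g1 by simp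
  then show ?thesis using hecke1[of 1 "P ^ Suc j" 0 1] parent_top[of "Suc j"] by (simp add: f_def mult.assoc add.commute)
qed

end

lemma (in ball_form) ball_form_swap: "ball_form p nv (\<lambda>a2 b2 a1 b1. F a1 b1 a2 b2) w2 w1 t2 t1"
  by unfold_locales (use right1 right2 left hecke1 hecke2 in auto)

lemma (in ball_form) f_swap: "ball_form.f p (\<lambda>a2 b2 a1 b1. F a1 b1 a2 b2) j i = f i j"
proof -
  interpret S: ball_form p nv "\<lambda>a2 b2 a1 b1. F a1 b1 a2 b2" w2 w1 t2 t1 by (rule ball_form_swap)
  \<comment> \<open>The exchange interchanges the centres \<open>0\<close> and \<open>1\<close>;
    translating the first back to \<open>0\<close> leaves the unit \<open>- 1\<close> as the
    second.\<close>
  have "S.f j i = F (P ^ i) 0 (P ^ j) (- 1)" using shift_center[of "P ^ i" "P ^ j" 1 0] by (simp add: S.f_def)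
  also have "\<dots> = f i j" unfolding f_def by (rule unit_center) auto
  finally show ?thesis .
qed

section \<open>Integrality of the numbers \<open>f i j\<close>\<close>

locale ball_form_ring = ball_form p nv F w1 w2 t1 t2 + coeff_ring p R
  for p and nv :: "'k::field_char_0 \<Rightarrow> real" and F w1 w2 t1 t2 R +
  assumes wt: "w1 \<in> R" "w2 \<in> R" "t1 \<in> R" "t2 \<in> R"
    and f00: "f 0 0 = 1 - w1 * w2" and w_ne: "w1 * w2 \<noteq> 1"
begin

lemma recursion2: "of_nat p * f i (Suc (Suc j)) + w2 * f i j = t2 * f i (Suc j)"
proof -
  interpret S: ball_form p nv "\<lambda>a2 b2 a1 b1. F a1 b1 a2 b2" w2 w1 t2 t1 by (rule ball_form_swap)
  show ?thesis using S.recursion1[of j i] by (simp add: f_swap)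
qed

lemma recursion2_top0: "of_nat p * f 0 1 + w2 * of_nat p * f 1 0 = t2 * f 0 0"
proof -
  interpret S: ball_form p nv "\<lambda>a2 b2 a1 b1. F a1 b1 a2 b2" w2 w1 t2 t1 by (rule ball_form_swap)
  show ?thesis using S.recursion1_top0 by (simp only: f_swap)
qed

text \<open>The two relations at the root are a linear system for \<open>f 1 0\<close> and \<open>f 0 1\<close> with determinant
  \<open>1 - w1 w2\<close>; the normalisation of \<open>f 0 0\<close> cancels the determinant.\<close>

lemma f10: "of_nat p * f 1 0 = t1 - w1 * t2"
proof -
  have "(1 - w1 * w2) * (of_nat p * f 1 0) = (of_nat p * f 1 0 + w1 * of_nat p * f 0 1) - w1 * (of_nat p * f 0 1 + w2 * of_nat p * f 1 0)"
    by (simp add: algebra_simps)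
  also have "\<dots> = (1 - w1 * w2) * (t1 - w1 * t2)"
    unfolding recursion1_top0 recursion2_top0 f00 by (simp add: algebra_simps)
  finally show ?thesis using w_ne by simp
qed

lemma f01: "of_nat p * f 0 1 = t2 - w2 * t1"
proof -
  have "(1 - w1 * w2) * (of_nat p * f 0 1) = (of_nat p * f 0 1 + w2 * of_nat p * f 1 0) - w2 * (of_nat p * f 1 0 + w1 * of_nat p * f 0 1)"
    by (simp add: algebra_simps)
  also have "\<dots> = (1 - w1 * w2) * (t2 - w2 * t1)"
    unfolding recursion1_top0 recursion2_top0 f00 by (simp add: algebra_simps)
  finally show ?thesis using w_ne by simp
qed

lemma fi0_R: "f i 0 \<in> R"
proof (induction i rule: less_induct)
  case (less i)
  consider "i = 0" | "i = 1" | j where "i = Suc (Suc j)" by (metis One_nat_def not0_implies_Suc)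
  then show ?case
  proof cases
    case 1
    then show ?thesis unfolding \<open>i = 0\<close> f00 by (intro R_diff R_one R_mult wt)
  next
    case 2
    have "of_nat p * f 1 0 \<in> R" unfolding f10 by (intro R_diff R_mult wt)
    then show ?thesis unfolding 2 by (rule R_cancel_p)
  next
    case 3
    have "of_nat p * f i 0 = t1 * f (Suc j) 0 - w1 * f j 0" using recursion1[of j 0] 3 by (simp add: algebra_simps)
    moreover have "t1 * f (Suc j) 0 - w1 * f j 0 \<in> R" using less.IH 3 by (intro R_diff R_mult wt) auto
    ultimately show ?thesis by - (rule R_cancel_p, simp)
  qed
qed

lemma f0j_R: "f 0 j \<in> R"
proof (induction j rule: less_induct)
  case (less j)
  consider "j = 0" | "j = 1" | i where "j = Suc (Suc i)" by (metis One_nat_def not0_implies_Suc)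
  then show ?case
  proof cases
    case 2
    have "of_nat p * f 0 1 \<in> R" unfolding f01 by (intro R_diff R_mult wt)
    then show ?thesis unfolding 2 by (rule R_cancel_p)
  next
    case 3
    have "of_nat p * f 0 j = t2 * f 0 (Suc i) - w2 * f 0 i" using recursion2[of 0 i] 3 by (simp add: algebra_simps)
    moreover have "t2 * f 0 (Suc i) - w2 * f 0 i \<in> R" using less.IH 3 by (intro R_diff R_mult wt) auto
    ultimately show ?thesis by - (rule R_cancel_p, simp)
  qed (simp add: fi0_R)
qed

text \<open>The value at \<open>s = 0\<close> of the inverse Rankin--Selberg factor in terms of Hecke eigenvalues.\<close>

definition rs :: complex where
  "rs = (1 - w1 * w2)\<^sup>2 - t1 * t2 * (1 + w1 * w2) / of_nat p + (w1 * t2\<^sup>2 + w2 * t1\<^sup>2) / of_nat p"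

lemma rs_R: "rs \<in> R"
  unfolding rs_def power2_eq_square
  by (intro R_add R_diff R_mult R_div_p R_one wt)

abbreviation "I \<equiv> ideal2 R (of_nat p - 1) rs"

lemma I_base: "(of_nat p - 1) * f i 0 \<in> I" "(of_nat p - 1) * f 0 j \<in> I"
  using ideal2_left[OF fi0_R[of i], of "of_nat p - 1" rs] ideal2_left[OF f0j_R[of j], of "of_nat p - 1" rs]
  by (simp_all add: mult.commute)

text \<open>The product \<open>(t2 - w2 * t1) * (t1 - w1 * t2) / p\<close> of the two root values
  expands to \<open>(1 - w1 * w2)\<^sup>2 - rs\<close>. The remaining terms combine to
  \<open>(1 - w1 * w2) * (1 - 1 / p)\<close>, a multiple of \<open>p - 1\<close> because
  \<open>1 / p\<close> is in \<open>R\<close>.\<close>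

lemma I_11: "(of_nat p - 1) * f 1 1 \<in> I"
proof -
  have p0: "of_nat p \<noteq> (0::complex)" using p_pos by simp
  have f1: "f 0 1 = (t2 - w2 * t1) / of_nat p" using f01 p0 by (simp add: field_simps)
  have f2: "of_nat p * f 0 2 = t2 * f 0 1 - w2 * f 0 0" using recursion2[of 0 0] by (simp add: numeral_2_eq_2 algebra_simps)
  have "(of_nat p - 1) * f 1 1 = t1 * f 0 1 - f 0 0 / of_nat p - w1 * (of_nat p * f 0 2)"
    using recursion1_top[of 0] by (simp add: numeral_2_eq_2 algebra_simps)
  also have "\<dots> = - rs + (1 - w1 * w2) * (1 - w1 * w2) * (1 - 1 / of_nat p) + (1 - w1 * w2) * (w1 * w2) * (1 - 1 / of_nat p)"
    unfolding f2 f1 f00 rs_def using p0 by (simp add: field_simps power2_eq_square)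
  also have "\<dots> = (- 1) * rs + ((1 - w1 * w2) / of_nat p) * (of_nat p - 1)"
    using p0 by (simp add: field_simps)
  also have "\<dots> \<in> I"
    by (intro ideal2_add ideal2_left ideal2_right R_div_p R_diff R_mult R_one R_uminus wt)
  finally show ?thesis .
qed

text \<open>Away from the meeting point the recursions are linear with coefficients in
  \<open>R\<close> and leading coefficient the unit \<open>p\<close>, so membership in the ideal
  spreads from indices \<open>0\<close> and \<open>1\<close>.\<close>

lemma fij_I: "(of_nat p - 1) * f i j \<in> I"
proof -
  have one: "(of_nat p - 1) * f 1 j \<in> I" for j
  proof (induction j rule: less_induct)
    case (less j)
    consider "j = 0" | "j = 1" | k where "j = Suc (Suc k)" by (metis One_nat_def not0_implies_Suc)
    then show ?case
    proof cases
      case 3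
      have "of_nat p * ((of_nat p - 1) * f 1 j) = t2 * ((of_nat p - 1) * f 1 (Suc k)) - w2 * ((of_nat p - 1) * f 1 k)"
        using arg_cong[OF recursion2[of 1 k], of "\<lambda>x. (of_nat p - 1) * x"] 3 by (simp add: algebra_simps)
      moreover have "\<dots> \<in> I"
        by (rule ideal2_diff[OF ideal2_mult[OF wt(4) less.IH] ideal2_mult[OF wt(2) less.IH]]) (use 3 in auto)
      ultimately show ?thesis by - (rule ideal2_cancel_p, simp)
    qed (use I_base[of 1] I_11 in simp_all)
  qed
  show ?thesis
  proof (induction i rule: less_induct)
    case (less i)
    consider "i = 0" | "i = 1" | k where "i = Suc (Suc k)" by (metis One_nat_def not0_implies_Suc)
    then show ?case
    proof cases
      case 3
      have "of_nat p * ((of_nat p - 1) * f i j) = t1 * ((of_nat p - 1) * f (Suc k) j) - w1 * ((of_nat p - 1) * f k j)"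
        using arg_cong[OF recursion1[of k j], of "\<lambda>x. (of_nat p - 1) * x"] 3 by (simp add: algebra_simps)
      moreover have "\<dots> \<in> I"
        by (rule ideal2_diff[OF ideal2_mult[OF wt(3) less.IH] ideal2_mult[OF wt(1) less.IH]]) (use 3 in auto)
      ultimately show ?thesis by - (rule ideal2_cancel_p, simp)
    qed (use I_base one in simp_all)
  qed
qed

lemma I_subset: "I \<subseteq> R"
proof
  fix x assume "x \<in> I"
  then obtain a b where "x = a * (of_nat p - 1) + b * rs" "a \<in> R" "b \<in> R" unfolding ideal2_def by blast
  then show "x \<in> R" using R_add R_mult R_diff R_of_nat R_one rs_R by metis
qed

lemma nv_R: "a \<noteq> 0 \<Longrightarrow> of_real (nv a) \<in> R"
  using nv_value R_powi by metis

lemma p_power_cases: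
  assumes "a \<noteq> 0" "nv a \<le> 1"
  obtains i u where "a = P ^ i * u" "nv u = 1"
proof -
  obtain n u where nu: "a = P powi n * u" "nv u = 1" using unit_decomp[OF assms(1)] by blast
  have "nv a = real p powi (- n)" using nu by (simp add: nv_mult nv_powi nv_p p_inv_powi)
  have "n \<ge> 0"
  proof (rule ccontr)
    assume "\<not> n \<ge> 0"
    then have "real p powi 1 \<le> real p powi (- n)" using p_gt_1 by (intro power_int_increasing) auto
    then show False using assms(2) \<open>nv a = _\<close> p_gt_1 by simp
  qed
  then have "a = P ^ nat n * u" using nu by (simp add: power_int_def)
  then show ?thesis using that nu(2) by blast
qed

lemma F_nested1:
  assumes a: "a1 \<noteq> 0" "a2 \<noteq> 0" and le: "nv a1 \<le> nv a2" "nv (b1 - b2) \<le> nv a2"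
  shows "F a1 b1 a2 b2 = of_real (nv a2) * F (a1 / a2) 0 1 1"
proof -
  \<comment> \<open>Every point of the larger ball is a centre; \<open>b1 + a2\<close> is the one
    that becomes \<open>1\<close> after moving \<open>b1\<close> to \<open>0\<close> and dividing by
    \<open>a2\<close>.\<close>
  have "F a1 b1 a2 b2 = F a1 b1 a2 (b1 + a2)"
    using shift2[OF a, of "b1 + a2" b2] nv_add_le[OF le(2), of a2] by (simp add: algebra_simps)
  also have "\<dots> = F (a2 * (a1 / a2)) (a2 * 0) (a2 * 1) (a2 * 1)" using shift_center[OF a, of b1 "b1 + a2"] a by simp
  also have "\<dots> = of_real (nv a2) * F (a1 / a2) 0 1 1" using a by (intro scale) auto
  finally show ?thesis .
qed

text \<open>The smallest ball containing both has radius \<open>nv (b2 - b1)\<close>, so dilation by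
  \<open>b2 - b1\<close> leads to standard position.\<close>

lemma F_disjoint:
  assumes a: "a1 \<noteq> 0" "a2 \<noteq> 0" and lt: "nv a1 < nv (b2 - b1)" "nv a2 < nv (b2 - b1)"
  shows "\<exists>i j. F a1 b1 a2 b2 = of_real (nv (b2 - b1)) * f i j"
proof -
  let ?d = "b2 - b1"
  have d: "?d \<noteq> 0" using lt(1) nv_nonneg[of a1] by (metis nv_0 not_le)
  have "F a1 b1 a2 b2 = F (?d * (a1 / ?d)) (?d * 0) (?d * (a2 / ?d)) (?d * 1)" using shift_center[OF a, of b1 b2] d by simp
  also have "\<dots> = of_real (nv ?d) * F (a1 / ?d) 0 (a2 / ?d) 1" using a d by (intro scale) auto
  finally have F: "F a1 b1 a2 b2 = of_real (nv ?d) * F (a1 / ?d) 0 (a2 / ?d) 1" .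
  obtain i u where i: "a1 / ?d = P ^ i * u" "nv u = 1"
    using p_power_cases[of "a1 / ?d"] a d lt nv_pos[OF d] by (auto simp: nv_divide)
  obtain j v where j: "a2 / ?d = P ^ j * v" "nv v = 1"
    using p_power_cases[of "a2 / ?d"] a d lt nv_pos[OF d] by (auto simp: nv_divide)
  have uv: "u \<noteq> 0" "v \<noteq> 0" using i j by auto
  have "F (a1 / ?d) 0 (a2 / ?d) 1 = f i j" unfolding i(1) j(1) f_def using uv i j by (simp add: unit1 unit2)
  then show ?thesis using F by auto
qed

lemma F_nested:
  assumes a: "a1 \<noteq> 0" "a2 \<noteq> 0" and le: "nv (b1 - b2) \<le> max (nv a1) (nv a2)"
  shows "F a1 b1 a2 b2 \<in> R"
proof (cases "nv a1 \<le> nv a2")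
  case True
  obtain i u where i: "a1 / a2 = P ^ i * u" "nv u = 1"
    using p_power_cases[of "a1 / a2"] a True nv_pos[OF a(2)] by (auto simp: nv_divide)
  have "F (a1 / a2) 0 1 1 = f i 0" unfolding i(1) f_def using i by (simp add: unit1)
  then show ?thesis using F_nested1[OF a True] le True nv_R[OF a(2)] fi0_R R_mult by (simp add: max_def)
next
  case False
  interpret S: ball_form p nv "\<lambda>a2 b2 a1 b1. F a1 b1 a2 b2" w2 w1 t2 t1 by (rule ball_form_swap)
  obtain j u where j: "a2 / a1 = P ^ j * u" "nv u = 1"
    using p_power_cases[of "a2 / a1"] a False nv_pos[OF a(1)] by (auto simp: nv_divide)
  have "F 1 1 (a2 / a1) 0 = S.f j 0" unfolding j(1) S.f_def using j by (simp add: unit2)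
  then have "F 1 1 (a2 / a1) 0 = f 0 j" by (simp add: f_swap)
  moreover have "F a1 b1 a2 b2 = of_real (nv a1) * F 1 1 (a2 / a1) 0"
  proof -
    have "F a1 b1 a2 b2 = F a1 (b2 + a1) a2 b2"
      using shift1[OF a, of "b2 + a1" b1] nv_add_le[of "b2 - b1" "nv a1" a1] le False by (simp add: nv_diff_commute algebra_simps max_def)
    also have "\<dots> = F (a1 * 1) (a1 * 1) (a1 * (a2 / a1)) (a1 * 0)" using translate[OF a, of a1 b2 0] a by (simp add: add.commute)
    also have "\<dots> = of_real (nv a1) * F 1 1 (a2 / a1) 0" using a by (intro scale) auto
    finally show ?thesis .
  qed
  ultimately show ?thesis using nv_R[OF a(1)] f0j_R R_mult by simp
qed

lemma F_I:
  assumes a: "a1 \<noteq> 0" "a2 \<noteq> 0"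
  shows "(of_nat p - 1) * F a1 b1 a2 b2 \<in> I"
proof (cases "nv (b1 - b2) \<le> max (nv a1) (nv a2)")
  case True
  from ideal2_left[OF F_nested[OF a True]] show ?thesis by (simp add: mult.commute)
next
  case False
  then have lt: "nv a1 < nv (b2 - b1)" "nv a2 < nv (b2 - b1)" by (simp_all add: nv_diff_commute[of b2 b1])
  then obtain i j where "F a1 b1 a2 b2 = of_real (nv (b2 - b1)) * f i j"
    using F_disjoint[OF a] by blast
  then have eq: "(of_nat p - 1) * F a1 b1 a2 b2 = of_real (nv (b2 - b1)) * ((of_nat p - 1) * f i j)" by simp
  have "b2 - b1 \<noteq> 0" using lt(1) nv_nonneg[of a1] by (metis nv_0 not_le)
  then show ?thesis unfolding eq by (intro ideal2_mult[OF nv_R fij_I])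
qed

end

section \<open>The equivariant form\<close>

locale rs_form = rs_pair p nv \<psi>1 \<psi>2 V1 V2 R
  for p :: nat and nv :: "'k::field_char_0 \<Rightarrow> real" and \<psi>1 \<psi>2 V1 V2 R +
  fixes Z :: "('k gl2 \<times> 'k gl2 \<Rightarrow> complex) \<Rightarrow> complex"
  assumes Z: "Z \<in> Hom_P nv (tensor_rep V1 V2)"
begin

abbreviation "v \<equiv> v_sph nv V1 V2"
abbreviation "U \<equiv> tensor_rep V1 V2"

lemma rtrans_v: "rtrans (g1, g2) v = tensor_fun (rtrans g1 S1.W) (rtrans g2 S2.W)"
  by (rule ext) (auto simp: rtrans_def tensor_fun_def v_sph_def times_prod_def)

lemma rtrans_v_apply: "rtrans (g1, g2) v (x1, x2) = S1.W (x1 * g1) * S2.W (x2 * g2)"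
  unfolding rtrans_v by (simp add: tensor_fun_def rtrans_def)

lemma rtrans_v_mem: "rtrans g v \<in> U"
proof -
  obtain g1 g2 where g: "g = (g1, g2)" by (cases g)
  show ?thesis unfolding g rtrans_v tensor_rep_def
    using invariant_subspaceD(4)[OF S1.inv_V S1.W(1)] invariant_subspaceD(4)[OF S2.inv_V S2.W(1)]
    by (intro span_over_base) blast
qed

lemma Z_scale: "G \<in> U \<Longrightarrow> Z (\<lambda>x. c * G x) = c * Z G"
  using Z unfolding Hom_P_def linear_on_def by blast

lemma Z_add: "G \<in> U \<Longrightarrow> H \<in> U \<Longrightarrow> Z (\<lambda>x. G x + H x) = Z G + Z H"
  using Z unfolding Hom_P_def linear_on_def by blast

lemma U_sum: "finite I \<Longrightarrow> (\<And>i. i \<in> I \<Longrightarrow> G i \<in> U) \<Longrightarrow> (\<lambda>x. \<Sum>i\<in>I. c i * G i x) \<in> U"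
proof (induction I rule: finite_induct)
  case empty
  then show ?case unfolding tensor_rep_def by (simp add: span_over_zero)
next
  case (insert i I)
  have "(\<lambda>x. c i * G i x + 1 * (\<Sum>i\<in>I. c i * G i x)) \<in> U"
    using insert unfolding tensor_rep_def by (intro span_over_add) auto
  then show ?case using insert by simp
qed

lemma Z_sum: "finite I \<Longrightarrow> (\<And>i. i \<in> I \<Longrightarrow> G i \<in> U) \<Longrightarrow> Z (\<lambda>x. \<Sum>i\<in>I. c i * G i x) = (\<Sum>i\<in>I. c i * Z (G i))"
proof (induction I rule: finite_induct)
  case empty
  have "(\<lambda>_. 0) \<in> U" unfolding tensor_rep_def by (rule span_over_zero)
  from Z_scale[OF this, of 0] show ?case by simp
next
  case (insert i I)
  have "(\<lambda>x. c i * G i x) \<in> U" using U_sum[of "{i}" G c] insert.prems by simp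
  moreover have "(\<lambda>x. \<Sum>i\<in>I. c i * G i x) \<in> U" using U_sum[of I G c] insert by simp
  ultimately have "Z (\<lambda>x. c i * G i x + (\<Sum>i\<in>I. c i * G i x)) = Z (\<lambda>x. c i * G i x) + Z (\<lambda>x. \<Sum>i\<in>I. c i * G i x)"
    by (rule Z_add)
  then show ?case using insert Z_scale by simp
qed

definition z :: "'k gl2 \<Rightarrow> 'k gl2 \<Rightarrow> complex" where
  "z g1 g2 = Z (rtrans (g1, g2) v)"

lemma z_K: "k1 \<in> K \<Longrightarrow> k2 \<in> K \<Longrightarrow> z (g1 * k1) (g2 * k2) = z g1 g2"
proof -
  assume "k1 \<in> K" "k2 \<in> K"
  then have "rtrans k1 S1.W = S1.W" "rtrans k2 S2.W = S2.W"
    using S1.W(2) S2.W(2) by (auto simp: right_inv_def)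
  then show ?thesis by (simp add: z_def rtrans_v flip: rtrans_rtrans)
qed

lemma z_scal:
  assumes "c1 \<noteq> 0" "c2 \<noteq> 0"
  shows "z (scal c1 * g1) (scal c2 * g2) = S1.\<omega> c1 * S2.\<omega> c2 * z g1 g2"
proof -
  have "rtrans (scal c1 * g1) S1.W = (\<lambda>x. S1.\<omega> c1 * rtrans g1 S1.W x)"
    unfolding rtrans_rtrans[symmetric] using assms invariant_subspaceD(4)[OF S1.inv_V S1.W(1)] by (intro S1.central_W)
  moreover have "rtrans (scal c2 * g2) S2.W = (\<lambda>x. S2.\<omega> c2 * rtrans g2 S2.W x)"
    unfolding rtrans_rtrans[symmetric] using assms invariant_subspaceD(4)[OF S2.inv_V S2.W(1)] by (intro S2.central_W)
  ultimately have "rtrans (scal c1 * g1, scal c2 * g2) v = (\<lambda>x. (S1.\<omega> c1 * S2.\<omega> c2) * rtrans (g1, g2) v x)"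
    unfolding rtrans_v by (auto simp: tensor_fun_def)
  then show ?thesis unfolding z_def using Z_scale[OF rtrans_v_mem] by simp
qed

lemma z_mir:
  assumes "c \<noteq> 0"
  shows "z (mir c d * g1) (mir c d * g2) = of_real (nv c) * z g1 g2"
proof -
  have "mir c d \<in> mirabolic" using assms unfolding mirabolic_def by blast
  then have "Z (rtrans (mir c d, mir c d) (rtrans (g1, g2) v)) = of_real (delta_P nv (mir c d)) * Z (rtrans (g1, g2) v)"
    using Z rtrans_v_mem unfolding Hom_P_def by blast
  moreover have "delta_P nv (mir c d) = nv c" using assms by (simp add: delta_P_def gl2_of_nth)
  ultimately show ?thesis by (simp add: z_def rtrans_rtrans times_prod_def)
qed

lemma finite_T_reps: "finite T_reps"
  by (simp add: T_reps_def)

lemma z_T1: "(\<Sum>r\<in>T_reps. z (g1 * r) g2) = S1.\<tau> * z g1 g2"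
proof -
  have "(\<lambda>x. \<Sum>r\<in>T_reps. 1 * rtrans (g1 * r, g2) v x) = (\<lambda>x. S1.\<tau> * rtrans (g1, g2) v x)"
  proof
    fix x :: "'k gl2 \<times> 'k gl2"
    obtain x1 x2 where x: "x = (x1, x2)" by (cases x)
    show "(\<Sum>r\<in>T_reps. 1 * rtrans (g1 * r, g2) v x) = S1.\<tau> * rtrans (g1, g2) v x"
      using T_W1[of "x1 * g1"]
      by (simp add: x rtrans_v_apply mult.assoc flip: sum_distrib_right)
  qed
  then show ?thesis
    using Z_sum[OF finite_T_reps, of "\<lambda>r. rtrans (g1 * r, g2) v" "\<lambda>_. 1"] Z_scale[OF rtrans_v_mem] rtrans_v_mem
    by (simp add: z_def)
qed

lemma z_T2: "(\<Sum>r\<in>T_reps. z g1 (g2 * r)) = S2.\<tau> * z g1 g2"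
proof -
  have "(\<lambda>x. \<Sum>r\<in>T_reps. 1 * rtrans (g1, g2 * r) v x) = (\<lambda>x. S2.\<tau> * rtrans (g1, g2) v x)"
  proof
    fix x :: "'k gl2 \<times> 'k gl2"
    obtain x1 x2 where x: "x = (x1, x2)" by (cases x)
    show "(\<Sum>r\<in>T_reps. 1 * rtrans (g1, g2 * r) v x) = S2.\<tau> * rtrans (g1, g2) v x"
      using T_W2[of "x2 * g2"]
      by (simp add: x rtrans_v_apply mult.assoc flip: sum_distrib_left)
  qed
  then show ?thesis
    using Z_sum[OF finite_T_reps, of "\<lambda>r. rtrans (g1, g2 * r) v" "\<lambda>_. 1"] Z_scale[OF rtrans_v_mem] rtrans_v_mem
    by (simp add: z_def)
qed

definition F :: "'k \<Rightarrow> 'k \<Rightarrow> 'k \<Rightarrow> 'k \<Rightarrow> complex" where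
  "F a1 b1 a2 b2 = z (mir a1 b1) (mir a2 b2)"

text \<open>The \<open>p\<close> children of the ball and its parent; the scalar \<open>p\<close>
  that comes with the parent turns into the central character in the Hecke relation.\<close>

lemma mir_T_reps:
  assumes "a \<noteq> (0::'k)"
  shows "mir a b * mir (of_nat p) (of_nat c) = mir (of_nat p * a) (b + of_nat c * a)"
    "mir a b * gl2_of 1 0 0 (of_nat p) = scal (of_nat p) * mir (a / of_nat p) b"
  using assms by (simp_all add: gl2_of_mult mult.commute add.commute)

sublocale B: ball_form p nv F "S1.\<omega> (of_nat p)" "S2.\<omega> (of_nat p)" "S1.\<tau>" "S2.\<tau>"
proof
  fix a1 a2 b1 b2 u s :: 'k
  assume a: "a1 \<noteq> 0" "a2 \<noteq> 0"
  show "F (a1 * u) (b1 + a1 * s) a2 b2 = F a1 b1 a2 b2" if us: "nv u = 1" "nv s \<le> 1"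
  proof -
    have u: "u \<noteq> 0" using us by auto
    have "mir u s \<in> K" using us u by (simp add: mir_K_iff)
    then show ?thesis
      using z_K[OF _ K_one, of "mir u s" "mir a1 b1" "mir a2 b2"] mir_unit_right[OF a(1) u] by (simp add: F_def)
  qed
  show "F a1 b1 (a2 * u) (b2 + a2 * s) = F a1 b1 a2 b2" if us: "nv u = 1" "nv s \<le> 1"
  proof -
    have u: "u \<noteq> 0" using us by auto
    have "mir u s \<in> K" using us u by (simp add: mir_K_iff)
    then show ?thesis
      using z_K[OF K_one, of "mir u s" "mir a1 b1" "mir a2 b2"] mir_unit_right[OF a(2) u] by (simp add: F_def)
  qed
  show "F (c * a1) (c * b1 + d) (c * a2) (c * b2 + d) = of_real (nv c) * F a1 b1 a2 b2" if c: "c \<noteq> 0" for c d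
    using z_mir[OF c, of d "mir a1 b1" "mir a2 b2"] a c by (simp add: F_def mir_mult)
  have P: "z (scal (of_nat p) * g1) g2 = S1.\<omega> (of_nat p) * z g1 g2"
    "z g1 (scal (of_nat p) * g2) = S2.\<omega> (of_nat p) * z g1 g2" for g1 g2
    using z_scal[of "of_nat p" 1 g1 g2] z_scal[of 1 "of_nat p" g1 g2] S1.omega_unit[of 1] S2.omega_unit[of 1] by simp_all
  show "(\<Sum>c<p. F (of_nat p * a1) (b1 + of_nat c * a1) a2 b2) + S1.\<omega> (of_nat p) * F (a1 / of_nat p) b1 a2 b2 = S1.\<tau> * F a1 b1 a2 b2"
    using z_T1[of "mir a1 b1" "mir a2 b2"] unfolding sum_T_reps mir_T_reps[OF a(1)] P by (simp add: F_def)
  show "(\<Sum>c<p. F a1 b1 (of_nat p * a2) (b2 + of_nat c * a2)) + S2.\<omega> (of_nat p) * F a1 b1 (a2 / of_nat p) b2 = S2.\<tau> * F a1 b1 a2 b2"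
    using z_T2[of "mir a1 b1" "mir a2 b2"] unfolding sum_T_reps mir_T_reps[OF a(2)] P by (simp add: F_def)
qed

lemma z_iwasawa:
  assumes "c1 \<noteq> 0" "c2 \<noteq> 0" "k1 \<in> K" "k2 \<in> K"
  shows "z (scal c1 * mir a1 b1 * k1) (scal c2 * mir a2 b2 * k2) = S1.\<omega> c1 * S2.\<omega> c2 * F a1 b1 a2 b2"
  using z_K[OF assms(3,4)] z_scal[OF assms(1,2)] by (simp add: F_def)

lemma F_base: "B.f 0 0 = Z v"
proof -
  have "z (mir 1 0 * 1) (mir 1 0 * mir 1 1) = z (mir 1 0) (mir 1 0)"
    by (intro z_K K_one) (simp add: mir_K_iff)
  moreover have "rtrans (1, 1) v = v" by (rule ext) (simp add: rtrans_def times_prod_def)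
  ultimately show ?thesis by (simp add: B.f_def F_def z_def mir_mult)
qed

end

section \<open>Stabilisers of pairs of balls\<close>

context padic_gl2
begin

text \<open>Scalars are central and the factors \<open>k1\<close>, \<open>k2\<close> preserve
  \<open>K\<close> under conjugation. What remains is that the affine map with slope
  \<open>u\<close> and constant term \<open>t\<close> sends each of the two balls to itself.\<close>

lemma conj_G_int_iff:
  assumes g: "g1 = scal c1 * mir a1 b1 * k1" "g2 = scal c2 * mir a2 b2 * k2"
    and nz: "c1 \<noteq> 0" "c2 \<noteq> 0" "a1 \<noteq> 0" "a2 \<noteq> 0" and k: "k1 \<in> K" "k2 \<in> K" and u: "u \<noteq> 0"
  shows "(mir u t, mir u t) \<in> conj_G_int nv (g1, g2) \<longleftrightarrow>
    nv u = 1 \<and> nv (t - (1 - u) * b1) \<le> nv a1 \<and> nv (t - (1 - u) * b2) \<le> nv a2"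
proof -
  have one: "inverse (scal c * mir a b * k) * mir u t * (scal c * mir a b * k) \<in> K \<longleftrightarrow> nv u = 1 \<and> nv (t - (1 - u) * b) \<le> nv a"
    if "c \<noteq> 0" "a \<noteq> 0" "k \<in> K" for c a b k
  proof -
    have "inverse (scal c * mir a b * k) * mir u t * (scal c * mir a b * k)
        = inverse k * (inverse (mir a b) * (inverse (scal c) * (mir u t * scal c)) * mir a b) * k"
      by (simp add: gl2_inverse_mult mult.assoc)
    also have "inverse (scal c) * (mir u t * scal c) = mir u t"
      using scal_commute[OF that(1), of "mir u t"] by (metis gl2_mult_inverse_cancel(1))
    also have "inverse (mir a b) * mir u t * mir a b = mir u ((t - (1 - u) * b) / a)"
    proof -
      have "(t - (1 - u) * b) / a = 1 / a * u * b + (1 / a * t + - b / a)" using that(2) by (simp add: divide_simps) (simp add: algebra_simps)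
      then show ?thesis using that(2) u by (simp add: mir_inverse mir_mult)
    qed
    finally show ?thesis
      using that K_inverse[OF that(3)] u nv_pos[OF that(2)] by (simp add: mir_K_iff nv_divide divide_le_eq_1)
  qed
  have "(mir u t, mir u t) \<in> conj_G_int nv (g1, g2) \<longleftrightarrow>
    inverse g1 * mir u t * g1 \<in> K \<and> inverse g2 * mir u t * g2 \<in> K"
  proof
    assume "(mir u t, mir u t) \<in> conj_G_int nv (g1, g2)"
    then obtain h1 h2 where h: "h1 \<in> K" "h2 \<in> K" "mir u t = g1 * h1 * inverse g1" "mir u t = g2 * h2 * inverse g2"
      unfolding conj_G_int_def G_int_def by (auto simp: times_prod_def)
    have "inverse g1 * mir u t * g1 = h1" by (simp add: h(3) mult.assoc)
    moreover have "inverse g2 * mir u t * g2 = h2" by (simp add: h(4) mult.assoc)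
    ultimately show "inverse g1 * mir u t * g1 \<in> K \<and> inverse g2 * mir u t * g2 \<in> K" using h by simp
  next
    assume h: "inverse g1 * mir u t * g1 \<in> K \<and> inverse g2 * mir u t * g2 \<in> K"
    have "(mir u t, mir u t) = (g1, g2) * (inverse g1 * mir u t * g1, inverse g2 * mir u t * g2) *
        (inverse (fst (g1, g2)), inverse (snd (g1, g2)))"
      by (simp add: times_prod_def mult.assoc)
    then show "(mir u t, mir u t) \<in> conj_G_int nv (g1, g2)" using h unfolding conj_G_int_def G_int_def by blast
  qed
  then show ?thesis unfolding g using one[OF nz(1,3) k(1)] one[OF nz(2,4) k(2)] by blast
qed

lemma mirabolic1_iff: "u \<noteq> 0 \<Longrightarrow> mir u t \<in> mirabolic1 p nv \<longleftrightarrow> nv (u - 1) \<le> 1 / real p"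
proof -
  assume u: "u \<noteq> 0"
  have "(\<exists>y. nv y \<le> 1 \<and> u = 1 + of_nat p * y) \<longleftrightarrow> nv (u - 1) \<le> 1 / real p"
  proof
    assume "nv (u - 1) \<le> 1 / real p"
    then have "nv ((u - 1) / of_nat p) \<le> 1" using p_gt_0 by (simp add: nv_divide nv_p field_simps)
    then show "\<exists>y. nv y \<le> 1 \<and> u = 1 + of_nat p * y" by (intro exI[of _ "(u - 1) / of_nat p"]) simp
  qed (auto simp: nv_mult nv_p divide_right_mono)
  moreover have "mir u t \<in> mirabolic" using u unfolding mirabolic_def by blast
  ultimately show ?thesis using u by (simp add: mirabolic1_def gl2_det_of)
qed

text \<open>Given the condition at the smaller ball, the one at the larger is equivalent to
  \<open>nv (u - 1) * nv (b1 - b2) \<le> nv a2\<close>. For nested balls this holds for every unit;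
  for disjoint ones it is a congruence of positive level, which absorbs the level
  \<open>m \<le> 1\<close> already imposed.\<close>

lemma Stab_Int:
  assumes a: "a1 \<noteq> 0" "a2 \<noteq> 0" and le: "nv a1 \<le> nv a2" and m: "m \<le> 1"
  shows "nv (b1 - b2) \<le> nv a2 \<Longrightarrow> Stab m b1 a1 \<inter> Stab m b2 a2 = Stab m b1 a1"
    and "nv (b1 - b2) > nv a2 \<Longrightarrow> \<exists>n\<ge>1. Stab m b1 a1 \<inter> Stab m b2 a2 = Stab n b1 a1"
proof -
  have e: "t - (1 - u) * b2 = (t - (1 - u) * b1) + (1 - u) * (b1 - b2)" for t u by (simp add: algebra_simps)
  have e': "(1 - u) * (b1 - b2) = (t - (1 - u) * b2) - (t - (1 - u) * b1)" for t u by (simp add: algebra_simps)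
  have cond: "mir u t \<in> Stab m b1 a1 \<inter> Stab m b2 a2 \<longleftrightarrow>
      mir u t \<in> Stab m b1 a1 \<and> nv (u - 1) * nv (b1 - b2) \<le> nv a2" if u: "u \<noteq> 0" for u t
  proof -
    have "nv (t - (1 - u) * b2) \<le> nv a2 \<longleftrightarrow> nv ((1 - u) * (b1 - b2)) \<le> nv a2" if t: "nv (t - (1 - u) * b1) \<le> nv a1"
    proof
      assume "nv (t - (1 - u) * b2) \<le> nv a2"
      then show "nv ((1 - u) * (b1 - b2)) \<le> nv a2" unfolding e'[of u t] using t le by - (rule nv_diff_le, auto)
    next
      assume "nv ((1 - u) * (b1 - b2)) \<le> nv a2"
      then show "nv (t - (1 - u) * b2) \<le> nv a2" unfolding e[of t u] using t le by - (rule nv_add_le, auto)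
    qed
    then show ?thesis using u by (auto simp: mir_Stab nv_mult nv_diff_commute[of 1 u])
  qed
  have sub: "x \<in> Stab m b1 a1 \<Longrightarrow> \<exists>u t. x = mir u t \<and> u \<noteq> 0 \<and> nv u = 1 \<and> nv (u - 1) \<le> 1" for x
  proof -
    assume x: "x \<in> Stab m b1 a1"
    then obtain u t where ut: "x = mir u t" "u \<noteq> 0" using Stab_mirabolic mirabolicE by blast
    then have "nv u = 1" using x mir_Stab by blast
    then show ?thesis using ut nv_diff_le[of u 1 1] by auto
  qed
  {
    assume b: "nv (b1 - b2) \<le> nv a2"
    show "Stab m b1 a1 \<inter> Stab m b2 a2 = Stab m b1 a1"
    proof (intro equalityI subsetI)
      fix x assume x: "x \<in> Stab m b1 a1"
      then obtain u t where ut: "x = mir u t" "u \<noteq> 0" "nv (u - 1) \<le> 1" using sub by blast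
      have "nv (u - 1) * nv (b1 - b2) \<le> nv (b1 - b2)" using ut(3) by (intro mult_left_le_one_le) auto
      then show "x \<in> Stab m b1 a1 \<inter> Stab m b2 a2" using cond[OF ut(2), of t] x ut(1) b by simp
    qed blast
  }
  {
    assume b: "nv (b1 - b2) > nv a2"
    then have d: "b1 - b2 \<noteq> 0" using nv_nonneg[of a2] by (metis nv_0 not_le)
    obtain n u where nu: "a2 / (b1 - b2) = of_nat p powi n * u" "nv u = 1"
      using unit_decomp[of "a2 / (b1 - b2)"] a d by auto
    have val: "nv a2 / nv (b1 - b2) = (1 / real p) powi n"
      using arg_cong[OF nu(1), of nv] nu(2) by (simp add: nv_mult nv_divide nv_powi nv_p)
    have "n \<ge> 1"
    proof (rule ccontr)
      assume "\<not> n \<ge> 1"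
      then have "real p powi 0 \<le> real p powi (- n)" using p_gt_1 by (intro power_int_increasing) auto
      moreover have "nv a2 / nv (b1 - b2) < 1" using b nv_pos[OF d] by (simp only: divide_less_eq_1_pos)
      ultimately show False unfolding val by (simp add: p_inv_powi)
    qed
    define l where "l = nat n"
    have l: "n = int l" "l \<ge> 1" using \<open>n \<ge> 1\<close> by (auto simp: l_def)
    have val': "nv (x) * nv (b1 - b2) \<le> nv a2 \<longleftrightarrow> nv x \<le> (1 / real p) ^ l" for x
      unfolding pos_le_divide_eq[OF nv_pos[OF d], symmetric] val by (simp add: l)
    have small: "(1 / real p) ^ l \<le> (1 / real p) ^ m"
      using l m p_gt_1 by (intro power_decreasing) auto
    have "Stab m b1 a1 \<inter> Stab m b2 a2 = Stab l b1 a1"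
    proof (intro equalityI subsetI)
      fix x assume x: "x \<in> Stab m b1 a1 \<inter> Stab m b2 a2"
      then obtain u t where ut: "x = mir u t" "u \<noteq> 0" using sub by blast
      then show "x \<in> Stab l b1 a1" using cond[OF ut(2), of t] x val' by (simp add: mir_Stab)
    next
      fix x assume x: "x \<in> Stab l b1 a1"
      then obtain u t where ut: "x = mir u t" "u \<noteq> 0" using Stab_mirabolic mirabolicE by blast
      then show "x \<in> Stab m b1 a1 \<inter> Stab m b2 a2" using cond[OF ut(2), of t] x val' small by (simp add: mir_Stab)
    qed
    then show "\<exists>n\<ge>1. Stab m b1 a1 \<inter> Stab m b2 a2 = Stab n b1 a1" using l by blast
  }
qed

end

lemma proots_quadratic:
  fixes b c :: complex
  obtains \<alpha> \<beta> where "proots [:c, - b, 1:] = {#\<alpha>, \<beta>#}" "\<alpha> + \<beta> = b" "\<alpha> * \<beta> = c"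
proof -
  have "\<not> constant (poly [:c, - b, 1:])" by (simp add: constant_degree)
  then obtain \<alpha> where a: "poly [:c, - b, 1:] \<alpha> = 0" using fundamental_theorem_of_algebra by blast
  then have c: "\<alpha> * (b - \<alpha>) = c" by (simp add: algebra_simps)
  then have "[:c, - b, 1:] = [:- \<alpha>, 1:] * [:- (b - \<alpha>), 1:]" by (simp add: algebra_simps)
  then have "proots [:c, - b, 1:] = proots [:- \<alpha>, 1:] + proots [:- (b - \<alpha>), 1:]"
    by (simp only: proots_mult pCons_eq_0_iff one_neq_zero simp_thms not_False_eq_True)
  then have "proots [:c, - b, 1:] = {#\<alpha>, b - \<alpha>#}" by simp
  then show ?thesis using that c by simp
qed

section \<open>Matching volumes with values of the form\<close>

locale rs_main = rs_form p nv \<psi>1 \<psi>2 V1 V2 R Z + padic_haar p nv vol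
  for p :: nat and nv :: "'k::field_char_0 \<Rightarrow> real" and \<psi>1 \<psi>2 V1 V2 R Z vol +
  assumes omega_ne: "\<exists>a. a \<noteq> 0 \<and> S1.\<omega> a \<noteq> inverse (S2.\<omega> a)"
    and norm: "Z v = 1 - S1.\<omega> (of_nat p) * S2.\<omega> (of_nat p)"
begin

text \<open>Both central characters are trivial on units, so their product is trivial as soon as it
  is \<open>1\<close> at \<open>p\<close>.\<close>

lemma omega_p_ne: "S1.\<omega> (of_nat p) * S2.\<omega> (of_nat p) \<noteq> 1"
proof
  let ?P = "of_nat p :: 'k"
  let ?c = "\<lambda>a. S1.\<omega> a * S2.\<omega> a"
  assume P: "?c ?P = 1"
  have mult: "?c (a * b) = ?c a * ?c b" if "a \<noteq> 0" "b \<noteq> 0" for a b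
    using that by (simp add: S1.omega_mult S2.omega_mult)
  have unit: "?c u = 1" if "nv u = 1" for u using S1.omega_unit[OF that] S2.omega_unit[OF that] by simp
  have pow: "?c (?P ^ n) = 1" for n
  proof (induction n)
    case (Suc n)
    then show ?case using mult[of ?P "?P ^ n"] P by simp
  qed (use unit[of 1] in simp)
  have powi: "?c (?P powi n) = 1" for n
  proof (cases "n \<ge> 0")
    case False
    have "?c (?P powi n * ?P ^ nat (- n)) = ?c (?P powi n)" using mult[of "?P powi n" "?P ^ nat (- n)"] pow by simp
    moreover have "?P powi n * ?P ^ nat (- n) = 1" using False by (simp add: power_int_def power_inverse)
    ultimately show ?thesis using unit[of 1] by simp
  qed (use pow in \<open>simp add: power_int_def\<close>)
  have "?c a = 1" if a: "a \<noteq> 0" for a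
  proof -
    obtain n u where nu: "a = ?P powi n * u" "nv u = 1" using unit_decomp[OF a] by blast
    then have "u \<noteq> 0" by auto
    then show ?thesis using mult[of "?P powi n" u] powi[of n] unit[OF nu(2)] nu(1) by simp
  qed
  then have "S1.\<omega> a = inverse (S2.\<omega> a)" if "a \<noteq> 0" for a
    using that by (metis inverse_unique mult.commute)
  then show False using omega_ne by blast
qed

sublocale C: ball_form_ring p nv F "S1.\<omega> (of_nat p)" "S2.\<omega> (of_nat p)" "S1.\<tau>" "S2.\<tau>" R
  by unfold_locales (use p_gt_0 R omega_R tau_R omega_p_ne F_base norm in auto)

text \<open>The four factors depend on the Satake parameters only through their sums and products,
  and the square roots of \<open>p\<close> occur in pairs.\<close>

lemma L_RS_value: "inverse (L_RS p nv V1 V2 0) = C.rs"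
proof -
  let ?s = "of_real (sqrt (real p)) :: complex"
  have s: "?s * ?s = of_nat p" "?s \<noteq> 0" using p_gt_0 by (simp_all flip: of_real_mult)
  obtain \<alpha>1 \<beta>1 where 1: "satake_params p nv V1 = {#\<alpha>1, \<beta>1#}" "\<alpha>1 + \<beta>1 = S1.\<tau> / ?s" "\<alpha>1 * \<beta>1 = S1.\<omega> (of_nat p)"
    using proots_quadratic[of "S1.\<omega> (of_nat p)" "S1.\<tau> / ?s"] unfolding satake_params_def satake_poly_def by auto
  obtain \<alpha>2 \<beta>2 where 2: "satake_params p nv V2 = {#\<alpha>2, \<beta>2#}" "\<alpha>2 + \<beta>2 = S2.\<tau> / ?s" "\<alpha>2 * \<beta>2 = S2.\<omega> (of_nat p)"
    using proots_quadratic[of "S2.\<omega> (of_nat p)" "S2.\<tau> / ?s"] unfolding satake_params_def satake_poly_def by auto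
  have "inverse (L_RS p nv V1 V2 0) = (1 - \<alpha>1 * \<alpha>2) * (1 - \<alpha>1 * \<beta>2) * ((1 - \<beta>1 * \<alpha>2) * (1 - \<beta>1 * \<beta>2))"
    unfolding L_RS_def 1(1) 2(1) by simp
  also have "\<dots> = (1 - (\<alpha>1 * \<beta>1) * (\<alpha>2 * \<beta>2))\<^sup>2 - (\<alpha>1 + \<beta>1) * (\<alpha>2 + \<beta>2) * (1 + (\<alpha>1 * \<beta>1) * (\<alpha>2 * \<beta>2))
      + ((\<alpha>1 * \<beta>1) * (\<alpha>2 + \<beta>2)\<^sup>2 + (\<alpha>2 * \<beta>2) * (\<alpha>1 + \<beta>1)\<^sup>2)"
    by (simp add: power2_eq_square algebra_simps)
  also have "\<dots> = C.rs"
  proof -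
    have prods: "(S1.\<tau> / ?s) * (S2.\<tau> / ?s) = S1.\<tau> * S2.\<tau> / of_nat p" "(S1.\<tau> / ?s)\<^sup>2 = S1.\<tau>\<^sup>2 / of_nat p"
      "(S2.\<tau> / ?s)\<^sup>2 = S2.\<tau>\<^sup>2 / of_nat p"
      unfolding power2_eq_square times_divide_times_eq s(1) by simp_all
    show ?thesis unfolding 1(2,3) 2(2,3) C.rs_def prods by (simp add: add_divide_distrib)
  qed
  finally show ?thesis .
qed

lemma inverse_measure_Stab:
  assumes "a \<noteq> 0"
  shows "\<exists>r\<in>R. inverse (of_real (measure vol (Stab n b a))) = (if n = 0 then r else (of_nat p - 1) * r)"
proof -
  have inv: "inverse (complex_of_real (nv a)) \<in> R"
  proof -
    have "inverse a \<noteq> 0" using assms by simp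
    from C.nv_R[OF this] show ?thesis by (simp add: nv_inverse)
  qed
  have "inverse (of_real (measure vol (Stab n b a))) = (if n = 0 then inverse (complex_of_real (nv a))
      else (of_nat p - 1) * (of_nat p ^ (n - 1) * inverse (complex_of_real (nv a))))"
    unfolding measure_Stab[OF assms] unit_index_def by (simp add: divide_inverse)
  moreover have "of_nat p ^ (n - 1) * inverse (complex_of_real (nv a)) \<in> R"
    by (intro C.R_mult C.R_power C.R_of_nat inv)
  ultimately show ?thesis using inv by auto
qed

lemma inverse_measure_Stab_Int:
  assumes a: "a1 \<noteq> 0" "a2 \<noteq> 0" and m: "m \<le> 1"
  shows "\<exists>r\<in>R. inverse (of_real (measure vol (Stab m b1 a1 \<inter> Stab m b2 a2))) =
    (if m = 0 \<and> nv (b1 - b2) \<le> max (nv a1) (nv a2) then r else (of_nat p - 1) * r)"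
proof -
  have *: "\<exists>r\<in>R. inverse (of_real (measure vol (Stab m b1 a1 \<inter> Stab m b2 a2))) =
    (if m = 0 \<and> nv (b1 - b2) \<le> nv a2 then r else (of_nat p - 1) * r)"
    if a: "a1 \<noteq> 0" "a2 \<noteq> 0" "nv a1 \<le> nv a2" for a1 a2 b1 b2
  proof (cases "nv (b1 - b2) \<le> nv a2")
    case True
    then show ?thesis using Stab_Int(1)[OF a m True] inverse_measure_Stab[OF a(1), of m b1] by simp
  next
    case False
    then obtain n where n: "n \<ge> 1" "Stab m b1 a1 \<inter> Stab m b2 a2 = Stab n b1 a1"
      using Stab_Int(2)[OF a m, of b1 b2] by auto
    then show ?thesis using False inverse_measure_Stab[OF a(1), of n b1] by simp
  qed
  show ?thesis
  proof (cases "nv a1 \<le> nv a2")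
    case True
    then show ?thesis using *[OF a True, of b1 b2] by (simp add: max_def)
  next
    case False
    then show ?thesis using *[OF a(2,1), of b2 b1] by (simp add: max_def Int_commute nv_diff_commute[of b2 b1])
  qed
qed

text \<open>The index \<open>m\<close> treats the two lattices at once and coincides with the level
  of the stabilisers \<open>Stab m\<close>.\<close>

abbreviation "Q m \<equiv> (if m = 0 then mirabolic else mirabolic1 p nv)"

lemma lattice_generator:
  assumes m: "m \<le> (1::nat)"
  shows "inverse (of_real (measure vol {x \<in> Q m. (x, x) \<in> conj_G_int nv g})) * Z (rtrans g v)
    \<in> (if m = 0 then R else C.I)"
proof -
  obtain g1 g2 where g: "g = (g1, g2)" by (cases g)
  obtain c1 a1 b1 k1 where g1: "g1 = scal c1 * mir a1 b1 * k1" "c1 \<noteq> 0" "a1 \<noteq> 0" "k1 \<in> K" by (rule iwasawa)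
  obtain c2 a2 b2 k2 where g2: "g2 = scal c2 * mir a2 b2 * k2" "c2 \<noteq> 0" "a2 \<noteq> 0" "k2 \<in> K" by (rule iwasawa)
  have set: "{x \<in> Q m. (x, x) \<in> conj_G_int nv g} = Stab m b1 a1 \<inter> Stab m b2 a2"
  proof -
    have "x \<in> {x \<in> Q m. (x, x) \<in> conj_G_int nv g} \<longleftrightarrow> x \<in> Stab m b1 a1 \<inter> Stab m b2 a2" for x
    proof (cases "x \<in> mirabolic")
      case True
      then obtain u t where ut: "x = mir u t" "u \<noteq> 0" by (rule mirabolicE)
      have "nv u = 1 \<Longrightarrow> nv (u - 1) \<le> 1" using nv_diff_le[of u 1 1] by simp
      then show ?thesis
        using m conj_G_int_iff[OF g1(1) g2(1) g1(2) g2(2) g1(3) g2(3) g1(4) g2(4) ut(2), of t] True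
        unfolding g ut(1) by (cases m) (auto simp: mir_Stab[OF ut(2)] mirabolic1_iff[OF ut(2)])
    next
      case False
      then show ?thesis using Stab_mirabolic by (auto simp: mirabolic1_def)
    qed
    then show ?thesis by blast
  qed
  have Zg: "Z (rtrans g v) = S1.\<omega> c1 * S2.\<omega> c2 * F a1 b1 a2 b2"
    using z_iwasawa[OF g1(2) g2(2) g1(4) g2(4)] by (simp add: g g1(1) g2(1) z_def)
  have w: "S1.\<omega> c1 * S2.\<omega> c2 \<in> R" using omega_R g1(2) g2(2) C.R_mult by blast
  obtain r where r: "r \<in> R" "inverse (of_real (measure vol (Stab m b1 a1 \<inter> Stab m b2 a2))) =
    (if m = 0 \<and> nv (b1 - b2) \<le> max (nv a1) (nv a2) then r else (of_nat p - 1) * r)"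
    using inverse_measure_Stab_Int[OF g1(3) g2(3) m] by blast
  show ?thesis
  proof (cases "m = 0 \<and> nv (b1 - b2) \<le> max (nv a1) (nv a2)")
    case True
    then have "F a1 b1 a2 b2 \<in> R" using C.F_nested[OF g1(3) g2(3)] by blast
    then have "r * (S1.\<omega> c1 * S2.\<omega> c2 * F a1 b1 a2 b2) \<in> R" by (intro C.R_mult r w)
    then show ?thesis unfolding set Zg r(2) using True by simp
  next
    case False
    \<comment> \<open>Either the balls are disjoint or \<open>m = 1\<close>; in both cases the
      inverse volume carries \<open>p - 1\<close>, which is moved onto \<open>F\<close>.\<close>
    have "r * (S1.\<omega> c1 * S2.\<omega> c2) * ((of_nat p - 1) * F a1 b1 a2 b2) \<in> C.I"
      by (intro C.ideal2_mult C.R_mult[OF r(1) w] C.F_I g1(3) g2(3))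
    moreover have "r * (S1.\<omega> c1 * S2.\<omega> c2) * ((of_nat p - 1) * F a1 b1 a2 b2) =
        (of_nat p - 1) * r * (S1.\<omega> c1 * S2.\<omega> c2 * F a1 b1 a2 b2)" by (simp add: mult_ac)
    ultimately have "(of_nat p - 1) * r * (S1.\<omega> c1 * S2.\<omega> c2 * F a1 b1 a2 b2) \<in> C.I" by simp
    then show ?thesis unfolding set Zg r(2) if_not_P[OF False] using C.I_subset by (cases "m = 0") auto
  qed
qed

lemma lattice_value:
  assumes m: "m \<le> (1::nat)" and G: "G \<in> int_lattice nv R vol (Q m) v"
  shows "Z G \<in> (if m = 0 then R else C.I)"
proof -
  let ?gen = "\<lambda>g y. inverse (of_real (measure vol {x \<in> Q m. (x, x) \<in> conj_G_int nv g})) * rtrans g v y"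
  obtain S c where S: "G = (\<lambda>x. \<Sum>b\<in>S. c b * b x)" "finite S" "S \<subseteq> {?gen g | g. True}" "\<forall>b\<in>S. c b \<in> R"
    using G unfolding int_lattice_def span_over_def by blast
  have gen: "b \<in> U \<and> Z b \<in> (if m = 0 then R else C.I)" if "b \<in> S" for b
  proof -
    obtain g where g: "b = ?gen g" using \<open>b \<in> S\<close> S(3) by blast
    have "b \<in> U" unfolding g using U_sum[of "{()}" "\<lambda>_. rtrans g v" "\<lambda>_. inverse (of_real (measure vol {x \<in> Q m. (x, x) \<in> conj_G_int nv g}))"] rtrans_v_mem
      by simp
    moreover have "Z b = inverse (of_real (measure vol {x \<in> Q m. (x, x) \<in> conj_G_int nv g})) * Z (rtrans g v)"
      unfolding g by (rule Z_scale[OF rtrans_v_mem])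
    ultimately show ?thesis using lattice_generator[OF m, of g] by simp
  qed
  have "Z G = (\<Sum>b\<in>S. c b * Z b)" unfolding S(1) using gen by (intro Z_sum S(2)) blast
  also have "\<dots> \<in> (if m = 0 then R else C.I)"
    using gen S(4) by (cases "m = 0") (auto intro!: C.R_sum C.ideal2_sum intro: C.R_mult C.ideal2_mult)
  finally show ?thesis .
qed

lemma integrality:
  "(\<forall>G\<in>int_lattice nv R vol mirabolic v. Z G \<in> R) \<and>
   ideal2 R (of_nat p - 1) (inverse (L_RS p nv V1 V2 0)) \<subseteq> R \<and>
   (\<forall>G\<in>int_lattice nv R vol (mirabolic1 p nv) v. Z G \<in> ideal2 R (of_nat p - 1) (inverse (L_RS p nv V1 V2 0)))"
  unfolding L_RS_value using lattice_value[of 0] lattice_value[of 1] C.I_subset by auto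

end

theorem theorem6p5:
  fixes p :: nat and nv :: "'k::field_char_0 \<Rightarrow> real" and \<psi> :: "'k \<Rightarrow> complex"
    and V1 V2 :: "('k gl2 \<Rightarrow> complex) set"
    and R :: "complex set"
    and Z :: "('k gl2 \<times> 'k gl2 \<Rightarrow> complex) \<Rightarrow> complex"
    and vol :: "'k gl2 measure"
  assumes "padic_field p nv"
    and "additive_character \<psi>" and "conductor_one p nv \<psi>"
    and "whittaker_type nv \<psi> V1" and "unramified_rep nv V1" and "in_whittaker_model \<psi> V1"
    and "whittaker_type nv (\<lambda>x. inverse (\<psi> x)) V2" and "unramified_rep nv V2"
    and "in_whittaker_model (\<lambda>x. inverse (\<psi> x)) V2"
    and "\<exists>a. a \<noteq> 0 \<and> central_char V1 a \<noteq> inverse (central_char V2 a)"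
    and "subalgebra_Z_inv p R"
    and "\<forall>\<phi>\<in>hecke_algebra_G nv R. Theta nv V1 V2 \<phi> \<in> R"
    and "Z \<in> Hom_P nv (tensor_rep V1 V2)"
    and "\<exists>F\<in>tensor_rep V1 V2. Z F \<noteq> 0"
    and "Z (v_sph nv V1 V2) = inverse (L_char p (\<lambda>a. central_char V1 a * central_char V2 a) 0)"
    and "haar_measure_P nv vol"
  shows "(\<forall>F\<in>int_lattice nv R vol mirabolic (v_sph nv V1 V2). Z F \<in> R) \<and>
         ideal2 R (of_nat p - 1) (inverse (L_RS p nv V1 V2 0)) \<subseteq> R \<and>
         (\<forall>F\<in>int_lattice nv R vol (mirabolic1 p nv) (v_sph nv V1 V2).
            Z F \<in> ideal2 R (of_nat p - 1) (inverse (L_RS p nv V1 V2 0)))"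
proof -
  \<comment> \<open>This gives \<open>of_nat p powr 0 = 1\<close> in the L-factor; the default is
    \<open>0 powr 0 = 0\<close>.\<close>
  have "p > 0" using assms(1) unfolding padic_field_def by (auto simp: prime_gt_0_nat)
  then have norm: "Z (v_sph nv V1 V2) = 1 - central_char V1 (of_nat p) * central_char V2 (of_nat p)"
    using assms(15) by (simp add: L_char_def)
  have psi2: "conductor_one p nv (\<lambda>x. inverse (\<psi> x))"
    using assms(3) unfolding conductor_one_def by (metis inverse_1 inverse_eq_1_iff)
  interpret rs_main p nv \<psi> "\<lambda>x. inverse (\<psi> x)" V1 V2 R Z vol
    by unfold_locales (rule assms(1,3-13,16) psi2 norm)+
  show ?thesis by (rule integrality)
qed

end
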